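(* Let $2^*_s=\frac{2N}{N-2s}$ and let $f\colon[0,\infty)\to\mathbb{R}$ be a continuous function that satisfies (1) $f'(t)\ge0$ and $f''(t)\ge0$ for all $t\in[0,\infty)$; (2) for any $\beta\in(1,2^*_s-1)$ there exists $q\in[2,2^*_s]$ with $q>\max\left\{\beta,\frac{N(\beta-1)}{2s}\right\}$ such that $f'(w)\in L^{q/(\beta-1)}(\mathbb{R}^N)$ for all $w\in H^s(\mathbb{R}^N)$. For any $0<s<1$, $N>2s$ and $m\in\mathbb{R}\setminus\{0\}$, if $u(x)$ is a positive solution of $(-\Delta+m^2)^su=f(u)$ in $\mathbb{R}^N$, then $u$ is radially symmetric and decreasing with respect to the origin.
   Context: $N$ is a positive integer. Fourier transform: $\hat u(\xi)=\mathcal F(u)(\xi)=\int_{\mathbb{R}^N}e^{-2\pi i x\cdot\xi}u(x)\,dx$. For $\sigma\in(0,1)$, $(-\Delta+m^2)^{\sigma}u=\mathcal F^{-1}\big((m^2+4\pi^2|\cdot|^2)^{\sigma}\hat u\big)$. $H^s(\mathbb{R}^N)$ is the space of real-valued $u\in L^2(\mathbb{R}^N)$ with $\int_{\mathbb{R}^N}(m^2+4\pi^2|\xi|^2)^s|\hat u(\xi)|^2d\xi<\infty$. A solution of $(-\Delta+m^2)^su=f(u)$ is a function $u\in H^s(\mathbb{R}^N)$ such that $\int_{\mathbb{R}^N}(-\Delta+m^2)^{s/2}u\,(-\Delta+m^2)^{s/2}v\,dx=\int_{\mathbb{R}^N}f(u)v\,dx$ for all $v\in H^s(\mathbb{R}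^N)$.
   Formalization: "With respect to the origin" is replaced by "with respect to some point": some translate of u is radially symmetric and decreasing about the origin; literally the claim fails, since every translate of a positive solution is again a positive solution. *)

theory Defs
  imports "HOL-Analysis.Analysis"
begin

definition Lp :: "real \<Rightarrow> (real^'n \<Rightarrow> 'b::{banach, second_countable_topology}) set" where
  "Lp p = {u. u \<in> borel_measurable lebesgue \<and> integrable lebesgue (\<lambda>x. norm (u x) powr p)}"

definition fourier :: "(real^'n \<Rightarrow> complex) \<Rightarrow> real^'n \<Rightarrow> complex" where
  "fourier u \<xi> = (\<integral>x. cis (- 2 * pi * (x \<bullet> \<xi>)) * u x \<partial>lebesgue)"

text \<open>The Fourier integral of a square integrable function need not converge, so its transform is
  the limit in the mean of the transforms of its truncations to balls. The limit is determined up
  to a null set, and an arbitrary representative is chosen.\<close>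

definition fourier_L2 :: "(real^'n \<Rightarrow> complex) \<Rightarrow> real^'n \<Rightarrow> complex" where
  "fourier_L2 u = (SOME g. g \<in> Lp 2 \<and>
     ((\<lambda>R. \<integral>\<^sup>+\<xi>. ennreal ((norm (fourier (\<lambda>x. indicator (ball 0 R) x *\<^sub>R u x) \<xi> - g \<xi>))\<^sup>2) \<partial>lebesgue)
        \<longlongrightarrow> 0) at_top)"

text \<open>Changing the sign in the exponential of the Fourier integral amounts to a reflection.\<close>

definition inv_fourier_L2 :: "(real^'n \<Rightarrow> complex) \<Rightarrow> real^'n \<Rightarrow> complex" where
  "inv_fourier_L2 g x = fourier_L2 g (- x)"

text \<open>The operator \<open>(-\<Delta> + m\<^sup>2)\<^sup>\<sigma>\<close>. Its values are complex by construction, although almost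
  everywhere real for real-valued \<open>u\<close>.\<close>

definition frac_op :: "real \<Rightarrow> real \<Rightarrow> (real^'n \<Rightarrow> real) \<Rightarrow> real^'n \<Rightarrow> complex" where
  "frac_op m \<sigma> u = inv_fourier_L2
     (\<lambda>\<xi>. of_real ((m\<^sup>2 + 4 * pi\<^sup>2 * (norm \<xi>)\<^sup>2) powr \<sigma>) * fourier_L2 (\<lambda>x. of_real (u x)) \<xi>)"

definition Hs :: "real \<Rightarrow> real \<Rightarrow> (real^'n \<Rightarrow> real) set" where
  "Hs m s = {u. u \<in> Lp 2 \<and> integrable lebesgue
     (\<lambda>\<xi>. (m\<^sup>2 + 4 * pi\<^sup>2 * (norm \<xi>)\<^sup>2) powr s * (norm (fourier_L2 (\<lambda>x. of_real (u x)) \<xi>))\<^sup>2)}"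

text \<open>Integrability of \<open>f(u) v\<close> has to be required explicitly, because the Bochner integral
  of a non-integrable function is 0 by convention.\<close>

definition weak_solution :: "real \<Rightarrow> real \<Rightarrow> (real \<Rightarrow> real) \<Rightarrow> (real^'n \<Rightarrow> real) \<Rightarrow> bool" where
  "weak_solution m s f u \<longleftrightarrow> u \<in> Hs m s \<and>
     (\<forall>v \<in> Hs m s. integrable lebesgue (\<lambda>x. f (u x) * v x) \<and>
        (\<integral>x. frac_op m (s/2) u x * frac_op m (s/2) v x \<partial>lebesgue)
          = of_real (\<integral>x. f (u x) * v x \<partial>lebesgue))"

definition crit_exp :: "nat \<Rightarrow> real \<Rightarrow> real" where
  "crit_exp N s = 2 * real N / (real N - 2 * s)"

text \<open>The profile is attained almost everywhere only, since elements of \<open>L\<^sup>2\<close> are considered up to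
  null sets; decreasing means strictly decreasing.\<close>

definition radially_decreasing :: "(real^'n \<Rightarrow> real) \<Rightarrow> bool" where
  "radially_decreasing u \<longleftrightarrow> (\<exists>g :: real \<Rightarrow> real.
     (\<forall>r t. 0 \<le> r \<and> r < t \<longrightarrow> g t < g r) \<and> (AE x in lebesgue. u x = g (norm x)))"

end

theory Submission
  imports Defs "HOL-Probability.Characteristic_Functions"
begin

text \<open>The Bessel kernel, i.e. the kernel of \<open>(-\<Delta> + m\<^sup>2)\<^sup>-\<^sup>s\<close>, is a superposition of heat kernels, hence
  positive and strictly radially decreasing. Testing the weak equation with Bessel potentials of
  Gaussians, for which every Fourier transform is explicit, turns it into the integral equation that
  \<open>u\<close> is the convolution of the Bessel kernel with \<open>f(u)\<close>. The integrability of \<open>f'(u)\<close>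
  in \<open>L\<^sup>p\<close> for some \<open>p > N/(2s)\<close> makes potentials cut down to suitable sets small; by the Schur
  test, nonnegative subsolutions of the linear integral equation with a small potential vanish. This
  yields boundedness (and then continuity) of \<open>u\<close>, and it starts and continues the method of moving
  planes for the integral equation. In every direction the planes stop at a plane of symmetry, and
  all these planes pass through one point.\<close>

subsection \<open>Gaussians and their Fourier transforms\<close>

text \<open>The unknown enters the weak equation through limits in the mean of which only some
  representative is given. Test functions are therefore chosen so explicit that the multiplication
  formula moves every transform onto them; the Gaussian factor keeps them and their transforms
  absolutely integrable. The exponent p comes from assumption (2) with \<beta> equal to half the
  critical exponent: then q/(\<beta> - 1) exceeds both 1 and N/(2s). Convexity enters as f(b) - f(a)
  \<le> f'(b) (b - a), which makes f'(u) the potential of a linear inequality. In place of pointwise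
  decay of u, dominated convergence makes f'(u)^p small over sets that shrink to a null set; this
  covers planes far away as well as planes just beyond the limiting one. Two complications shape the
  details. The value f(0) may be nonzero, so that only f(u) - f(0) is a nonnegative source, and the
  constant is carried along with the total mass of the kernel. And u is given up to null sets, so
  that the potential of f(u) has to supply the continuous function to which the planes are
  applied.\<close>

lemma lborel_integral_prod:
  fixes f :: "'a::euclidean_space \<Rightarrow> real \<Rightarrow> 'b::{real_normed_field, banach, second_countable_topology}"
  assumes f: "\<And>b. b \<in> Basis \<Longrightarrow> integrable lborel (f b)"
  shows "integrable lborel (\<lambda>x. \<Prod>b\<in>Basis. f b (x \<bullet> b))"
    and "(\<integral>x. (\<Prod>b\<in>Basis. f b (x \<bullet> b)) \<partial>lborel) = (\<Prod>b\<in>Basis. \<integral>x. f b x \<partial>lborel)"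
proof -
  interpret product_sigma_finite "\<lambda>_::'a. lborel :: real measure"
    by standard
  have [measurable]: "f b \<in> borel_measurable borel" if "b \<in> Basis" for b
    using borel_measurable_integrable[OF f[OF that]] by simp
  have m1: "(\<lambda>x. \<Prod>b\<in>Basis. f b (x \<bullet> b)) \<in> borel_measurable borel"
    by measurable
  have m2: "(\<lambda>f. \<Sum>b\<in>Basis. f b *\<^sub>R b :: 'a) \<in> (\<Pi>\<^sub>M b\<in>Basis. lborel) \<rightarrow>\<^sub>M borel"
    by measurable
  have eq: "(\<Prod>b\<in>Basis. f b ((\<Sum>c\<in>Basis. x c *\<^sub>R c) \<bullet> b)) = (\<Prod>b\<in>Basis. f b (x b))" for x :: "'a \<Rightarrow> real"
    by (rule prod.cong) auto
  show "integrable lborel (\<lambda>x. \<Prod>b\<in>Basis. f b (x \<bullet> b))"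
    unfolding lborel_eq[where 'a='a]
    by (subst integrable_distr_eq[OF m2 m1]) (simp add: eq product_integrable_prod f)
  show "(\<integral>x. (\<Prod>b\<in>Basis. f b (x \<bullet> b)) \<partial>lborel) = (\<Prod>b\<in>Basis. \<integral>x. f b x \<partial>lborel)"
    by (subst lborel_eq[where 'a='a], subst integral_distr[OF m2 m1])
       (simp add: eq product_integral_prod f)
qed

text \<open>A scaling of the variable by c with c^2 = 2 t turns the Gaussian into the standard
  normal density, and the integral into the characteristic function of the standard normal law at
  \<open>w\<close>.\<close>

lemma gaussian_fourier_real:
  fixes t y :: real
  assumes t: "t > 0"
  shows "integrable lborel (\<lambda>x. cis (- 2 * pi * (x * y)) * of_real (exp (- (x\<^sup>2) / (4 * t))))"
    and "(\<integral>x. cis (- 2 * pi * (x * y)) * of_real (exp (- (x\<^sup>2) / (4 * t))) \<partial>lborel)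
      = of_real (sqrt (4 * pi * t) * exp (- 4 * pi\<^sup>2 * t * y\<^sup>2))"
proof -
  define c where "c = sqrt (2 * t)"
  have c: "c > 0" "c\<^sup>2 = 2 * t" "c * c = 2 * t"
    using t by (auto simp: c_def)
  define g where "g = (\<lambda>x. cis (- 2 * pi * (x * y)) * of_real (exp (- (x\<^sup>2) / (4 * t))))"
  define w where "w = - 2 * pi * c * y"
  have g: "g (0 + c * x) = of_real (sqrt (2 * pi)) * (of_real (std_normal_density x) * iexp (w * x))" for x
    using c t unfolding g_def w_def std_normal_density_def
    by (simp add: power_mult_distrib cis_conv_exp field_simps real_sqrt_mult flip: of_real_mult)
  have i: "integrable lborel (\<lambda>x. of_real (std_normal_density x) * iexp (w * x))"
    by (rule Bochner_Integration.integrable_bound[where f=std_normal_density])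
       (auto simp: norm_mult integrable_std_normal_moment)
  have "integrable lborel (\<lambda>x. g (0 + c * x))"
    unfolding g by (intro integrable_mult_right i)
  then show "integrable lborel (\<lambda>x. cis (- 2 * pi * (x * y)) * of_real (exp (- (x\<^sup>2) / (4 * t))))"
    using lborel_integrable_real_affine_iff[of c g 0] c unfolding g_def by simp
  have "integral\<^sup>L lborel g = \<bar>c\<bar> *\<^sub>R (\<integral>x. g (0 + c * x) \<partial>lborel)"
    using c by (intro lborel_integral_real_affine) auto
  also have "(\<integral>x. g (0 + c * x) \<partial>lborel) = of_real (sqrt (2 * pi)) * char std_normal_distribution w"
    unfolding g char_def
    by (simp add: integral_density scaleR_conv_of_real)
  also have "char std_normal_distribution w = of_real (exp (- (w\<^sup>2) / 2))"
    by (simp add: char_std_normal_distribution)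
  also have "w\<^sup>2 / 2 = 4 * pi\<^sup>2 * t * y\<^sup>2"
    using c by (simp add: w_def power_mult_distrib)
  hence "- (w\<^sup>2) / 2 = - 4 * pi\<^sup>2 * t * y\<^sup>2" by simp
  also have "\<bar>c\<bar> *\<^sub>R (complex_of_real (sqrt (2 * pi)) * complex_of_real (exp (- 4 * pi\<^sup>2 * t * y\<^sup>2)))
     = of_real ((c * sqrt (2 * pi)) * exp (- 4 * pi\<^sup>2 * t * y\<^sup>2))"
    using c by (simp add: scaleR_conv_of_real)
  also have "c * sqrt (2 * pi) = sqrt (4 * pi * t)"
    using c by (intro real_sqrt_unique[symmetric]) (auto simp: power_mult_distrib)
  finally show "(\<integral>x. cis (- 2 * pi * (x * y)) * of_real (exp (- (x\<^sup>2) / (4 * t))) \<partial>lborel)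
      = of_real (sqrt (4 * pi * t) * exp (- 4 * pi\<^sup>2 * t * y\<^sup>2))"
    unfolding g_def .
qed

text \<open>The multiplier of exp(t \<Delta>): with the factor 2 pi in the exponential of
  \<open>fourier\<close>, the operator -\<Delta> becomes multiplication by 4 pi^2 |\<xi>|^2. The
  corresponding kernel is \<open>heat_kernel t\<close>.\<close>

abbreviation gaussian :: "real \<Rightarrow> 'a::real_normed_vector \<Rightarrow> real" where
  "gaussian t \<xi> \<equiv> exp (- 4 * pi\<^sup>2 * t * (norm \<xi>)\<^sup>2)"

definition heat_kernel :: "real \<Rightarrow> 'a::euclidean_space \<Rightarrow> real" where
  "heat_kernel t x = (4 * pi * t) powr (- real DIM('a) / 2) * exp (- (norm x)\<^sup>2 / (4 * t))"

lemma prod_cis: "finite A \<Longrightarrow> (\<Prod>a\<in>A. cis (f a)) = cis (\<Sum>a\<in>A. f a)"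
  by (induction A rule: finite_induct) (auto simp: cis_mult)

lemma norm_sq_Basis: "(norm (x::'a::euclidean_space))\<^sup>2 = (\<Sum>b\<in>Basis. (x \<bullet> b)\<^sup>2)"
  unfolding power2_norm_eq_inner
  by (subst euclidean_inner) (simp add: power2_eq_square)

lemma heat_kernel_nonneg [simp]: "heat_kernel t x \<ge> 0"
  by (simp add: heat_kernel_def)

lemma heat_kernel_pos: "t > 0 \<Longrightarrow> heat_kernel t x > 0"
  by (simp add: heat_kernel_def)

lemma heat_kernel_le: "t > 0 \<Longrightarrow> heat_kernel t (x::'a::euclidean_space) \<le> (4 * pi * t) powr (- real DIM('a) / 2)"
  by (simp add: heat_kernel_def mult_le_cancel_left1)

lemma heat_kernel_antimono:
  assumes "t > 0" "norm x \<le> norm y"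
  shows "heat_kernel t (y::'a::euclidean_space) \<le> heat_kernel t (x::'a)"
proof -
  have "(norm x)\<^sup>2 \<le> (norm y)\<^sup>2"
    using assms by (intro power_mono) auto
  then show ?thesis
    unfolding heat_kernel_def using assms by (intro mult_left_mono) (auto simp: divide_right_mono)
qed

lemma heat_kernel_minus [simp]: "heat_kernel t (- x) = heat_kernel t x"
  by (simp add: heat_kernel_def)

lemma heat_kernel_commute: "heat_kernel t (x - y) = heat_kernel t (y - x)"
  by (simp add: heat_kernel_def norm_minus_commute)

lemma measurable_heat_kernel [measurable]:
  "(\<lambda>p. heat_kernel (fst p) (snd p)) \<in> borel_measurable (borel \<Otimes>\<^sub>M borel)"
  unfolding heat_kernel_def by measurable

lemma measurable_heat_kernel' [measurable (raw)]:
  assumes "f \<in> borel_measurable M" "g \<in> borel_measurable M"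
  shows "(\<lambda>x. heat_kernel (f x) (g x)) \<in> borel_measurable M"
  using measurable_compose[OF measurable_Pair[OF assms] measurable_heat_kernel] by simp

lemma heat_kernel_fourier:
  fixes \<xi> :: "'a::euclidean_space"
  assumes t: "t > 0"
  shows "integrable lborel (\<lambda>x. cis (- 2 * pi * (x \<bullet> \<xi>)) * of_real (heat_kernel t x))"
    and "(\<integral>x. cis (- 2 * pi * (x \<bullet> \<xi>)) * of_real (heat_kernel t x) \<partial>lborel)
      = of_real (gaussian t \<xi>)"
proof -
  define f where "f = (\<lambda>(b::'a) x. cis (- 2 * pi * (x * (\<xi> \<bullet> b))) * complex_of_real (exp (- (x\<^sup>2) / (4 * t))))"
  have fi: "integrable lborel (f b)" for b
    unfolding f_def by (rule gaussian_fourier_real(1)[OF t])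
  define K where "K = (4 * pi * t) powr (- real DIM('a) / 2)"
  have eq: "cis (- 2 * pi * (x \<bullet> \<xi>)) * of_real (heat_kernel t x) = of_real K * (\<Prod>b\<in>Basis. f b (x \<bullet> b))" for x
  proof -
    have "(\<Prod>b\<in>Basis. f b (x \<bullet> b)) = cis (\<Sum>b\<in>Basis. - 2 * pi * ((x \<bullet> b) * (\<xi> \<bullet> b)))
       * of_real (exp (\<Sum>b\<in>Basis. - ((x \<bullet> b)\<^sup>2) / (4 * t)))"
      unfolding f_def by (simp only: prod.distrib prod_cis finite_Basis exp_sum of_real_prod)
    also have "(\<Sum>b\<in>Basis. - 2 * pi * ((x \<bullet> b) * (\<xi> \<bullet> b))) = - 2 * pi * (x \<bullet> \<xi>)"
      by (subst euclidean_inner[of x \<xi>]) (simp add: sum_distrib_left)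
    also have "(\<Sum>b\<in>Basis. - ((x \<bullet> b)\<^sup>2) / (4 * t)) = - (norm x)\<^sup>2 / (4 * t)"
      by (simp only: norm_sq_Basis sum_divide_distrib[symmetric] sum_negf)
    finally show ?thesis
      by (simp add: heat_kernel_def K_def)
  qed
  show "integrable lborel (\<lambda>x. cis (- 2 * pi * (x \<bullet> \<xi>)) * of_real (heat_kernel t x))"
    unfolding eq by (intro integrable_mult_right lborel_integral_prod fi)
  have "(\<integral>x. cis (- 2 * pi * (x \<bullet> \<xi>)) * of_real (heat_kernel t x) \<partial>lborel)
     = of_real K * (\<Prod>b\<in>Basis. \<integral>x. f b x \<partial>lborel)"
    unfolding eq by (simp add: lborel_integral_prod fi)
  also have "(\<Prod>b\<in>Basis. \<integral>x. f b x \<partial>lborel)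
     = of_real (\<Prod>b\<in>Basis. sqrt (4 * pi * t) * exp (- 4 * pi\<^sup>2 * t * (\<xi> \<bullet> b)\<^sup>2))"
    unfolding f_def by (simp only: gaussian_fourier_real(2)[OF t] of_real_prod)
  also have "(\<Prod>b\<in>Basis. sqrt (4 * pi * t) * exp (- 4 * pi\<^sup>2 * t * (\<xi> \<bullet> b)\<^sup>2))
     = sqrt (4 * pi * t) ^ DIM('a) * gaussian t \<xi>"
    by (simp add: prod.distrib norm_sq_Basis sum_distrib_left flip: exp_sum sum_negf)
  also have "of_real K * complex_of_real \<dots> = of_real ((K * sqrt (4 * pi * t) ^ DIM('a)) * gaussian t \<xi>)"
    by simp
  also have "K * sqrt (4 * pi * t) ^ DIM('a) = 1"
  proof -
    have "sqrt (4 * pi * t) ^ DIM('a) = (4 * pi * t) powr (real DIM('a) / 2)"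
      using t by (simp add: powr_half_sqrt[symmetric] powr_powr flip: powr_realpow)
    then show ?thesis
      using t by (simp add: K_def flip: powr_add)
  qed
  finally show "(\<integral>x. cis (- 2 * pi * (x \<bullet> \<xi>)) * of_real (heat_kernel t x) \<partial>lborel)
      = of_real (gaussian t \<xi>)"
    by simp
qed

lemma integrable_heat_kernel: "t > 0 \<Longrightarrow> integrable lborel (heat_kernel t :: 'a::euclidean_space \<Rightarrow> real)"
  using heat_kernel_fourier(1)[of t "0::'a"] by (simp add: complex_of_real_integrable_eq)

lemma integral_heat_kernel: "t > 0 \<Longrightarrow> integral\<^sup>L lborel (heat_kernel t :: 'a::euclidean_space \<Rightarrow> real) = 1"
proof -
  assume "t > 0"
  then have "complex_of_real (integral\<^sup>L lborel (heat_kernel t :: 'a \<Rightarrow> real)) = 1"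
    using heat_kernel_fourier(2)[of t "0::'a"] by simp
  then show ?thesis by simp
qed

text \<open>Up to a factor, a Gaussian in frequency is again a heat kernel, at the dual time 1/(16
  pi^2 t). Through this identity \<open>heat_kernel_fourier\<close> also yields the transform of the
  Gaussian, which is Fourier inversion for this family.\<close>

lemma gaussian_eq_heat_kernel:
  assumes t: "t > 0"
  shows "exp (- 4 * pi\<^sup>2 * t * (norm (\<xi>::'a::euclidean_space))\<^sup>2)
    = (4 * pi * t) powr (- real DIM('a) / 2) * heat_kernel (1 / (16 * pi\<^sup>2 * t)) \<xi>"
proof -
  have "4 * pi * (1 / (16 * pi\<^sup>2 * t)) = inverse (4 * pi * t)"
    using t by (simp add: field_simps power2_eq_square)
  then have "(4 * pi * (1 / (16 * pi\<^sup>2 * t))) powr (- real DIM('a) / 2) = inverse (4 * pi * t) powr (- real DIM('a) / 2)"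
    by (rule arg_cong)
  also have "\<dots> = (4 * pi * t) powr (real DIM('a) / 2)"
    unfolding minus_divide_left[symmetric] inverse_powr powr_minus by (rule inverse_inverse_eq)
  finally have "(4 * pi * (1 / (16 * pi\<^sup>2 * t))) powr (- real DIM('a) / 2) = (4 * pi * t) powr (real DIM('a) / 2)" .
  then have "(4 * pi * t) powr (- real DIM('a) / 2) * (4 * pi * (1 / (16 * pi\<^sup>2 * t))) powr (- real DIM('a) / 2) = 1"
    using t by (simp only: powr_add[symmetric]) simp
  moreover have "- (norm \<xi>)\<^sup>2 / (4 * (1 / (16 * pi\<^sup>2 * t))) = - 4 * pi\<^sup>2 * t * (norm \<xi>)\<^sup>2"
    using t by (simp add: field_simps)
  ultimately show ?thesis
    unfolding heat_kernel_def by (simp only: mult.assoc[symmetric] mult_1_left)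
qed

lemma gaussian_fourier:
  fixes x :: "'a::euclidean_space"
  assumes t: "t > 0"
  shows "integrable lborel (\<lambda>\<xi>. cis (- 2 * pi * (\<xi> \<bullet> x)) * of_real (gaussian t \<xi>))"
    and "(\<integral>\<xi>. cis (- 2 * pi * (\<xi> \<bullet> x)) * of_real (gaussian t \<xi>) \<partial>lborel)
      = of_real (heat_kernel t x)"
proof -
  define r where "r = 1 / (16 * pi\<^sup>2 * t)"
  have r: "r > 0" using t by (simp add: r_def)
  define K where "K = (4 * pi * t) powr (- real DIM('a) / 2)"
  have eq: "cis (- 2 * pi * (\<xi> \<bullet> x)) * of_real (gaussian t \<xi>)
    = of_real K * (cis (- 2 * pi * (\<xi> \<bullet> x)) * of_real (heat_kernel r \<xi>))" for \<xi> :: 'a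
    unfolding gaussian_eq_heat_kernel[OF t] r_def K_def by simp
  show "integrable lborel (\<lambda>\<xi>. cis (- 2 * pi * (\<xi> \<bullet> x)) * of_real (gaussian t \<xi>))"
    unfolding eq by (intro integrable_mult_right heat_kernel_fourier r)
  have "4 * pi\<^sup>2 * r * (norm x)\<^sup>2 = (norm x)\<^sup>2 / (4 * t)"
    using t by (simp add: r_def field_simps)
  then have "gaussian r x = exp (- (norm x)\<^sup>2 / (4 * t))"
    by simp
  then show "(\<integral>\<xi>. cis (- 2 * pi * (\<xi> \<bullet> x)) * of_real (gaussian t \<xi>) \<partial>lborel)
      = of_real (heat_kernel t x)"
    unfolding eq integral_mult_right_zero heat_kernel_fourier(2)[OF r]
    by (simp add: heat_kernel_def K_def)
qed

section \<open>Lebesgue integrals under translations and linear isometries\<close>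

lemma nn_integral_lborel_translation:
  fixes f :: "'a::euclidean_space \<Rightarrow> ennreal"
  assumes [measurable]: "f \<in> borel_measurable borel"
  shows "(\<integral>\<^sup>+x. f (c + x) \<partial>lborel) = (\<integral>\<^sup>+x. f x \<partial>lborel)"
proof -
  have "(\<integral>\<^sup>+x. f x \<partial>lborel) = (\<integral>\<^sup>+x. f x \<partial>distr lborel borel ((+) c))"
    by (simp add: lborel_distr_plus)
  also have "\<dots> = (\<integral>\<^sup>+x. f (c + x) \<partial>lborel)"
    by (rule nn_integral_distr) simp_all
  finally show ?thesis by simp
qed

lemma nn_integral_heat_kernel_diff:
  fixes x :: "'a::euclidean_space"
  assumes t: "t > 0"
  shows "(\<integral>\<^sup>+y. ennreal (heat_kernel t (y - x)) \<partial>lborel) = 1"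
    and "(\<integral>\<^sup>+y. ennreal (heat_kernel t (x - y)) \<partial>lborel) = 1"
proof -
  have "(\<integral>\<^sup>+y. ennreal (heat_kernel t (- x + y)) \<partial>lborel) = (\<integral>\<^sup>+y. ennreal (heat_kernel t (y::'a)) \<partial>lborel)"
    by (rule nn_integral_lborel_translation[of "\<lambda>y. ennreal (heat_kernel t y)"]) measurable
  also have "\<dots> = 1"
    by (simp add: nn_integral_eq_integral integrable_heat_kernel integral_heat_kernel t)
  finally show *: "(\<integral>\<^sup>+y. ennreal (heat_kernel t (y - x)) \<partial>lborel) = 1"
    by simp
  then show "(\<integral>\<^sup>+y. ennreal (heat_kernel t (x - y)) \<partial>lborel) = 1"
    by (subst (asm) heat_kernel_commute)
qed

text \<open>Uniqueness of translation invariant measures, with the rotation invariant function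
  \<open>heat_kernel 1\<close> as the normalizing weight.\<close>

lemma nn_integral_lborel_isometry:
  fixes R :: "'a::euclidean_space \<Rightarrow> 'a" and h :: "'a \<Rightarrow> ennreal"
  assumes lin: "linear R" and norm_R: "\<And>x. norm (R x) = norm x"
    and [measurable]: "h \<in> borel_measurable borel"
  shows "(\<integral>\<^sup>+x. h (R x) \<partial>lborel) = (\<integral>\<^sup>+x. h x \<partial>lborel)"
proof -
  have contR: "continuous_on UNIV R"
    using lin by (simp add: linear_continuous_on linear_conv_bounded_linear)
  then have [measurable]: "R \<in> borel_measurable borel"
    by (rule borel_measurable_continuous_onI)
  have "inj R"
    using lin norm_R by (metis linear_injective_0 norm_eq_zero)
  then have "surj R"
    using lin linear_injective_imp_surjective by blast
  have inv: "(\<integral>\<^sup>+x. f (R x + a) \<partial>lborel) = (\<integral>\<^sup>+x. f (R x) \<partial>lborel)"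
    if [measurable]: "f \<in> borel_measurable borel" for f :: "'a \<Rightarrow> ennreal" and a
  proof -
    obtain b where a: "a = R b"
      using \<open>surj R\<close> by blast
    have "(\<integral>\<^sup>+x. f (R x + a) \<partial>lborel) = (\<integral>\<^sup>+x. f (R (b + x)) \<partial>lborel)"
      using linear_add[OF lin] by (simp add: a add.commute)
    also have "\<dots> = (\<integral>\<^sup>+x. f (R x) \<partial>lborel)"
      by (rule nn_integral_lborel_translation[of "\<lambda>x. f (R x)"]) measurable
    finally show ?thesis .
  qed
  define k where "k = (\<lambda>x::'a. ennreal (heat_kernel 1 x))"
  have [measurable]: "k \<in> borel_measurable borel"
    unfolding k_def by measurable
  have kR: "k (R x) = k x" for x
    by (simp add: k_def heat_kernel_def norm_R)
  have k1: "(\<integral>\<^sup>+y. k y \<partial>lborel) = 1"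
    using nn_integral_heat_kernel_diff(1)[of 1 0] by (simp add: k_def)
  \<comment> \<open>The double integral of h(R x + y) k(y) is evaluated in both orders. Shifting y
    by R x moves the isometry from \<open>h\<close> into the argument of \<open>k\<close>, where
    invariance of the norm removes it.\<close>
  have "(\<integral>\<^sup>+x. h (R x) \<partial>lborel) = (\<integral>\<^sup>+y. (\<integral>\<^sup>+x. h (R x) \<partial>lborel) * k y \<partial>lborel)"
    by (simp add: nn_integral_cmult k1)
  also have "\<dots> = (\<integral>\<^sup>+y. (\<integral>\<^sup>+x. h (R x + y) * k y \<partial>lborel) \<partial>lborel)"
    by (simp add: nn_integral_multc inv)
  also have "\<dots> = (\<integral>\<^sup>+x. (\<integral>\<^sup>+y. h (R x + y) * k y \<partial>lborel) \<partial>lborel)"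
    by (rule lborel_pair.Fubini'[of "\<lambda>x y. h (R x + y) * k y", simplified]) measurable
  also have "\<dots> = (\<integral>\<^sup>+x. (\<integral>\<^sup>+y. h y * k (y - R x) \<partial>lborel) \<partial>lborel)"
    using nn_integral_lborel_translation[of "\<lambda>y. h y * k (y - R x)" "R x" for x]
    by simp
  also have "\<dots> = (\<integral>\<^sup>+y. (\<integral>\<^sup>+x. h y * k (y - R x) \<partial>lborel) \<partial>lborel)"
    by (rule lborel_pair.Fubini'[of "\<lambda>y x. h y * k (y - R x)", simplified]) measurable
  also have "\<dots> = (\<integral>\<^sup>+y. h y * (\<integral>\<^sup>+x. k (R x + (- y)) \<partial>lborel) \<partial>lborel)"
    by (simp add: nn_integral_cmult k_def heat_kernel_commute)
  also have "\<dots> = (\<integral>\<^sup>+y. h y * (\<integral>\<^sup>+x. k (R x) \<partial>lborel) \<partial>lborel)"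
    by (subst inv) simp_all
  also have "\<dots> = (\<integral>\<^sup>+x. h x \<partial>lborel)"
    by (simp add: kR k1)
  finally show ?thesis .
qed

lemma measurable_cis [measurable]: "cis \<in> borel_measurable borel"
  by (intro borel_measurable_continuous_onI continuous_intros)

lemma measurable_cnj [measurable]: "cnj \<in> borel_measurable borel"
  by (intro borel_measurable_continuous_onI continuous_intros)

section \<open>Fourier integrals of integrable functions\<close>

lemma fourier_eq_lborel:
  assumes [measurable]: "g \<in> borel_measurable borel"
  shows "fourier g \<xi> = (\<integral>x. cis (- 2 * pi * (x \<bullet> \<xi>)) * g x \<partial>lborel)"
  unfolding fourier_def by (intro integral_completion) measurable

lemma measurable_fourier [measurable]:
  assumes [measurable]: "g \<in> borel_measurable borel"
  shows "fourier g \<in> borel_measurable borel"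
proof -
  have "(\<lambda>\<xi>. \<integral>x. cis (- 2 * pi * (x \<bullet> \<xi>)) * g x \<partial>lborel) \<in> borel_measurable borel"
    by measurable
  moreover have "fourier g = (\<lambda>\<xi>. \<integral>x. cis (- 2 * pi * (x \<bullet> \<xi>)) * g x \<partial>lborel)"
    by (rule ext) (simp add: fourier_eq_lborel)
  ultimately show ?thesis
    by simp
qed

lemma integrable_cis_mult:
  assumes "integrable lborel g" and [measurable]: "\<theta> \<in> borel_measurable borel"
  shows "integrable lborel (\<lambda>x. cis (\<theta> x) * g x)"
  by (rule Bochner_Integration.integrable_bound[OF assms(1)])
     (use borel_measurable_integrable[OF assms(1)] in \<open>auto simp: norm_mult\<close>)

lemma norm_fourier_le:
  assumes "integrable lborel g"
  shows "norm (fourier g \<xi>) \<le> (\<integral>x. norm (g x) \<partial>lborel)"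
proof -
  have "norm (fourier g \<xi>) \<le> (\<integral>x. norm (cis (- 2 * pi * (x \<bullet> \<xi>)) * g x) \<partial>lborel)"
    using borel_measurable_integrable[OF assms] by (simp add: fourier_eq_lborel)
  then show ?thesis by (simp add: norm_mult)
qed

lemma fourier_diff:
  assumes "integrable lborel g" "integrable lborel h"
  shows "fourier (\<lambda>x. g x - h x) \<xi> = fourier g \<xi> - fourier h \<xi>"
  using assms[THEN borel_measurable_integrable] assms
  by (simp add: fourier_eq_lborel right_diff_distrib integrable_cis_mult)

lemma integrable_pair_mult:
  fixes f :: "'a::euclidean_space \<Rightarrow> 'c::{real_normed_algebra, banach, second_countable_topology}"
    and g :: "'b::euclidean_space \<Rightarrow> 'c"
  assumes f: "integrable lborel f" and g: "integrable lborel g"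
  shows "integrable (lborel \<Otimes>\<^sub>M lborel) (\<lambda>(x, y). f x * g y)"
proof (rule Bochner_Integration.integrable_bound)
  note [measurable] = borel_measurable_integrable[OF f] borel_measurable_integrable[OF g]
  show "integrable (lborel \<Otimes>\<^sub>M lborel) (\<lambda>(x, y). norm (f x) * norm (g y))"
    by (rule lborel_pair.Fubini_integrable) (auto intro!: f g simp: abs_mult)
  show "(\<lambda>(x, y). f x * g y) \<in> borel_measurable (lborel \<Otimes>\<^sub>M lborel)"
    by measurable
qed (auto simp: norm_mult_ineq)

text \<open>Fubini for an exponential that is symmetric in the two variables. If one of the two
  transforms is explicit, the formula evaluates pairings with the other; this is the mechanism
  behind the square norm bound, the heat semigroup law and the test of the weak equation.\<close>

lemma fourier_duality:
  assumes g: "integrable lborel g" and h: "integrable lborel h"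
  shows "(\<integral>\<xi>. fourier g \<xi> * h \<xi> \<partial>lborel) = (\<integral>x. g x * fourier h x \<partial>lborel)"
proof -
  note [measurable] = borel_measurable_integrable[OF g] borel_measurable_integrable[OF h]
  have "integrable (lborel \<Otimes>\<^sub>M lborel) (\<lambda>(x, \<xi>). cis (- 2 * pi * (x \<bullet> \<xi>)) * (g x * h \<xi>))"
    by (rule Bochner_Integration.integrable_bound[OF integrable_pair_mult[OF g h]])
       (auto simp: norm_mult)
  from lborel_pair.Fubini_integral[OF this]
  have "(\<integral>\<xi>. (\<integral>x. cis (- 2 * pi * (x \<bullet> \<xi>)) * (g x * h \<xi>) \<partial>lborel) \<partial>lborel)
     = (\<integral>x. (\<integral>\<xi>. cis (- 2 * pi * (x \<bullet> \<xi>)) * (g x * h \<xi>) \<partial>lborel) \<partial>lborel)"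
    by simp
  also have "(\<lambda>\<xi>. \<integral>x. cis (- 2 * pi * (x \<bullet> \<xi>)) * (g x * h \<xi>) \<partial>lborel) = (\<lambda>\<xi>. fourier g \<xi> * h \<xi>)"
    by (rule ext) (simp add: fourier_eq_lborel mult.assoc[symmetric])
  also have "(\<lambda>x. \<integral>\<xi>. cis (- 2 * pi * (x \<bullet> \<xi>)) * (g x * h \<xi>) \<partial>lborel) = (\<lambda>x. g x * fourier h x)"
  proof (rule ext)
    fix x
    have "(\<integral>\<xi>. cis (- 2 * pi * (x \<bullet> \<xi>)) * (g x * h \<xi>) \<partial>lborel)
      = (\<integral>\<xi>. g x * (cis (- 2 * pi * (\<xi> \<bullet> x)) * h \<xi>) \<partial>lborel)"
      by (intro Bochner_Integration.integral_cong) (auto simp: inner_commute)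
    then show "(\<integral>\<xi>. cis (- 2 * pi * (x \<bullet> \<xi>)) * (g x * h \<xi>) \<partial>lborel) = g x * fourier h x"
      by (simp add: fourier_eq_lborel)
  qed
  finally show ?thesis .
qed

text \<open>By a(x) a(y) \<le> (a(x)^2 + a(y)^2)/2 the quadratic form splits into two halves, which
  are equal by symmetry of the kernel. It serves twice: with heat kernels for the Fourier transform
  on square integrable functions, and with the Bessel kernel weighted by a potential.\<close>

lemma nn_integral_schur:
  fixes K :: "'a::euclidean_space \<Rightarrow> 'a \<Rightarrow> ennreal"
  assumes K [measurable]: "case_prod K \<in> borel_measurable (borel \<Otimes>\<^sub>M borel)"
    and sym: "\<And>x y. K x y = K y x"
    and [measurable]: "a \<in> borel_measurable borel" and nn: "\<And>x. a x \<ge> (0::real)"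
  shows "(\<integral>\<^sup>+x. (\<integral>\<^sup>+y. ennreal (a x) * ennreal (a y) * K x y \<partial>lborel) \<partial>lborel)
    \<le> (\<integral>\<^sup>+x. ennreal ((a x)\<^sup>2) * (\<integral>\<^sup>+y. K x y \<partial>lborel) \<partial>lborel)"
proof -
  define J where "J x = (\<integral>\<^sup>+y. K x y \<partial>lborel)" for x
  have [measurable]: "J \<in> borel_measurable borel"
    unfolding J_def by measurable
  have half: "ennreal (a x) * ennreal (a y) \<le> ennreal ((a x)\<^sup>2 / 2) + ennreal ((a y)\<^sup>2 / 2)" for x y
  proof -
    have "a x * a y \<le> (a x)\<^sup>2 / 2 + (a y)\<^sup>2 / 2"
      using sum_squares_bound[of "a x" "a y"] by simp
    then show ?thesis
      by (simp add: nn ennreal_mult[symmetric] ennreal_leI flip: ennreal_plus)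
  qed
  have "(\<integral>\<^sup>+x. (\<integral>\<^sup>+y. ennreal (a x) * ennreal (a y) * K x y \<partial>lborel) \<partial>lborel)
     \<le> (\<integral>\<^sup>+x. (\<integral>\<^sup>+y. (ennreal ((a x)\<^sup>2 / 2) + ennreal ((a y)\<^sup>2 / 2)) * K x y \<partial>lborel) \<partial>lborel)"
    by (intro nn_integral_mono mult_right_mono half) simp
  also have "\<dots> = (\<integral>\<^sup>+x. ennreal ((a x)\<^sup>2 / 2) * J x + (\<integral>\<^sup>+y. ennreal ((a y)\<^sup>2 / 2) * K x y \<partial>lborel) \<partial>lborel)"
    by (simp add: distrib_right nn_integral_add nn_integral_cmult J_def)
  also have "\<dots> = (\<integral>\<^sup>+x. ennreal ((a x)\<^sup>2 / 2) * J x \<partial>lborel) + (\<integral>\<^sup>+x. (\<integral>\<^sup>+y. ennreal ((a y)\<^sup>2 / 2) * K x y \<partial>lborel) \<partial>lborel)"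
    by (rule nn_integral_add) measurable
  also have "(\<integral>\<^sup>+x. (\<integral>\<^sup>+y. ennreal ((a y)\<^sup>2 / 2) * K x y \<partial>lborel) \<partial>lborel)
     = (\<integral>\<^sup>+y. (\<integral>\<^sup>+x. ennreal ((a y)\<^sup>2 / 2) * K x y \<partial>lborel) \<partial>lborel)"
    by (rule lborel_pair.Fubini'[of "\<lambda>y x. ennreal ((a y)\<^sup>2 / 2) * K x y", simplified]) measurable
  also have "\<dots> = (\<integral>\<^sup>+y. ennreal ((a y)\<^sup>2 / 2) * J y \<partial>lborel)"
    by (subst sym) (simp add: nn_integral_cmult J_def)
  also have "(\<integral>\<^sup>+x. ennreal ((a x)\<^sup>2 / 2) * J x \<partial>lborel) + (\<integral>\<^sup>+x. ennreal ((a x)\<^sup>2 / 2) * J x \<partial>lborel)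
    = (\<integral>\<^sup>+x. ennreal ((a x)\<^sup>2 / 2) * J x + ennreal ((a x)\<^sup>2 / 2) * J x \<partial>lborel)"
    by (rule nn_integral_add[symmetric]) measurable
  also have "\<dots> = (\<integral>\<^sup>+x. ennreal ((a x)\<^sup>2) * J x \<partial>lborel)"
    by (simp flip: distrib_right ennreal_plus)
  finally show ?thesis
    by (simp add: J_def)
qed

text \<open>The square of the L^2 norm, valued in \<open>ennreal\<close> so that inequalities can be
  stated before finiteness is known. Without the root the triangle inequality holds up to a factor
  2, which is harmless for convergence to 0.\<close>

definition sq_norm :: "(real^'n \<Rightarrow> complex) \<Rightarrow> ennreal" where
  "sq_norm g = (\<integral>\<^sup>+x. ennreal ((norm (g x))\<^sup>2) \<partial>lborel)"

lemma ennreal_norm_integral_le: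
  fixes f :: "'a \<Rightarrow> 'b::{banach, second_countable_topology}"
  shows "ennreal (norm (integral\<^sup>L M f)) \<le> (\<integral>\<^sup>+x. ennreal (norm (f x)) \<partial>M)"
  by (cases "integrable M f") (auto simp: integral_norm_bound_ennreal not_integrable_integral_eq)

lemma gaussian_fourier_cis:
  fixes x :: "real^'n"
  assumes t: "t > 0"
  shows "integrable lborel (\<lambda>\<xi>. cis (2 * pi * (\<xi> \<bullet> x)) * of_real (gaussian t \<xi>))"
    and "fourier (\<lambda>\<xi>. cis (2 * pi * (\<xi> \<bullet> x)) * of_real (gaussian t \<xi>)) y
       = of_real (heat_kernel t (y - x))"
proof -
  show "integrable lborel (\<lambda>\<xi>. cis (2 * pi * (\<xi> \<bullet> x)) * of_real (gaussian t \<xi>))"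
    by (rule integrable_cis_mult) (use gaussian_fourier(1)[OF t, of "0::real^'n"] in simp_all)
  have "fourier (\<lambda>\<xi>. cis (2 * pi * (\<xi> \<bullet> x)) * of_real (gaussian t \<xi>)) y
    = (\<integral>\<xi>. cis (- 2 * pi * (\<xi> \<bullet> (y - x))) * of_real (gaussian t \<xi>) \<partial>lborel)"
    by (simp add: fourier_eq_lborel mult.assoc[symmetric] cis_mult inner_diff_right right_diff_distrib)
  then show "fourier (\<lambda>\<xi>. cis (2 * pi * (\<xi> \<bullet> x)) * of_real (gaussian t \<xi>)) y
       = of_real (heat_kernel t (y - x))"
    using gaussian_fourier(2)[OF t, of "y - x"] by simp
qed

text \<open>With Gaussian damping the square norm of the transform becomes a quadratic form with a heat
  kernel, which the Schur test bounds by the square norm of the function.\<close>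

lemma sq_norm_fourier_le:
  assumes g: "integrable lborel g"
  shows "sq_norm (fourier g) \<le> sq_norm g"
proof -
  note [measurable] = borel_measurable_integrable[OF g]
  define e where "e t \<xi> = gaussian t \<xi>" for t and \<xi> :: "real^'a"
  have [measurable]: "e t \<in> borel_measurable borel" for t
    unfolding e_def by measurable
  have damped: "(\<integral>\<^sup>+\<xi>. ennreal ((norm (fourier g \<xi>))\<^sup>2 * e t \<xi>) \<partial>lborel) \<le> sq_norm g" if t: "t > 0" for t
  proof -
    \<comment> \<open>The pairing of \<open>fourier g\<close> with \<open>h\<close> is the damped
      square norm of \<open>fourier g\<close>. Duality turns it into a pairing of \<open>g\<close>
      with \<open>fourier h\<close>, and the latter is the conjugate of \<open>g\<close> smoothed by
      a heat kernel.\<close>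
    define h where "h \<xi> = of_real (e t \<xi>) * cnj (fourier g \<xi>)" for \<xi>
    have e_int: "integrable lborel (\<lambda>\<xi>. complex_of_real (e t \<xi>))"
      using gaussian_fourier_cis(1)[OF t, of 0] by (simp add: e_def)
    have h: "integrable lborel h"
    proof (rule Bochner_Integration.integrable_bound)
      show "integrable lborel (\<lambda>\<xi>. complex_of_real (e t \<xi>) * of_real (\<integral>x. norm (g x) \<partial>lborel))"
        by (intro integrable_mult_left e_int)
      show "h \<in> borel_measurable lborel"
        unfolding h_def by measurable
      show "AE \<xi> in lborel. norm (h \<xi>) \<le> norm (complex_of_real (e t \<xi>) * of_real (\<integral>x. norm (g x) \<partial>lborel))"
        using norm_fourier_le[OF g]
        by (auto simp: h_def norm_mult e_def intro!: mult_left_mono order_trans[OF _ abs_ge_self])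
    qed
    have fh: "fourier h x = cnj (\<integral>y. g y * of_real (heat_kernel t (y - x)) \<partial>lborel)" for x
    proof -
      have "fourier h x = (\<integral>\<xi>. cnj (fourier g \<xi> * (cis (2 * pi * (\<xi> \<bullet> x)) * of_real (e t \<xi>))) \<partial>lborel)"
        using borel_measurable_integrable[OF h]
        by (subst fourier_eq_lborel) (simp_all add: h_def cis_cnj mult_ac)
      also have "\<dots> = cnj (\<integral>\<xi>. fourier g \<xi> * (cis (2 * pi * (\<xi> \<bullet> x)) * of_real (e t \<xi>)) \<partial>lborel)"
        by (rule Bochner_Integration.integral_cnj)
      also have "(\<integral>\<xi>. fourier g \<xi> * (cis (2 * pi * (\<xi> \<bullet> x)) * of_real (e t \<xi>)) \<partial>lborel)
         = (\<integral>y. g y * of_real (heat_kernel t (y - x)) \<partial>lborel)"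
        unfolding e_def by (subst fourier_duality[OF g gaussian_fourier_cis(1)[OF t]]) (simp only: gaussian_fourier_cis(2)[OF t])
      finally show ?thesis .
    qed
    have "(\<integral>\<^sup>+\<xi>. ennreal ((norm (fourier g \<xi>))\<^sup>2 * e t \<xi>) \<partial>lborel) = ennreal (\<integral>\<xi>. (norm (fourier g \<xi>))\<^sup>2 * e t \<xi> \<partial>lborel)"
    proof (rule nn_integral_eq_integral)
      have "integrable lborel (\<lambda>\<xi>. (\<integral>x. norm (g x) \<partial>lborel) * norm (h \<xi>))"
        using h by (intro integrable_mult_right integrable_norm)
      then show "integrable lborel (\<lambda>\<xi>. (norm (fourier g \<xi>))\<^sup>2 * e t \<xi>)"
      proof (rule Bochner_Integration.integrable_bound)
        have "norm (fourier g \<xi>) * norm (fourier g \<xi>) * e t \<xi> \<le> (\<integral>x. norm (g x) \<partial>lborel) * (norm (fourier g \<xi>) * e t \<xi>)" for \<xi>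
          unfolding mult.assoc by (intro mult_right_mono norm_fourier_le g) (simp add: e_def)
        then show "AE \<xi> in lborel. norm ((norm (fourier g \<xi>))\<^sup>2 * e t \<xi>) \<le> norm ((\<integral>x. norm (g x) \<partial>lborel) * norm (h \<xi>))"
          by (auto simp: h_def norm_mult power2_eq_square e_def abs_mult mult_ac)
      qed measurable
    qed (simp add: e_def)
    also have "(\<integral>\<xi>. (norm (fourier g \<xi>))\<^sup>2 * e t \<xi> \<partial>lborel)
      = norm (complex_of_real (\<integral>\<xi>. (norm (fourier g \<xi>))\<^sup>2 * e t \<xi> \<partial>lborel))"
      by (simp add: e_def)
    also have "complex_of_real (\<integral>\<xi>. (norm (fourier g \<xi>))\<^sup>2 * e t \<xi> \<partial>lborel)
      = (\<integral>\<xi>. fourier g \<xi> * h \<xi> \<partial>lborel)"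
      unfolding h_def integral_complex_of_real[symmetric]
      by (simp only: of_real_mult complex_norm_square mult_ac)
    also have "\<dots> = (\<integral>x. g x * fourier h x \<partial>lborel)"
      by (rule fourier_duality[OF g h])
    also have "ennreal (norm \<dots>) \<le> (\<integral>\<^sup>+x. ennreal (norm (g x * fourier h x)) \<partial>lborel)"
      by (rule ennreal_norm_integral_le)
    also have "\<dots> \<le> (\<integral>\<^sup>+x. (\<integral>\<^sup>+y. ennreal (norm (g x)) * ennreal (norm (g y)) * ennreal (heat_kernel t (y - x)) \<partial>lborel) \<partial>lborel)"
    proof (rule nn_integral_mono)
      fix x
      have "ennreal (norm (g x * fourier h x)) = ennreal (norm (g x)) * ennreal (norm (\<integral>y. g y * of_real (heat_kernel t (y - x)) \<partial>lborel))"
        by (simp add: fh norm_mult ennreal_mult)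
      also have "\<dots> \<le> ennreal (norm (g x)) * (\<integral>\<^sup>+y. ennreal (norm (g y * of_real (heat_kernel t (y - x)))) \<partial>lborel)"
        by (intro mult_left_mono ennreal_norm_integral_le) simp
      also have "\<dots> = (\<integral>\<^sup>+y. ennreal (norm (g x)) * ennreal (norm (g y)) * ennreal (heat_kernel t (y - x)) \<partial>lborel)"
        by (simp add: norm_mult ennreal_mult mult.assoc nn_integral_cmult)
      finally show "ennreal (norm (g x * fourier h x)) \<le> (\<integral>\<^sup>+y. ennreal (norm (g x)) * ennreal (norm (g y)) * ennreal (heat_kernel t (y - x)) \<partial>lborel)" .
    qed
    also have "\<dots> \<le> (\<integral>\<^sup>+x. ennreal ((norm (g x))\<^sup>2) * (\<integral>\<^sup>+y. ennreal (heat_kernel t (y - x)) \<partial>lborel) \<partial>lborel)"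
      by (rule nn_integral_schur) (auto simp: heat_kernel_commute)
    also have "\<dots> = sq_norm g"
      by (simp add: nn_integral_heat_kernel_diff t sq_norm_def)
    finally show ?thesis .
  qed
  \<comment> \<open>The bound for the damped integral does not depend on \<open>t\<close>, so
    Fatou's lemma along t = 1/(n + 1) removes the damping.\<close>
  have "sq_norm (fourier g) = (\<integral>\<^sup>+\<xi>. liminf (\<lambda>n. ennreal ((norm (fourier g \<xi>))\<^sup>2 * e (1 / Suc n) \<xi>)) \<partial>lborel)"
    unfolding sq_norm_def
  proof (rule nn_integral_cong)
    fix \<xi> :: "real^'a"
    have "(\<lambda>n. exp (- 4 * pi\<^sup>2 * (norm \<xi>)\<^sup>2 * (1 / real (Suc n)))) \<longlonglongrightarrow> exp (- 4 * pi\<^sup>2 * (norm \<xi>)\<^sup>2 * 0)"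
      by (intro tendsto_intros LIMSEQ_inverse_real_of_nat[unfolded inverse_eq_divide])
    then have "(\<lambda>n. ennreal ((norm (fourier g \<xi>))\<^sup>2 * e (1 / Suc n) \<xi>)) \<longlonglongrightarrow> ennreal ((norm (fourier g \<xi>))\<^sup>2 * 1)"
      by (intro tendsto_intros tendsto_ennrealI) (simp add: e_def mult_ac)
    then show "ennreal ((norm (fourier g \<xi>))\<^sup>2) = liminf (\<lambda>n. ennreal ((norm (fourier g \<xi>))\<^sup>2 * e (1 / Suc n) \<xi>))"
      using lim_imp_Liminf[OF sequentially_bot, symmetric] by simp
  qed
  also have "\<dots> \<le> liminf (\<lambda>n. \<integral>\<^sup>+\<xi>. ennreal ((norm (fourier g \<xi>))\<^sup>2 * e (1 / Suc n) \<xi>) \<partial>lborel)"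
    by (rule nn_integral_liminf) measurable
  also have "\<dots> \<le> liminf (\<lambda>n. sq_norm g)"
    by (intro Liminf_mono always_eventually allI damped) simp
  also have "\<dots> = sq_norm g"
    by (simp add: Liminf_const)
  finally show ?thesis .
qed

subsection \<open>The Fourier transform on square integrable functions\<close>

lemma sq_norm_diff_commute: "sq_norm (\<lambda>x. g x - h x) = sq_norm (\<lambda>x. h x - g x)"
  by (simp add: sq_norm_def norm_minus_commute)

lemma sq_norm_cong_AE:
  assumes "AE x in lborel. g x = h x"
  shows "sq_norm g = sq_norm h"
  unfolding sq_norm_def using assms by (intro nn_integral_cong_AE) auto

lemma sq_norm_triangle:
  assumes [measurable]: "g \<in> borel_measurable borel" "k \<in> borel_measurable borel" "h \<in> borel_measurable borel"
  shows "sq_norm (\<lambda>x. g x - h x) \<le> 2 * sq_norm (\<lambda>x. g x - k x) + 2 * sq_norm (\<lambda>x. k x - h x)"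
proof -
  have "(norm (a - c))\<^sup>2 \<le> 2 * (norm (a - b))\<^sup>2 + 2 * (norm (b - c))\<^sup>2" for a b c :: complex
  proof -
    have "norm (a - c) \<le> norm (a - b) + norm (b - c)"
      using norm_triangle_ineq[of "a - b" "b - c"] by simp
    then have "(norm (a - c))\<^sup>2 \<le> (norm (a - b) + norm (b - c))\<^sup>2"
      by (intro power_mono) auto
    also have "\<dots> \<le> 2 * (norm (a - b))\<^sup>2 + 2 * (norm (b - c))\<^sup>2"
      using sum_squares_bound[of "norm (a - b)" "norm (b - c)"] by (simp add: power2_sum)
    finally show ?thesis .
  qed
  then have "sq_norm (\<lambda>x. g x - h x) \<le> (\<integral>\<^sup>+x. ennreal (2 * (norm (g x - k x))\<^sup>2 + 2 * (norm (k x - h x))\<^sup>2) \<partial>lborel)"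
    unfolding sq_norm_def by (intro nn_integral_mono ennreal_leI) auto
  also have "\<dots> = (\<integral>\<^sup>+x. 2 * ennreal ((norm (g x - k x))\<^sup>2) + 2 * ennreal ((norm (k x - h x))\<^sup>2) \<partial>lborel)"
    by (simp add: ennreal_plus ennreal_mult)
  also have "\<dots> = 2 * sq_norm (\<lambda>x. g x - k x) + 2 * sq_norm (\<lambda>x. k x - h x)"
    unfolding sq_norm_def by (simp add: nn_integral_add nn_integral_cmult)
  finally show ?thesis .
qed

definition sq_integrable :: "(real^'n \<Rightarrow> complex) \<Rightarrow> bool" where
  "sq_integrable g \<longleftrightarrow> g \<in> borel_measurable borel \<and> sq_norm g < \<infinity>"

lemma sq_integrable_measurable [measurable_dest]: "sq_integrable g \<Longrightarrow> g \<in> borel_measurable borel"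
  by (simp add: sq_integrable_def)

lemma sq_norm_minus [simp]: "sq_norm (\<lambda>x. - g x) = sq_norm g"
  by (simp add: sq_norm_def)

lemma sq_integrable_diff:
  assumes "sq_integrable g" "sq_integrable h"
  shows "sq_integrable (\<lambda>x. g x - h x)"
  using sq_norm_triangle[of g "\<lambda>_. 0" h] assms
  by (auto simp: sq_integrable_def ennreal_mult_less_top less_top intro: le_less_trans)

lemma sq_integrable_mult:
  assumes "sq_integrable g" "sq_integrable h"
  shows "integrable lborel (\<lambda>x. g x * h x)"
    and "(ennreal (norm (\<integral>x. g x * h x \<partial>lborel)))\<^sup>2 \<le> sq_norm g * sq_norm h"
proof -
  note [measurable] = assms[THEN sq_integrable_measurable]
  have sq: "(\<integral>\<^sup>+x. ennreal (norm (g x)) * ennreal (norm (h x)) \<partial>lborel)\<^sup>2 \<le> sq_norm g * sq_norm h"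
    using Cauchy_Schwarz_nn_integral[of "\<lambda>x. ennreal (norm (g x))" lborel "\<lambda>x. ennreal (norm (h x))"]
    by (simp add: sq_norm_def ennreal_power)
  also have "\<dots> < \<infinity>"
    using assms by (simp add: sq_integrable_def ennreal_mult_less_top)
  finally have fin: "(\<integral>\<^sup>+x. ennreal (norm (g x)) * ennreal (norm (h x)) \<partial>lborel) < \<infinity>"
    by (simp add: power_less_top_ennreal)
  then show "integrable lborel (\<lambda>x. g x * h x)"
    by (intro integrableI_bounded) (auto simp: norm_mult ennreal_mult)
  have "ennreal (norm (\<integral>x. g x * h x \<partial>lborel)) \<le> (\<integral>\<^sup>+x. ennreal (norm (g x)) * ennreal (norm (h x)) \<partial>lborel)"
    using ennreal_norm_integral_le[of lborel "\<lambda>x. g x * h x"] by (simp add: norm_mult ennreal_mult)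
  then have "(ennreal (norm (\<integral>x. g x * h x \<partial>lborel)))\<^sup>2 \<le> (\<integral>\<^sup>+x. ennreal (norm (g x)) * ennreal (norm (h x)) \<partial>lborel)\<^sup>2"
    by (intro power_mono) simp_all
  also note sq
  finally show "(ennreal (norm (\<integral>x. g x * h x \<partial>lborel)))\<^sup>2 \<le> sq_norm g * sq_norm h" .
qed

section \<open>Completeness and limits of truncations\<close>

lemma sq_norm_fatou:
  assumes [measurable]: "\<And>k. h k \<in> borel_measurable borel" "g \<in> borel_measurable borel"
    and lim: "AE x in lborel. (\<lambda>k. h k x) \<longlonglongrightarrow> l x"
    and bound: "\<forall>\<^sub>F k in sequentially. sq_norm (\<lambda>x. g x - h k x) \<le> c"
  shows "sq_norm (\<lambda>x. g x - l x) \<le> c"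
proof -
  have "sq_norm (\<lambda>x. g x - l x) = (\<integral>\<^sup>+x. liminf (\<lambda>k. ennreal ((norm (g x - h k x))\<^sup>2)) \<partial>lborel)"
    unfolding sq_norm_def
  proof (rule nn_integral_cong_AE, use lim in eventually_elim)
    fix x assume "(\<lambda>k. h k x) \<longlonglongrightarrow> l x"
    then have "(\<lambda>k. ennreal ((norm (g x - h k x))\<^sup>2)) \<longlonglongrightarrow> ennreal ((norm (g x - l x))\<^sup>2)"
      by (intro tendsto_ennrealI tendsto_intros)
    then show "ennreal ((norm (g x - l x))\<^sup>2) = liminf (\<lambda>k. ennreal ((norm (g x - h k x))\<^sup>2))"
      by (rule lim_imp_Liminf[OF sequentially_bot, symmetric])
  qed
  also have "\<dots> \<le> liminf (\<lambda>k. sq_norm (\<lambda>x. g x - h k x))"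
    unfolding sq_norm_def by (rule nn_integral_liminf) measurable
  also have "\<dots> \<le> liminf (\<lambda>k. c)"
    by (rule Liminf_mono[OF bound])
  finally show ?thesis by (simp add: Liminf_const)
qed

text \<open>Riesz-Fischer with a rate: Fatou's lemma carries the Cauchy bounds to the limit. The
  almost everywhere convergent subsequence is exported because \<open>fourier_trunc_limit\<close>
  applies Fatou's lemma along it once more, for real truncation radii.\<close>

lemma sq_norm_complete:
  fixes h :: "nat \<Rightarrow> real^'n \<Rightarrow> complex" and \<epsilon> :: "nat \<Rightarrow> ennreal"
  assumes [measurable]: "\<And>i. h i \<in> borel_measurable borel"
    and cauchy: "\<And>i j. i \<le> j \<Longrightarrow> sq_norm (\<lambda>x. h i x - h j x) \<le> \<epsilon> i"
    and lim: "\<epsilon> \<longlonglongrightarrow> 0"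
  shows "\<exists>l. l \<in> borel_measurable borel \<and> (\<exists>r. strict_mono r \<and> (AE x in lborel. (\<lambda>k. h (r k) x) \<longlonglongrightarrow> l x)) \<and> (\<forall>i. sq_norm (\<lambda>x. h i x - l x) \<le> \<epsilon> i)"
proof -
  have small: "\<exists>n>m. \<epsilon> n < ennreal (1 / 8 ^ k)" for m k :: nat
  proof -
    have "\<forall>\<^sub>F n in sequentially. \<epsilon> n < ennreal (1 / 8 ^ k)"
      by (rule order_tendstoD(2)[OF lim]) simp
    then obtain N where "\<And>n. n \<ge> N \<Longrightarrow> \<epsilon> n < ennreal (1 / 8 ^ k)"
      by (auto simp: eventually_sequentially)
    then have "max N (Suc m) > m \<and> \<epsilon> (max N (Suc m)) < ennreal (1 / 8 ^ k)"
      by auto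
    then show ?thesis by blast
  qed
  define r where "r = rec_nat (SOME n. \<epsilon> n < ennreal 1) (\<lambda>k m. SOME n. n > m \<and> \<epsilon> n < ennreal (1 / 8 ^ Suc k))"
  have r_Suc: "r (Suc k) > r k \<and> \<epsilon> (r (Suc k)) < ennreal (1 / 8 ^ Suc k)" for k
    using someI_ex[OF small[of "r k" "Suc k"]] by (simp add: r_def)
  have r_mono: "strict_mono r"
    using r_Suc by (simp add: strict_mono_Suc_iff)
  have r_small: "\<epsilon> (r k) \<le> ennreal (1 / 8 ^ k)" for k
  proof (cases k)
    case 0
    have "\<epsilon> (SOME n. \<epsilon> n < ennreal 1) < ennreal 1"
      by (rule someI_ex) (use small[of 0 0] in auto)
    then show ?thesis by (simp add: 0 r_def)
  next
    case (Suc j)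
    then show ?thesis using r_Suc[of j] by (simp add: less_imp_le)
  qed
  define d where "d k x = norm (h (r k) x - h (r (Suc k)) x)" for k x
  have [measurable]: "d k \<in> borel_measurable borel" for k
    unfolding d_def by measurable
  have d_int: "(\<integral>\<^sup>+x. ennreal ((d k x)\<^sup>2) \<partial>lborel) \<le> ennreal (1 / 8 ^ k)" for k
    using order_trans[OF cauchy[of "r k" "r (Suc k)"] r_small[of k]] r_Suc[of k]
    by (simp add: sq_norm_def d_def)
  \<comment> \<open>Along \<open>r\<close> the increments have square norm at most 8^-k. The weight
    4^k keeps the sum of the integrals finite and still forces \<open>d k x\<close> to be of order
    2^-k almost everywhere, which is summable.\<close>
  have "(\<integral>\<^sup>+x. (\<Sum>k. ennreal (4 ^ k * (d k x)\<^sup>2)) \<partial>lborel) = (\<Sum>k. \<integral>\<^sup>+x. ennreal (4 ^ k * (d k x)\<^sup>2) \<partial>lborel)"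
    by (rule nn_integral_suminf) measurable
  also have "\<dots> \<le> (\<Sum>k. ennreal ((1 / 2) ^ k))"
  proof (rule suminf_le)
    fix k
    have "(\<integral>\<^sup>+x. ennreal (4 ^ k * (d k x)\<^sup>2) \<partial>lborel) = ennreal (4 ^ k) * (\<integral>\<^sup>+x. ennreal ((d k x)\<^sup>2) \<partial>lborel)"
      by (simp add: ennreal_mult nn_integral_cmult)
    also have "\<dots> \<le> ennreal (4 ^ k) * ennreal (1 / 8 ^ k)"
      by (intro mult_left_mono d_int) simp
    also have "\<dots> = ennreal ((1 / 2) ^ k)"
      by (simp add: ennreal_mult[symmetric] power_one_over field_simps flip: power_mult_distrib)
    finally show "(\<integral>\<^sup>+x. ennreal (4 ^ k * (d k x)\<^sup>2) \<partial>lborel) \<le> ennreal ((1 / 2) ^ k)" .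
  qed auto
  also have "\<dots> = ennreal (\<Sum>k. (1 / 2) ^ k)"
    by (rule suminf_ennreal2) (auto intro: summable_geometric)
  also have "\<dots> < \<infinity>" by simp
  finally have "AE x in lborel. (\<Sum>k. ennreal (4 ^ k * (d k x)\<^sup>2)) \<noteq> \<infinity>"
    by (intro nn_integral_PInf_AE) auto
  then have conv: "AE x in lborel. (\<lambda>k. h (r k) x) \<longlonglongrightarrow> lim (\<lambda>k. h (r k) x)"
  proof eventually_elim
    fix x assume fin: "(\<Sum>k. ennreal (4 ^ k * (d k x)\<^sup>2)) \<noteq> \<infinity>"
    have "summable (\<lambda>k. 4 ^ k * (d k x)\<^sup>2)"
    proof (rule summable_suminf_not_top)
      show "(\<Sum>k. ennreal (4 ^ k * (d k x)\<^sup>2)) \<noteq> top"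
        using fin by (simp only: infinity_ennreal_def not_False_eq_True)
      show "0 \<le> 4 ^ k * (d k x)\<^sup>2" for k
        by (intro mult_nonneg_nonneg) auto
    qed
    then have "(\<lambda>k. 4 ^ k * (d k x)\<^sup>2) \<longlonglongrightarrow> 0"
      by (rule summable_LIMSEQ_zero)
    then have "Bseq (\<lambda>k. 4 ^ k * (d k x)\<^sup>2)"
      by (intro convergent_imp_Bseq convergentI)
    then obtain C where C: "C > 0" "\<And>k. norm (4 ^ k * (d k x)\<^sup>2) \<le> C"
      unfolding Bseq_def by metis
    have dC: "d k x \<le> sqrt C * (1 / 2) ^ k" for k
    proof -
      have "(2 ^ k * d k x)\<^sup>2 \<le> C"
      proof -
        have "(2 ^ k)\<^sup>2 = (4::real) ^ k"
          by (simp add: power2_eq_square flip: power_mult_distrib)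
        then show ?thesis
          using C(2)[of k] by (simp add: power_mult_distrib)
      qed
      then have "2 ^ k * d k x \<le> sqrt C"
        using real_le_rsqrt by blast
      then show ?thesis by (simp add: field_simps power_one_over)
    qed
    have "summable (\<lambda>k. d k x)"
    proof (rule summable_comparison_test')
      show "summable (\<lambda>k. sqrt C * (1 / 2) ^ k)"
        by (intro summable_mult summable_geometric) simp
      show "norm (d k x) \<le> sqrt C * (1 / 2) ^ k" if "k \<ge> 0" for k
        using dC[of k] unfolding d_def by (simp only: real_norm_def abs_norm_cancel)
    qed
    then have "summable (\<lambda>k. norm (h (r (Suc k)) x - h (r k) x))"
      unfolding d_def by (subst norm_minus_commute)
    then have "summable (\<lambda>k. h (r (Suc k)) x - h (r k) x)"
      by (rule summable_norm_cancel)
    then have "convergent (\<lambda>k. h (r k) x)"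
      by (simp only: summable_iff_convergent sum_lessThan_telescope[of "\<lambda>k. h (r k) x"] convergent_diff_const_right_iff)
    then show "(\<lambda>k. h (r k) x) \<longlonglongrightarrow> lim (\<lambda>k. h (r k) x)"
      by (simp add: convergent_LIMSEQ_iff)
  qed
  define l where "l x = lim (\<lambda>k. h (r k) x)" for x
  have l: "l \<in> borel_measurable borel"
    unfolding l_def by measurable
  have "sq_norm (\<lambda>x. h i x - l x) \<le> \<epsilon> i" for i
  proof (rule sq_norm_fatou[where h="\<lambda>k. h (r k)"])
    show "AE x in lborel. (\<lambda>k. h (r k) x) \<longlonglongrightarrow> l x"
      using conv by (simp add: l_def)
    have "r k \<ge> i" if "k \<ge> i" for k
      using seq_suble[OF r_mono, of k] that by linarith
    then show "\<forall>\<^sub>F k in sequentially. sq_norm (\<lambda>x. h i x - h (r k) x) \<le> \<epsilon> i"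
      unfolding eventually_sequentially using cauchy by blast
  qed measurable
  then show ?thesis
    using conv l r_mono by (intro exI[of _ l] conjI exI[of _ r] allI) (simp_all only: l_def)
qed

definition trunc :: "real \<Rightarrow> (real^'n \<Rightarrow> complex) \<Rightarrow> real^'n \<Rightarrow> complex" where
  "trunc R g x = indicator (ball 0 R) x *\<^sub>R g x"

lemma measurable_trunc [measurable]:
  "g \<in> borel_measurable borel \<Longrightarrow> trunc R g \<in> borel_measurable borel"
  unfolding trunc_def[abs_def] by (intro borel_measurable_scaleR borel_measurable_indicator) simp_all

lemma integrable_trunc:
  assumes "sq_integrable g"
  shows "integrable lborel (trunc R g)"
proof -
  note [measurable] = sq_integrable_measurable[OF assms]
  show ?thesis
  proof (rule integrableI_bounded)
    have "(\<integral>\<^sup>+x. ennreal (norm (trunc R g x)) \<partial>lborel) \<le> (\<integral>\<^sup>+x. indicator (ball 0 R) x + ennreal ((norm (g x))\<^sup>2) \<partial>lborel)"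
    proof (rule nn_integral_mono)
      fix x :: "real^'a"
      have "norm (g x) \<le> 1 + (norm (g x))\<^sup>2"
        using sum_squares_bound[of 1 "norm (g x)"] norm_ge_zero[of "g x"]
        unfolding power_one mult_1_right by linarith
      then show "ennreal (norm (trunc R g x)) \<le> indicator (ball 0 R) x + ennreal ((norm (g x))\<^sup>2)"
        by (auto simp: trunc_def indicator_def simp flip: ennreal_1 ennreal_plus intro: ennreal_leI)
    qed
    also have "\<dots> = emeasure lborel (ball (0::real^'a) R) + sq_norm g"
      unfolding sq_norm_def by (subst nn_integral_add) (auto intro!: borel_measurable_indicator)
    also have "\<dots> < \<infinity>"
      using assms emeasure_lborel_ball_finite[of "0::real^'a" R] by (simp add: sq_integrable_def)
    finally show "(\<integral>\<^sup>+x. ennreal (norm (trunc R g x)) \<partial>lborel) < \<infinity>" .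
  qed measurable
qed

definition tail :: "(real^'n \<Rightarrow> complex) \<Rightarrow> real \<Rightarrow> ennreal" where
  "tail g R = sq_norm (\<lambda>x. trunc R g x - g x)"

lemma tail_tendsto:
  assumes "sq_integrable g"
  shows "(tail g \<longlongrightarrow> 0) at_top"
proof (rule tendsto_at_topI_sequentially)
  fix X :: "nat \<Rightarrow> real" assume X: "filterlim X at_top sequentially"
  note [measurable] = sq_integrable_measurable[OF assms]
  have "(\<lambda>n. \<integral>\<^sup>+x. ennreal ((norm (trunc (X n) g x - g x))\<^sup>2) \<partial>lborel) \<longlonglongrightarrow> (\<integral>\<^sup>+x. 0 \<partial>(lborel :: (real^'a) measure))"
  proof (rule nn_integral_dominated_convergence[where w="\<lambda>x. ennreal ((norm (g x))\<^sup>2)"])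
    show "(\<integral>\<^sup>+x. ennreal ((norm (g x))\<^sup>2) \<partial>lborel) < \<infinity>"
      using assms by (simp add: sq_integrable_def sq_norm_def)
    show "AE x in lborel. (\<lambda>n. ennreal ((norm (trunc (X n) g x - g x))\<^sup>2)) \<longlonglongrightarrow> 0"
    proof (rule AE_I2)
      fix x :: "real^'a"
      have "\<forall>\<^sub>F n in sequentially. norm x < X n"
        using X by (simp add: filterlim_at_top_dense)
      then have "\<forall>\<^sub>F n in sequentially. ennreal ((norm (trunc (X n) g x - g x))\<^sup>2) = 0"
        by eventually_elim (simp add: trunc_def)
      then show "(\<lambda>n. ennreal ((norm (trunc (X n) g x - g x))\<^sup>2)) \<longlonglongrightarrow> 0"
        by (rule tendsto_eventually)
    qed
  qed (auto simp: trunc_def indicator_def)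
  then show "(\<lambda>n. tail g (X n)) \<longlonglongrightarrow> 0"
    by (simp add: tail_def sq_norm_def)
qed

lemma sq_norm_trunc_diff_le:
  assumes "R \<le> R'"
  shows "sq_norm (\<lambda>x. trunc R g x - trunc R' g x) \<le> tail g R"
  unfolding tail_def sq_norm_def using assms
  by (intro nn_integral_mono ennreal_leI) (auto simp: trunc_def indicator_def)

text \<open>Truncations are integrable, so \<open>sq_norm_fourier_le\<close> applies to their
  differences and the transforms form a Cauchy family with rate \<open>tail g\<close>. This is the
  existence behind the choice made in \<open>fourier_L2\<close>.\<close>

lemma fourier_trunc_limit:
  assumes g: "sq_integrable g"
  shows "\<exists>h. sq_integrable h \<and> ((\<lambda>R. sq_norm (\<lambda>\<xi>. fourier (trunc R g) \<xi> - h \<xi>)) \<longlongrightarrow> 0) at_top"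
proof -
  note [measurable] = sq_integrable_measurable[OF g]
  have step: "sq_norm (\<lambda>\<xi>. fourier (trunc R g) \<xi> - fourier (trunc R' g) \<xi>) \<le> tail g R" if "R \<le> R'" for R R'
  proof -
    have "fourier (\<lambda>x. trunc R g x - trunc R' g x) = (\<lambda>\<xi>. fourier (trunc R g) \<xi> - fourier (trunc R' g) \<xi>)"
      by (rule ext) (simp add: fourier_diff integrable_trunc[OF g])
    then show ?thesis
      using sq_norm_fourier_le[of "\<lambda>x. trunc R g x - trunc R' g x"] sq_norm_trunc_diff_le[OF that, of g]
      by (simp add: integrable_trunc[OF g])
  qed
  have "(\<lambda>n. tail g (real n)) \<longlonglongrightarrow> 0"
    by (rule filterlim_compose[OF tail_tendsto[OF g] filterlim_real_sequentially])
  from sq_norm_complete[of "\<lambda>n. fourier (trunc (real n) g)", OF _ _ this]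
  obtain h r where [measurable]: "h \<in> borel_measurable borel" and r: "strict_mono (r :: nat \<Rightarrow> nat)"
      and lim: "AE x in lborel. (\<lambda>k. fourier (trunc (real (r k)) g) x) \<longlonglongrightarrow> h x"
    using step by auto
  have bound: "sq_norm (\<lambda>\<xi>. fourier (trunc R g) \<xi> - h \<xi>) \<le> tail g R" for R
  proof (rule sq_norm_fatou[OF _ _ lim])
    have "\<forall>\<^sub>F k in sequentially. R \<le> real (r k)"
      using filterlim_compose[OF filterlim_real_sequentially filterlim_subseq[OF r]]
      by (simp add: filterlim_at_top)
    then show "\<forall>\<^sub>F k in sequentially. sq_norm (\<lambda>\<xi>. fourier (trunc R g) \<xi> - fourier (trunc (real (r k)) g) \<xi>) \<le> tail g R"
      by eventually_elim (rule step)
  qed measurable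
  have "((\<lambda>R. sq_norm (\<lambda>\<xi>. fourier (trunc R g) \<xi> - h \<xi>)) \<longlongrightarrow> 0) at_top"
    by (rule tendsto_sandwich[OF _ _ tendsto_const tail_tendsto[OF g]]) (auto simp: bound)
  moreover have "sq_integrable h"
  proof -
    \<comment> \<open>At radius 0 the ball is empty and the tail is the whole function, so the error
      bound itself shows that \<open>h\<close> is square integrable.\<close>
    have "fourier (trunc 0 g) = (\<lambda>_. 0)"
      by (rule ext) (simp add: fourier_def trunc_def)
    then have "sq_norm h \<le> tail g 0"
      using bound[of 0] by simp
    also have "tail g 0 = sq_norm g"
      by (simp add: tail_def trunc_def)
    finally show ?thesis
      using g by (simp add: sq_integrable_def le_less_trans)
  qed
  ultimately show ?thesis by blast
qed

lemma lebesgue_complex_ex_borel: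
  fixes g :: "real^'n \<Rightarrow> complex"
  assumes g: "g \<in> borel_measurable lebesgue"
  shows "\<exists>h. h \<in> borel_measurable borel \<and> (AE x in lborel. g x = h x)"
proof -
  have "(\<lambda>x. Re (g x)) \<in> borel_measurable lebesgue" "(\<lambda>x. Im (g x)) \<in> borel_measurable lebesgue"
    using g by measurable
  from this[THEN completion_ex_borel_measurable_real]
  obtain a b where [measurable]: "a \<in> borel_measurable borel" "b \<in> borel_measurable borel"
    and "AE x in lborel. Re (g x) = a x" "AE x in lborel. Im (g x) = b x"
    by auto
  then have "AE x in lborel. g x = Complex (a x) (b x)"
    by (auto simp: complex_eq_iff)
  moreover have "(\<lambda>x. Complex (a x) (b x)) \<in> borel_measurable borel"
    by (subst borel_measurable_complex_iff) simp
  ultimately show ?thesis by blast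
qed

lemma Lp2_ex_sq_integrable:
  fixes g :: "real^'n \<Rightarrow> complex"
  assumes "g \<in> Lp 2"
  shows "\<exists>h. sq_integrable h \<and> (AE x in lborel. g x = h x)"
proof -
  obtain h where [measurable]: "h \<in> borel_measurable borel" and h: "AE x in lborel. g x = h x"
    using lebesgue_complex_ex_borel assms by (auto simp: Lp_def)
  have "integrable lebesgue (\<lambda>x. norm (g x) powr 2)"
    using assms by (simp add: Lp_def)
  then have "(\<integral>\<^sup>+x. ennreal (norm (norm (g x) powr 2)) \<partial>lebesgue) < \<infinity>"
    by (simp add: integrable_iff_bounded)
  then have "sq_norm g < \<infinity>"
    by (simp add: sq_norm_def nn_integral_completion)
  then have "sq_norm h < \<infinity>"
    using sq_norm_cong_AE[OF h] by simp
  then have "sq_integrable h"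
    by (simp add: sq_integrable_def)
  then show ?thesis
    using h by (intro exI[of _ h] conjI)
qed

lemma sq_integrable_imp_Lp2:
  assumes "sq_integrable g" and h: "AE x in lborel. h x = g x"
  shows "h \<in> Lp 2"
proof -
  note [measurable] = sq_integrable_measurable[OF assms(1)]
  have AE: "AE x in lebesgue. g x = h x"
    using h by (auto simp: AE_completion_iff)
  have g: "g \<in> borel_measurable lebesgue"
    by (simp add: measurable_completion)
  then have m: "h \<in> borel_measurable lebesgue"
    using AE by (rule borel_measurable_AE)
  have "integrable lborel (\<lambda>x. norm (g x) powr 2)"
    using assms(1) by (intro integrableI_bounded) (auto simp: sq_integrable_def sq_norm_def)
  then have "integrable lebesgue (\<lambda>x. norm (g x) powr 2)"
    by (subst integrable_completion) simp_all
  then have "integrable lebesgue (\<lambda>x. norm (h x) powr 2)"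
    by (rule integrable_cong_AE_imp) (use AE m in \<open>auto simp: eq_commute\<close>)
  then show ?thesis
    using m by (simp add: Lp_def)
qed

lemma tendsto_integral_mult_sq_norm:
  fixes a :: "real \<Rightarrow> real^'n \<Rightarrow> complex"
  assumes a: "\<And>R. sq_integrable (a R)" and l: "sq_integrable l" and b: "sq_integrable b"
    and lim: "((\<lambda>R. sq_norm (\<lambda>x. a R x - l x)) \<longlongrightarrow> 0) at_top"
  shows "((\<lambda>R. \<integral>x. a R x * b x \<partial>lborel) \<longlongrightarrow> (\<integral>x. l x * b x \<partial>lborel)) at_top"
proof -
  define d where "d R = (\<integral>x. a R x * b x \<partial>lborel) - (\<integral>x. l x * b x \<partial>lborel)" for R
  have d_eq: "d R = (\<integral>x. (a R x - l x) * b x \<partial>lborel)" for R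
    by (simp add: d_def left_diff_distrib sq_integrable_mult a b l)
  have d_le: "ennreal ((norm (d R))\<^sup>2) \<le> sq_norm b * sq_norm (\<lambda>x. a R x - l x)" for R
    using sq_integrable_mult(2)[OF sq_integrable_diff[OF a l] b, of R]
    by (simp add: d_eq ennreal_power mult.commute)
  have "((\<lambda>R. sq_norm b * sq_norm (\<lambda>x. a R x - l x)) \<longlongrightarrow> sq_norm b * 0) at_top"
    using b by (intro tendsto_mult_ennreal tendsto_const lim) (auto simp: sq_integrable_def)
  then have lim0: "((\<lambda>R. sq_norm b * sq_norm (\<lambda>x. a R x - l x)) \<longlongrightarrow> 0) at_top"
    by (simp only: mult_zero_right)
  have "((\<lambda>R. ennreal ((norm (d R))\<^sup>2)) \<longlongrightarrow> ennreal 0) at_top"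
    unfolding ennreal_0
    by (rule tendsto_sandwich[OF always_eventually always_eventually tendsto_const lim0]) (simp_all only: d_le zero_le simp_thms)
  then have "((\<lambda>R. (norm (d R))\<^sup>2) \<longlongrightarrow> 0) at_top"
    by (subst (asm) tendsto_ennreal_iff) auto
  then have "((\<lambda>R. sqrt ((norm (d R))\<^sup>2)) \<longlongrightarrow> sqrt 0) at_top"
    by (rule tendsto_real_sqrt)
  then have "(d \<longlongrightarrow> 0) at_top"
    by (simp add: tendsto_norm_zero_iff)
  then show ?thesis
    unfolding d_def by (simp add: LIM_zero_iff)
qed

text \<open>A relation in place of the chosen function: \<open>fourier_L2\<close> returns some
  Lebesgue measurable representative, whereas Fubini and substitution are applied to Borel
  functions. \<open>fourier_L2_is_fourier_L2\<close> connects the two almost everywhere.\<close>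

definition is_fourier_L2 :: "(real^'n \<Rightarrow> complex) \<Rightarrow> (real^'n \<Rightarrow> complex) \<Rightarrow> bool" where
  "is_fourier_L2 g k \<longleftrightarrow> sq_integrable k \<and>
     ((\<lambda>R. sq_norm (\<lambda>\<xi>. fourier (trunc R g) \<xi> - k \<xi>)) \<longlongrightarrow> 0) at_top"

lemma sq_integrable_fourier:
  assumes "integrable lborel g" "sq_integrable g"
  shows "sq_integrable (fourier g)"
  using sq_norm_fourier_le[OF assms(1)] assms(2) measurable_fourier[of g]
  by (auto simp: sq_integrable_def intro: le_less_trans)

lemma sq_integrable_trunc:
  assumes "sq_integrable g"
  shows "sq_integrable (trunc R g)"
proof -
  have "sq_norm (trunc R g) \<le> sq_norm g"
    unfolding sq_norm_def by (intro nn_integral_mono ennreal_leI) (auto simp: trunc_def indicator_def)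
  then show ?thesis
    using assms measurable_trunc[of g R] by (auto simp: sq_integrable_def intro: le_less_trans)
qed

text \<open>The formula for truncations passes to the limit on both sides by Cauchy-Schwarz.
  Integrability is asked of the test function \<open>h\<close> alone, so \<open>g\<close> may be a
  general square integrable function.\<close>

lemma is_fourier_L2_duality:
  assumes k: "is_fourier_L2 g k" and g: "sq_integrable g"
    and h: "sq_integrable h" "integrable lborel h"
  shows "(\<integral>\<xi>. k \<xi> * h \<xi> \<partial>lborel) = (\<integral>x. g x * fourier h x \<partial>lborel)"
proof (rule tendsto_unique[OF trivial_limit_at_top_linorder])
  have "((\<lambda>R. \<integral>\<xi>. fourier (trunc R g) \<xi> * h \<xi> \<partial>lborel) \<longlongrightarrow> (\<integral>\<xi>. k \<xi> * h \<xi> \<partial>lborel)) at_top"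
    using k by (intro tendsto_integral_mult_sq_norm h sq_integrable_fourier integrable_trunc g sq_integrable_trunc)
       (auto simp: is_fourier_L2_def)
  then show "((\<lambda>R. \<integral>x. trunc R g x * fourier h x \<partial>lborel) \<longlongrightarrow> (\<integral>\<xi>. k \<xi> * h \<xi> \<partial>lborel)) at_top"
    by (simp add: fourier_duality integrable_trunc g h)
  show "((\<lambda>R. \<integral>x. trunc R g x * fourier h x \<partial>lborel) \<longlongrightarrow> (\<integral>x. g x * fourier h x \<partial>lborel)) at_top"
    using tail_tendsto[OF g] unfolding tail_def
    by (intro tendsto_integral_mult_sq_norm h sq_integrable_fourier g sq_integrable_trunc)
qed

lemma is_fourier_L2_fourier:
  assumes g: "integrable lborel g" "sq_integrable g"
  shows "is_fourier_L2 g (fourier g)"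
proof -
  have "sq_norm (\<lambda>\<xi>. fourier (trunc R g) \<xi> - fourier g \<xi>) \<le> tail g R" for R
  proof -
    have "fourier (\<lambda>x. trunc R g x - g x) = (\<lambda>\<xi>. fourier (trunc R g) \<xi> - fourier g \<xi>)"
      by (rule ext) (simp add: fourier_diff integrable_trunc g)
    then show ?thesis
      using sq_norm_fourier_le[of "\<lambda>x. trunc R g x - g x"]
      by (simp add: integrable_trunc g tail_def)
  qed
  then have "((\<lambda>R. sq_norm (\<lambda>\<xi>. fourier (trunc R g) \<xi> - fourier g \<xi>)) \<longlongrightarrow> 0) at_top"
    by (intro tendsto_sandwich[OF always_eventually always_eventually tendsto_const tail_tendsto[OF g(2)]]) (simp_all only: zero_le simp_thms)
  then show ?thesis
    by (simp add: is_fourier_L2_def sq_integrable_fourier g)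
qed

lemma is_fourier_L2_unique:
  assumes g: "sq_integrable g" and k: "is_fourier_L2 g k" "is_fourier_L2 g k'"
  shows "AE x in lborel. k x = k' x"
proof -
  have [measurable]: "k \<in> borel_measurable borel" "k' \<in> borel_measurable borel"
    using k by (auto simp: is_fourier_L2_def sq_integrable_def)
  have [measurable]: "g \<in> borel_measurable borel"
    using g by (simp add: sq_integrable_def)
  have "sq_norm (\<lambda>\<xi>. k \<xi> - k' \<xi>) \<le> 2 * 0 + 2 * 0"
  proof (rule tendsto_lowerbound[OF _ _ trivial_limit_at_top_linorder])
    show "((\<lambda>R. 2 * sq_norm (\<lambda>\<xi>. k \<xi> - fourier (trunc R g) \<xi>) + 2 * sq_norm (\<lambda>\<xi>. fourier (trunc R g) \<xi> - k' \<xi>)) \<longlongrightarrow> 2 * 0 + 2 * 0) at_top"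
      using k by (intro tendsto_add tendsto_mult_ennreal tendsto_const)
         (auto simp: is_fourier_L2_def sq_norm_diff_commute[of k])
    show "\<forall>\<^sub>F R in at_top. sq_norm (\<lambda>\<xi>. k \<xi> - k' \<xi>) \<le> 2 * sq_norm (\<lambda>\<xi>. k \<xi> - fourier (trunc R g) \<xi>) + 2 * sq_norm (\<lambda>\<xi>. fourier (trunc R g) \<xi> - k' \<xi>)"
      by (intro always_eventually allI sq_norm_triangle) measurable
  qed
  then have "(\<integral>\<^sup>+x. ennreal ((norm (k x - k' x))\<^sup>2) \<partial>lborel) = 0"
    by (simp add: sq_norm_def)
  then show ?thesis
    by (subst (asm) nn_integral_0_iff_AE) auto
qed

lemma fourier_trunc_cong_AE:
  assumes g: "g \<in> borel_measurable lebesgue" and [measurable]: "h \<in> borel_measurable borel"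
    and eq: "AE x in lborel. g x = h x"
  shows "fourier (\<lambda>x. indicator (ball 0 R) x *\<^sub>R g x) = fourier (trunc R h)"
proof
  fix \<xi> :: "real^'a"
  have m: "(\<lambda>x. indicator (ball 0 R) x :: real) \<in> borel_measurable lebesgue" "(\<lambda>x. cis (- 2 * pi * (x \<bullet> \<xi>))) \<in> borel_measurable lebesgue"
    by (auto intro!: measurable_completion borel_measurable_indicator)
  show "fourier (\<lambda>x. indicator (ball 0 R) x *\<^sub>R g x) \<xi> = fourier (trunc R h) \<xi>"
    unfolding fourier_def
  proof (rule integral_cong_AE)
    show "(\<lambda>x. cis (- 2 * pi * (x \<bullet> \<xi>)) * indicator (ball 0 R) x *\<^sub>R g x) \<in> borel_measurable lebesgue"
      by (intro borel_measurable_times borel_measurable_scaleR m g)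
    show "(\<lambda>x. cis (- 2 * pi * (x \<bullet> \<xi>)) * trunc R h x) \<in> borel_measurable lebesgue"
      by (rule measurable_completion) measurable
    show "AE x in lebesgue. cis (- 2 * pi * (x \<bullet> \<xi>)) * indicator (ball 0 R) x *\<^sub>R g x = cis (- 2 * pi * (x \<bullet> \<xi>)) * trunc R h x"
      using eq by (auto simp: AE_completion_iff trunc_def)
  qed
qed

text \<open>Completeness provides a witness for the \<open>SOME\<close> in
  \<open>fourier_L2\<close>, and whatever is chosen has a Borel version. Changing the function on a
  null set alters none of the truncated transforms, hence \<open>h\<close> can stand for
  \<open>g\<close>.\<close>

lemma fourier_L2_is_fourier_L2:
  assumes h: "sq_integrable h" and eq: "AE x in lborel. g x = h x"
  shows "\<exists>k. is_fourier_L2 h k \<and> (AE x in lborel. fourier_L2 g x = k x)"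
proof -
  have g: "g \<in> borel_measurable lebesgue"
    using sq_integrable_imp_Lp2[OF h eq] by (simp add: Lp_def)
  note [measurable] = sq_integrable_measurable[OF h]
  note tr = fourier_trunc_cong_AE[OF g sq_integrable_measurable[OF h] eq]
  define Q where "Q k \<longleftrightarrow> k \<in> Lp 2 \<and>
     ((\<lambda>R. \<integral>\<^sup>+\<xi>. ennreal ((norm (fourier (\<lambda>x. indicator (ball 0 R) x *\<^sub>R g x) \<xi> - k \<xi>))\<^sup>2) \<partial>lebesgue) \<longlongrightarrow> 0) at_top" for k
  have Q_iff: "Q k \<longleftrightarrow> k \<in> Lp 2 \<and> ((\<lambda>R. sq_norm (\<lambda>\<xi>. fourier (trunc R h) \<xi> - k \<xi>)) \<longlongrightarrow> 0) at_top" for k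
    unfolding Q_def tr by (simp add: sq_norm_def nn_integral_completion)
  obtain k0 where "is_fourier_L2 h k0"
    using fourier_trunc_limit[OF h] by (auto simp: is_fourier_L2_def)
  then have "Q k0"
    unfolding Q_iff by (auto simp: is_fourier_L2_def intro: sq_integrable_imp_Lp2)
  then have "Q (fourier_L2 g)"
    unfolding fourier_L2_def Q_def[symmetric] by (rule someI[of Q])
  then obtain k where k: "sq_integrable k" "AE x in lborel. fourier_L2 g x = k x"
    and lim: "((\<lambda>R. sq_norm (\<lambda>\<xi>. fourier (trunc R h) \<xi> - fourier_L2 g \<xi>)) \<longlongrightarrow> 0) at_top"
    unfolding Q_iff using Lp2_ex_sq_integrable by blast
  have "sq_norm (\<lambda>\<xi>. fourier (trunc R h) \<xi> - fourier_L2 g \<xi>) = sq_norm (\<lambda>\<xi>. fourier (trunc R h) \<xi> - k \<xi>)" for R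
    by (rule sq_norm_cong_AE) (use k(2) in auto)
  then show ?thesis
    using k lim by (auto simp: is_fourier_L2_def)
qed

lemma fourier_L2_fourier:
  assumes h: "integrable lborel h" "sq_integrable h" and eq: "AE x in lborel. g x = h x"
  shows "AE x in lborel. fourier_L2 g x = fourier h x"
proof -
  obtain k where k: "is_fourier_L2 h k" "AE x in lborel. fourier_L2 g x = k x"
    using fourier_L2_is_fourier_L2[OF h(2) eq] by blast
  then show ?thesis
    using is_fourier_L2_unique[OF h(2) k(1) is_fourier_L2_fourier[OF h]] by auto
qed

section \<open>Negative powers as superpositions of exponentials\<close>

definition bessel_weight :: "real \<Rightarrow> real \<Rightarrow> real \<Rightarrow> real" where
  "bessel_weight \<sigma> \<mu> \<tau> = indicator {0<..} \<tau> * (\<tau> powr (\<sigma> - 1) * exp (- \<mu> * \<tau>) / Gamma \<sigma>)"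

lemma measurable_bessel_weight [measurable]: "bessel_weight \<sigma> \<mu> \<in> borel_measurable borel"
  unfolding bessel_weight_def by measurable

lemma bessel_weight_nonneg: "\<sigma> > 0 \<Longrightarrow> bessel_weight \<sigma> \<mu> \<tau> \<ge> 0"
  by (auto simp: bessel_weight_def less_imp_le[OF Gamma_real_pos])

lemma bessel_weight_zero: "\<tau> \<le> 0 \<Longrightarrow> bessel_weight \<sigma> \<mu> \<tau> = 0"
  by (simp add: bessel_weight_def)

lemma bessel_weight_exp: "bessel_weight \<sigma> \<mu> \<tau> * exp (- c * \<tau>) = bessel_weight \<sigma> (\<mu> + c) \<tau>"
  by (simp add: bessel_weight_def algebra_simps flip: exp_add)

text \<open>The Gamma integral with its variable scaled by \<open>b\<close>. For b = \<mu> + 4 pi^2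
  |\<xi>|^2 it writes the symbol of (-\<Delta> + \<mu>)^-\<sigma> as a superposition of Gaussians,
  hence the operator as a superposition of heat semigroups with density
  \<open>bessel_weight\<close>.\<close>

lemma nn_integral_bessel_weight:
  assumes "\<sigma> > 0" "b > 0"
  shows "(\<integral>\<^sup>+\<tau>. ennreal (bessel_weight \<sigma> b \<tau>) \<partial>lborel) = ennreal (b powr - \<sigma>)"
proof -
  have G: "Gamma \<sigma> > 0" using assms(1) by (rule Gamma_real_pos)
  note G0 = less_imp_neq[OF G, symmetric]
  have "ennreal (Gamma \<sigma>) = (\<integral>\<^sup>+t. ennreal (indicator {0..} t * t powr (\<sigma> - 1) / exp t) \<partial>lborel)"
    using Gamma_conv_nn_integral_real[OF assms(1)] by simp
  also have "\<dots> = ennreal b * (\<integral>\<^sup>+t. ennreal (indicator {0..} (0 + b * t) * (0 + b * t) powr (\<sigma> - 1) / exp (0 + b * t)) \<partial>lborel)"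
    using assms by (subst nn_integral_real_affine[where c=b and t=0]) auto
  also have "\<dots> = ennreal b * (\<integral>\<^sup>+t. ennreal (b powr (\<sigma> - 1) * Gamma \<sigma>) * ennreal (bessel_weight \<sigma> b t) \<partial>lborel)"
  proof (intro arg_cong2[where f="(*)"] nn_integral_cong refl)
    fix t :: real
    have "indicator {0..} (0 + b * t) * (0 + b * t) powr (\<sigma> - 1) / exp (0 + b * t)
      = (b powr (\<sigma> - 1) * Gamma \<sigma>) * bessel_weight \<sigma> b t"
    proof (cases "t > 0")
      case True
      then show ?thesis
        using assms G0 by (simp add: bessel_weight_def powr_mult exp_minus field_simps)
    next
      case False
      then have "indicator {0..} (0 + b * t) * (0 + b * t) powr (\<sigma> - 1) = 0"
        using assms by (cases "t = 0") (auto simp: indicator_def zero_le_mult_iff)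
      then show ?thesis
        using False by (simp add: bessel_weight_zero)
    qed
    then show "ennreal (indicator {0..} (0 + b * t) * (0 + b * t) powr (\<sigma> - 1) / exp (0 + b * t))
      = ennreal (b powr (\<sigma> - 1) * Gamma \<sigma>) * ennreal (bessel_weight \<sigma> b t)"
      using G by (simp only: ennreal_mult'[symmetric] ennreal_mult'' bessel_weight_nonneg assms)
  qed
  also have "\<dots> = ennreal (b powr \<sigma> * Gamma \<sigma>) * (\<integral>\<^sup>+t. ennreal (bessel_weight \<sigma> b t) \<partial>lborel)"
    using assms G by (simp add: nn_integral_cmult mult.assoc[symmetric] powr_mult_base flip: ennreal_mult)
  finally have eq: "ennreal (Gamma \<sigma>) = ennreal (b powr \<sigma> * Gamma \<sigma>) * (\<integral>\<^sup>+t. ennreal (bessel_weight \<sigma> b t) \<partial>lborel)" .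
  have "ennreal (b powr - \<sigma> / Gamma \<sigma>) * ennreal (Gamma \<sigma>) = ennreal (b powr - \<sigma>)"
    using less_imp_le[OF G] G0 by (simp flip: ennreal_mult)
  moreover have "ennreal (b powr - \<sigma> / Gamma \<sigma>) * (ennreal (b powr \<sigma> * Gamma \<sigma>) * (\<integral>\<^sup>+t. ennreal (bessel_weight \<sigma> b t) \<partial>lborel))
     = (\<integral>\<^sup>+t. ennreal (bessel_weight \<sigma> b t) \<partial>lborel)"
    using less_imp_le[OF G] G0 assms by (simp add: mult.assoc[symmetric] powr_minus flip: ennreal_mult)
  ultimately show ?thesis
    using eq by simp
qed

lemma bessel_weight_integral:
  assumes "\<sigma> > 0" "b > 0"
  shows "integrable lborel (bessel_weight \<sigma> b)" "integral\<^sup>L lborel (bessel_weight \<sigma> b) = b powr - \<sigma>"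
proof -
  have "has_bochner_integral lborel (bessel_weight \<sigma> b) (b powr - \<sigma>)"
    using assms by (intro has_bochner_integral_nn_integral) (auto simp: bessel_weight_nonneg nn_integral_bessel_weight)
  then show "integrable lborel (bessel_weight \<sigma> b)" "integral\<^sup>L lborel (bessel_weight \<sigma> b) = b powr - \<sigma>"
    by (auto simp: has_bochner_integral_iff)
qed

subsection \<open>Bessel potentials of Gaussians\<close>

lemma integral_lborel_translation:
  fixes f :: "'a::euclidean_space \<Rightarrow> 'b::{banach, second_countable_topology}"
  assumes [measurable]: "f \<in> borel_measurable borel"
  shows "(\<integral>x. f (c + x) \<partial>lborel) = (\<integral>x. f x \<partial>lborel)"
    and "integrable lborel (\<lambda>x. f (c + x)) \<longleftrightarrow> integrable lborel f"
proof -
  have "(\<integral>x. f x \<partial>lborel) = (\<integral>x. f x \<partial>distr lborel borel ((+) c))"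
    by (simp add: lborel_distr_plus)
  also have "\<dots> = (\<integral>x. f (c + x) \<partial>lborel)"
    by (rule integral_distr) simp_all
  finally show "(\<integral>x. f (c + x) \<partial>lborel) = (\<integral>x. f x \<partial>lborel)" ..
  have "integrable lborel f \<longleftrightarrow> integrable (distr lborel borel ((+) c)) f"
    by (simp add: lborel_distr_plus)
  also have "\<dots> \<longleftrightarrow> integrable lborel (\<lambda>x. f (c + x))"
    by (rule integrable_distr_eq) simp_all
  finally show "integrable lborel (\<lambda>x. f (c + x)) \<longleftrightarrow> integrable lborel f" ..
qed

lemma lborel_distr_isometry:
  fixes R :: "'a::euclidean_space \<Rightarrow> 'a"
  assumes lin: "linear R" and norm_R: "\<And>x. norm (R x) = norm x"
  shows "R \<in> borel_measurable borel" "distr lborel borel R = lborel"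
proof -
  show R [measurable]: "R \<in> borel_measurable borel"
    using lin by (intro borel_measurable_continuous_onI) (simp add: linear_continuous_on linear_conv_bounded_linear)
  show "distr lborel borel R = lborel"
  proof (rule measure_eqI)
    fix A assume "A \<in> sets (distr lborel borel R)"
    then have [measurable]: "A \<in> sets borel" by simp
    have "emeasure (distr lborel borel R) A = (\<integral>\<^sup>+x. indicator A x \<partial>distr lborel borel R)"
      by simp
    also have "\<dots> = (\<integral>\<^sup>+x. indicator A (R x) \<partial>lborel)"
      by (rule nn_integral_distr) measurable
    also have "\<dots> = emeasure lborel A"
      by (subst nn_integral_lborel_isometry[OF lin norm_R]) simp_all
    finally show "emeasure (distr lborel borel R) A = emeasure lborel A" .
  qed simp
qed

lemma integral_lborel_isometry:
  fixes R :: "'a::euclidean_space \<Rightarrow> 'a" and f :: "'a \<Rightarrow> 'b::{banach, second_countable_topology}"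
  assumes R: "linear R" "\<And>x. norm (R x) = norm x"
    and [measurable]: "f \<in> borel_measurable borel"
  shows "(\<integral>x. f (R x) \<partial>lborel) = (\<integral>x. f x \<partial>lborel)"
    and "integrable lborel (\<lambda>x. f (R x)) \<longleftrightarrow> integrable lborel f"
proof -
  note [measurable] = lborel_distr_isometry(1)[OF R]
  have "(\<integral>x. f x \<partial>lborel) = (\<integral>x. f x \<partial>distr lborel borel R)"
    by (simp only: lborel_distr_isometry(2)[OF R])
  also have "\<dots> = (\<integral>x. f (R x) \<partial>lborel)"
    by (rule integral_distr) simp_all
  finally show "(\<integral>x. f (R x) \<partial>lborel) = (\<integral>x. f x \<partial>lborel)" ..
  have "integrable lborel f \<longleftrightarrow> integrable (distr lborel borel R) f"
    by (simp only: lborel_distr_isometry(2)[OF R])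
  also have "\<dots> \<longleftrightarrow> integrable lborel (\<lambda>x. f (R x))"
    by (rule integrable_distr_eq) simp_all
  finally show "integrable lborel (\<lambda>x. f (R x)) \<longleftrightarrow> integrable lborel f" ..
qed

lemma AE_lborel_uminus:
  assumes "AE x in lborel. P (x::'a::euclidean_space)"
  shows "AE x in lborel. P (- x)"
proof -
  have "distr lborel borel uminus = (lborel :: 'a measure)"
    by (rule lborel_distr_isometry) (simp_all add: linear_uminus)
  then have "AE x in distr lborel borel (uminus :: 'a \<Rightarrow> 'a). P x"
    by (rule ssubst) (rule assms)
  then show ?thesis
    by (rule AE_distrD[rotated]) simp
qed

lemma nn_integral_bessel_weight_heat_kernel:
  assumes "\<sigma> > 0" "\<tau> > 0 \<Longrightarrow> r > 0"
  shows "(\<integral>\<^sup>+x. ennreal (bessel_weight \<sigma> \<mu> \<tau> * heat_kernel r x) \<partial>(lborel :: 'a::euclidean_space measure)) = ennreal (bessel_weight \<sigma> \<mu> \<tau>)"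
proof (cases "\<tau> > 0")
  case True
  then have "(\<integral>\<^sup>+x. ennreal (heat_kernel r x) \<partial>(lborel :: 'a measure)) = 1"
    using nn_integral_heat_kernel_diff(1)[of r "0::'a"] assms by simp
  then show ?thesis
    using assms by (simp add: ennreal_mult' bessel_weight_nonneg nn_integral_cmult)
qed (simp add: bessel_weight_zero)

lemma bessel_weight_heat_kernel_antimono:
  fixes x y :: "'a::euclidean_space"
  assumes "\<sigma> > 0" "norm x \<le> norm y"
  shows "bessel_weight \<sigma> \<mu> \<tau> * heat_kernel \<tau> y \<le> bessel_weight \<sigma> \<mu> \<tau> * heat_kernel \<tau> x"
  using assms by (cases "\<tau> > 0") (auto simp: bessel_weight_zero intro!: mult_left_mono bessel_weight_nonneg heat_kernel_antimono)

lemma bessel_weight_gaussian: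
  "bessel_weight \<sigma> \<mu> \<tau> * gaussian (t + \<tau>) \<xi> = gaussian t \<xi> * bessel_weight \<sigma> (\<mu> + 4 * pi\<^sup>2 * (norm \<xi>)\<^sup>2) \<tau>"
proof -
  have "gaussian (t + \<tau>) \<xi> = gaussian t \<xi> * exp (- (4 * pi\<^sup>2 * (norm \<xi>)\<^sup>2) * \<tau>)"
    unfolding exp_add[symmetric] by (rule arg_cong[where f=exp]) (simp add: algebra_simps)
  then show ?thesis
    by (simp only: bessel_weight_exp[symmetric] mult_ac)
qed

text \<open>The operator (-\<Delta> + \<mu>)^-\<sigma> applied to the heat kernel of time
  \<open>t\<close>. The positive time smooths the singularity at the origin, so that this function
  and its transform are both bounded and integrable.\<close>

definition bessel_heat :: "real \<Rightarrow> real \<Rightarrow> real \<Rightarrow> 'a::euclidean_space \<Rightarrow> real" where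
  "bessel_heat \<sigma> \<mu> t x = (\<integral>\<tau>. bessel_weight \<sigma> \<mu> \<tau> * heat_kernel (t + \<tau>) x \<partial>lborel)"

lemma measurable_bessel_heat [measurable]: "bessel_heat \<sigma> \<mu> t \<in> borel_measurable borel"
  unfolding bessel_heat_def by measurable

lemma bessel_heat_minus [simp]: "bessel_heat \<sigma> \<mu> t (- x) = bessel_heat \<sigma> \<mu> t x"
  by (simp add: bessel_heat_def)

text \<open>The transform of \<open>bessel_heat\<close> centred at \<open>a\<close>. The order
  \<sigma> may be any real number, zero included: multiplication by a power of \<mu> + 4 pi^2
  |\<xi>|^2 then only changes the order.\<close>

definition bessel_symbol :: "real \<Rightarrow> real \<Rightarrow> real \<Rightarrow> real^'n \<Rightarrow> real^'n \<Rightarrow> complex" where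
  "bessel_symbol \<sigma> \<mu> t a \<xi> = cis (- 2 * pi * (\<xi> \<bullet> a)) *
     of_real (gaussian t \<xi> * (\<mu> + 4 * pi\<^sup>2 * (norm \<xi>)\<^sup>2) powr - \<sigma>)"

context
  fixes \<sigma> \<mu> t :: real
  assumes pos: "\<sigma> > 0" "\<mu> > 0" "t > 0"
begin

lemma bessel_weight_heat_kernel_le:
  "bessel_weight \<sigma> \<mu> \<tau> * heat_kernel (t + \<tau>) (x::'a::euclidean_space)
     \<le> bessel_weight \<sigma> \<mu> \<tau> * (4 * pi * t) powr (- real DIM('a) / 2)"
proof (cases "\<tau> > 0")
  case True
  have "heat_kernel (t + \<tau>) x \<le> (4 * pi * (t + \<tau>)) powr (- real DIM('a) / 2)"
    using True pos by (intro heat_kernel_le) simp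
  also have "\<dots> \<le> (4 * pi * t) powr (- real DIM('a) / 2)"
    using True pos by (intro powr_mono2') auto
  finally show ?thesis
    using pos by (intro mult_left_mono bessel_weight_nonneg)
qed (simp add: bessel_weight_zero)

lemma integrable_bessel_heat_integrand:
  "integrable lborel (\<lambda>\<tau>. bessel_weight \<sigma> \<mu> \<tau> * heat_kernel (t + \<tau>) (x::'a::euclidean_space))"
proof (rule Bochner_Integration.integrable_bound)
  show "integrable lborel (\<lambda>\<tau>. bessel_weight \<sigma> \<mu> \<tau> * (4 * pi * t) powr (- real DIM('a) / 2))"
    using pos by (intro integrable_mult_left bessel_weight_integral)
  show "AE \<tau> in lborel. norm (bessel_weight \<sigma> \<mu> \<tau> * heat_kernel (t + \<tau>) x)
     \<le> norm (bessel_weight \<sigma> \<mu> \<tau> * (4 * pi * t) powr (- real DIM('a) / 2))"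
    using bessel_weight_heat_kernel_le bessel_weight_nonneg pos by (intro AE_I2) simp
qed measurable

lemma bessel_heat_nonneg: "bessel_heat \<sigma> \<mu> t x \<ge> 0"
  unfolding bessel_heat_def
  using pos by (intro integral_nonneg_AE AE_I2 mult_nonneg_nonneg bessel_weight_nonneg) auto

lemma ennreal_bessel_heat:
  "ennreal (bessel_heat \<sigma> \<mu> t x) = (\<integral>\<^sup>+\<tau>. ennreal (bessel_weight \<sigma> \<mu> \<tau> * heat_kernel (t + \<tau>) x) \<partial>lborel)"
  unfolding bessel_heat_def
  using pos by (intro nn_integral_eq_integral[symmetric] integrable_bessel_heat_integrand AE_I2 mult_nonneg_nonneg bessel_weight_nonneg) auto

lemma bessel_heat_le:
  "bessel_heat \<sigma> \<mu> t (x::'a::euclidean_space) \<le> \<mu> powr - \<sigma> * (4 * pi * t) powr (- real DIM('a) / 2)"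
proof -
  have "bessel_heat \<sigma> \<mu> t x \<le> (\<integral>\<tau>. bessel_weight \<sigma> \<mu> \<tau> * (4 * pi * t) powr (- real DIM('a) / 2) \<partial>lborel)"
    unfolding bessel_heat_def
    using pos by (intro integral_mono integrable_bessel_heat_integrand bessel_weight_heat_kernel_le integrable_mult_left bessel_weight_integral)
  then show ?thesis
    using pos by (simp add: bessel_weight_integral)
qed

lemma integrable_bessel_heat: "integrable lborel (bessel_heat \<sigma> \<mu> t :: 'a::euclidean_space \<Rightarrow> real)"
proof (rule integrableI_bounded)
  have "(\<integral>\<^sup>+x. ennreal (norm (bessel_heat \<sigma> \<mu> t x)) \<partial>(lborel :: 'a measure))
    = (\<integral>\<^sup>+x. (\<integral>\<^sup>+\<tau>. ennreal (bessel_weight \<sigma> \<mu> \<tau> * heat_kernel (t + \<tau>) x) \<partial>lborel) \<partial>(lborel :: 'a measure))"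
    by (simp add: bessel_heat_nonneg ennreal_bessel_heat)
  also have "\<dots> = (\<integral>\<^sup>+\<tau>. (\<integral>\<^sup>+x. ennreal (bessel_weight \<sigma> \<mu> \<tau> * heat_kernel (t + \<tau>) x) \<partial>(lborel :: 'a measure)) \<partial>lborel)"
    by (rule lborel_pair.Fubini'[of "\<lambda>\<tau> x. ennreal (bessel_weight \<sigma> \<mu> \<tau> * heat_kernel (t + \<tau>) (x::'a))", simplified]) measurable
  also have "\<dots> = (\<integral>\<^sup>+\<tau>. ennreal (bessel_weight \<sigma> \<mu> \<tau>) \<partial>lborel)"
    using pos by (intro nn_integral_cong nn_integral_bessel_weight_heat_kernel) simp_all
  also have "\<dots> < \<infinity>"
    using pos by (simp add: nn_integral_bessel_weight)
  finally show "(\<integral>\<^sup>+x. ennreal (norm (bessel_heat \<sigma> \<mu> t x)) \<partial>(lborel :: 'a measure)) < \<infinity>" .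
qed measurable

lemma integrable_bessel_heat_diff:
  "integrable lborel (\<lambda>x. bessel_heat \<sigma> \<mu> t (x - a) :: real)"
  using integral_lborel_translation(2)[of "bessel_heat \<sigma> \<mu> t" "- a"] integrable_bessel_heat
  by simp

lemma bessel_heat_fourier_0:
  fixes \<xi> :: "real^'n"
  shows "fourier (\<lambda>x. of_real (bessel_heat \<sigma> \<mu> t x)) \<xi>
    = of_real (gaussian t \<xi> * (\<mu> + 4 * pi\<^sup>2 * (norm \<xi>)\<^sup>2) powr - \<sigma>)"
proof -
  define F where "F x \<tau> = cis (- 2 * pi * (x \<bullet> \<xi>)) * of_real (bessel_weight \<sigma> \<mu> \<tau> * heat_kernel (t + \<tau>) x)" for x :: "real^'n" and \<tau>
  have [measurable]: "case_prod F \<in> borel_measurable (lborel \<Otimes>\<^sub>M lborel)"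
    unfolding F_def by measurable
  have normF: "norm (F x \<tau>) = bessel_weight \<sigma> \<mu> \<tau> * heat_kernel (t + \<tau>) x" for x \<tau>
    unfolding F_def using pos by (simp add: norm_mult bessel_weight_nonneg)
  have F: "integrable (lborel \<Otimes>\<^sub>M lborel) (case_prod F)"
  proof (rule lborel_pair.Fubini_integrable)
    show "integrable lborel (\<lambda>x. \<integral>\<tau>. norm (case (x, \<tau>) of (x, \<tau>) \<Rightarrow> F x \<tau>) \<partial>lborel)"
      using integrable_bessel_heat unfolding bessel_heat_def[abs_def] by (simp add: normF)
    have "integrable lborel (F x)" for x
      unfolding F_def by (intro integrable_mult_right integrable_of_real integrable_bessel_heat_integrand)
    then show "AE x in lborel. integrable lborel (\<lambda>\<tau>. case (x, \<tau>) of (x, \<tau>) \<Rightarrow> F x \<tau>)"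
      by simp
  qed measurable
  have "fourier (\<lambda>x. of_real (bessel_heat \<sigma> \<mu> t x)) \<xi> = (\<integral>x. (\<integral>\<tau>. F x \<tau> \<partial>lborel) \<partial>lborel)"
  proof -
    have "(\<integral>\<tau>. F x \<tau> \<partial>lborel) = cis (- 2 * pi * (x \<bullet> \<xi>)) * of_real (bessel_heat \<sigma> \<mu> t x)" for x
      by (simp only: F_def integral_mult_right_zero integral_complex_of_real bessel_heat_def)
    then show ?thesis
      by (subst fourier_eq_lborel) simp_all
  qed
  also have "\<dots> = (\<integral>\<tau>. (\<integral>x. F x \<tau> \<partial>lborel) \<partial>lborel)"
    by (rule lborel_pair.Fubini_integral[OF F, symmetric])
  also have "\<dots> = (\<integral>\<tau>. of_real (gaussian t \<xi> * bessel_weight \<sigma> (\<mu> + 4 * pi\<^sup>2 * (norm \<xi>)\<^sup>2) \<tau>) \<partial>lborel)"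
  proof (rule Bochner_Integration.integral_cong[OF refl])
    fix \<tau> :: real
    show "(\<integral>x. F x \<tau> \<partial>lborel) = of_real (gaussian t \<xi> * bessel_weight \<sigma> (\<mu> + 4 * pi\<^sup>2 * (norm \<xi>)\<^sup>2) \<tau>)"
    proof (cases "\<tau> > 0")
      case True
      have "(\<integral>x. F x \<tau> \<partial>lborel) = of_real (bessel_weight \<sigma> \<mu> \<tau>) * (\<integral>x. cis (- 2 * pi * (x \<bullet> \<xi>)) * of_real (heat_kernel (t + \<tau>) x) \<partial>lborel)"
        unfolding integral_mult_right_zero[symmetric] F_def by (simp add: mult_ac)
      also have "\<dots> = of_real (bessel_weight \<sigma> \<mu> \<tau>) * of_real (gaussian (t + \<tau>) \<xi>)"
        using True pos by (subst heat_kernel_fourier(2)) simp_all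
      finally show ?thesis
        by (simp only: of_real_mult[symmetric] bessel_weight_gaussian)
    qed (simp add: F_def bessel_weight_zero)
  qed
  also have "\<dots> = of_real (gaussian t \<xi> * (\<mu> + 4 * pi\<^sup>2 * (norm \<xi>)\<^sup>2) powr - \<sigma>)"
  proof -
    have "\<mu> + 4 * pi\<^sup>2 * (norm \<xi>)\<^sup>2 > 0"
      using pos by (simp add: add_pos_nonneg)
    then show ?thesis
      using pos by (simp only: integral_complex_of_real integral_mult_right_zero bessel_weight_integral(2))
  qed
  finally show ?thesis .
qed

lemma bessel_heat_fourier:
  fixes \<xi> a :: "real^'n"
  shows "fourier (\<lambda>x. of_real (bessel_heat \<sigma> \<mu> t (x - a))) \<xi> = bessel_symbol \<sigma> \<mu> t a \<xi>"
proof -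
  have "fourier (\<lambda>x. of_real (bessel_heat \<sigma> \<mu> t (x - a))) \<xi>
    = (\<integral>x. cis (- 2 * pi * ((a + x) \<bullet> \<xi>)) * of_real (bessel_heat \<sigma> \<mu> t (a + x - a)) \<partial>lborel)"
    by (subst fourier_eq_lborel, measurable, subst integral_lborel_translation(1)[where c=a, symmetric]) measurable
  also have "\<dots> = (\<integral>x. cis (- 2 * pi * (\<xi> \<bullet> a)) * (cis (- 2 * pi * (x \<bullet> \<xi>)) * of_real (bessel_heat \<sigma> \<mu> t x)) \<partial>lborel)"
    by (intro Bochner_Integration.integral_cong refl)
       (simp add: mult.assoc[symmetric] cis_mult inner_add_left distrib_left inner_commute[of \<xi> a])
  also have "\<dots> = bessel_symbol \<sigma> \<mu> t a \<xi>"
    using bessel_heat_fourier_0[of \<xi>] by (simp add: bessel_symbol_def fourier_eq_lborel)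
  finally show ?thesis .
qed

lemma integrable_bessel_symbol:
  "integrable lborel (bessel_symbol \<sigma> \<mu> t a)" "sq_integrable (bessel_symbol \<sigma> \<mu> t a)"
  "integrable lborel (\<lambda>x. complex_of_real (bessel_heat \<sigma> \<mu> t (x - a)))"
  "sq_integrable (\<lambda>x. complex_of_real (bessel_heat \<sigma> \<mu> t (x - a)))"
proof -
  show v: "integrable lborel (\<lambda>x. complex_of_real (bessel_heat \<sigma> \<mu> t (x - a)))"
    by (intro integrable_of_real integrable_bessel_heat_diff)
  have sq: "sq_integrable g" if g: "integrable lborel g" "\<And>x. norm (g x) \<le> C" for g :: "real^'a \<Rightarrow> complex" and C
  proof -
    have "C \<ge> 0" using order_trans[OF norm_ge_zero g(2)] .
    have "sq_norm g \<le> (\<integral>\<^sup>+x. ennreal C * ennreal (norm (g x)) \<partial>lborel)"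
      unfolding sq_norm_def using \<open>C \<ge> 0\<close>
      by (intro nn_integral_mono) (auto simp: power2_eq_square ennreal_mult[symmetric] intro!: ennreal_leI mult_right_mono g)
    also have "\<dots> < \<infinity>"
      using g(1) borel_measurable_integrable[OF g(1)] by (simp add: nn_integral_cmult ennreal_mult_less_top integrable_iff_bounded)
    finally show ?thesis
      using borel_measurable_integrable[OF g(1)] by (simp add: sq_integrable_def)
  qed
  show "sq_integrable (\<lambda>x. complex_of_real (bessel_heat \<sigma> \<mu> t (x - a)))"
  proof (rule sq[OF v])
    show "norm (complex_of_real (bessel_heat \<sigma> \<mu> t (x - a))) \<le> \<mu> powr - \<sigma> * (4 * pi * t) powr (- real DIM(real^'a) / 2)" for x
      using bessel_heat_le[of "x - a"] bessel_heat_nonneg[of "x - a"]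
      by (simp only: norm_of_real abs_of_nonneg)
  qed
  have sym_le: "norm (bessel_symbol \<sigma> \<mu> t a \<xi>) \<le> \<mu> powr - \<sigma> * gaussian t \<xi>" for \<xi>
  proof -
    have "(\<mu> + 4 * pi\<^sup>2 * (norm \<xi>)\<^sup>2) powr - \<sigma> \<le> \<mu> powr - \<sigma>"
      using pos by (intro powr_mono2') auto
    then show ?thesis
      by (simp add: bessel_symbol_def norm_mult)
  qed
  have gauss: "integrable lborel (\<lambda>\<xi>::real^'a. \<mu> powr - \<sigma> * gaussian t \<xi>)"
    using gaussian_fourier(1)[OF pos(3), of "0::real^'a"] by (intro integrable_mult_right) (simp add: complex_of_real_integrable_eq)
  show s: "integrable lborel (bessel_symbol \<sigma> \<mu> t a)"
    by (rule Bochner_Integration.integrable_bound[OF gauss])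
       (use sym_le in \<open>auto simp: bessel_symbol_def[abs_def] intro: order_trans\<close>)
  show "sq_integrable (bessel_symbol \<sigma> \<mu> t a)"
  proof (rule sq[OF s])
    fix \<xi>
    show "norm (bessel_symbol \<sigma> \<mu> t a \<xi>) \<le> \<mu> powr - \<sigma>"
      by (rule order_trans[OF sym_le]) (use pos in \<open>simp add: mult_le_cancel_left1\<close>)
  qed
qed

text \<open>Fourier inversion for the test functions, by computation: the negative power is expanded
  again into exponentials in \<tau>, each Gaussian is transformed, and the results add up to
  \<open>bessel_heat\<close>. The reflected argument is that of
  \<open>inv_fourier_L2\<close>.\<close>

lemma fourier_bessel_symbol:
  "fourier (bessel_symbol \<sigma> \<mu> t a) (- x) = of_real (bessel_heat \<sigma> \<mu> t (x - a))"
proof -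
  define F where "F \<xi> \<tau> = cis (2 * pi * (\<xi> \<bullet> (x - a))) * of_real (bessel_weight \<sigma> \<mu> \<tau> * gaussian (t + \<tau>) \<xi>)" for \<xi> \<tau>
  have [measurable]: "case_prod F \<in> borel_measurable (lborel \<Otimes>\<^sub>M lborel)"
    unfolding F_def by measurable
  have gauss: "integrable lborel (\<lambda>\<xi>::real^'a. gaussian t \<xi>)"
    using gaussian_fourier(1)[OF pos(3), of "0::real^'a"] by (simp add: complex_of_real_integrable_eq)
  have F: "integrable (lborel \<Otimes>\<^sub>M lborel) (case_prod F)"
  proof (rule Bochner_Integration.integrable_bound)
    show "integrable (lborel \<Otimes>\<^sub>M lborel) (\<lambda>(\<xi>::real^'a, \<tau>). gaussian t \<xi> * bessel_weight \<sigma> \<mu> \<tau>)"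
      using pos by (intro integrable_pair_mult gauss bessel_weight_integral)
    have "norm (F \<xi> \<tau>) \<le> gaussian t \<xi> * bessel_weight \<sigma> \<mu> \<tau>" for \<xi> \<tau>
    proof (cases "\<tau> > 0")
      case True
      then have "gaussian (t + \<tau>) \<xi> \<le> gaussian t \<xi>"
        unfolding exp_le_cancel_iff by (intro mult_right_mono) simp_all
      then have "bessel_weight \<sigma> \<mu> \<tau> * gaussian (t + \<tau>) \<xi> \<le> bessel_weight \<sigma> \<mu> \<tau> * gaussian t \<xi>"
        using pos by (intro mult_left_mono bessel_weight_nonneg)
      then show ?thesis
        using pos by (simp add: F_def norm_mult bessel_weight_nonneg mult_ac)
    qed (simp add: F_def bessel_weight_zero)
    then show "AE p in lborel \<Otimes>\<^sub>M lborel. norm (case_prod F p) \<le> norm (case p of (\<xi>, \<tau>) \<Rightarrow> gaussian t \<xi> * bessel_weight \<sigma> \<mu> \<tau>)"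
      using pos by (intro AE_I2) (auto simp: abs_mult bessel_weight_nonneg)
  qed measurable
  have "fourier (bessel_symbol \<sigma> \<mu> t a) (- x) = (\<integral>\<xi>. (\<integral>\<tau>. F \<xi> \<tau> \<partial>lborel) \<partial>lborel)"
  proof -
    have "cis (- 2 * pi * (\<xi> \<bullet> - x)) * bessel_symbol \<sigma> \<mu> t a \<xi> = (\<integral>\<tau>. F \<xi> \<tau> \<partial>lborel)" for \<xi>
    proof -
      have p: "\<mu> + 4 * pi\<^sup>2 * (norm \<xi>)\<^sup>2 > 0"
        using pos by (simp add: add_pos_nonneg)
      have "(\<integral>\<tau>. F \<xi> \<tau> \<partial>lborel) = cis (2 * pi * (\<xi> \<bullet> (x - a))) * of_real (gaussian t \<xi> * (\<mu> + 4 * pi\<^sup>2 * (norm \<xi>)\<^sup>2) powr - \<sigma>)"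
        unfolding F_def bessel_weight_gaussian integral_mult_right_zero integral_complex_of_real bessel_weight_integral(2)[OF pos(1) p] ..
      also have "cis (2 * pi * (\<xi> \<bullet> (x - a))) = cis (- 2 * pi * (\<xi> \<bullet> - x)) * cis (- 2 * pi * (\<xi> \<bullet> a))"
        by (simp add: cis_mult inner_diff_right right_diff_distrib)
      finally show ?thesis
        by (simp only: bessel_symbol_def mult.assoc)
    qed
    moreover have "bessel_symbol \<sigma> \<mu> t a \<in> borel_measurable borel"
      using borel_measurable_integrable[OF integrable_bessel_symbol(1)] by simp
    ultimately show ?thesis
      by (simp only: fourier_eq_lborel)
  qed
  also have "\<dots> = (\<integral>\<tau>. (\<integral>\<xi>. F \<xi> \<tau> \<partial>lborel) \<partial>lborel)"
    by (rule lborel_pair.Fubini_integral[OF F, symmetric])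
  also have "\<dots> = (\<integral>\<tau>. of_real (bessel_weight \<sigma> \<mu> \<tau> * heat_kernel (t + \<tau>) (x - a)) \<partial>lborel)"
  proof (rule Bochner_Integration.integral_cong[OF refl])
    fix \<tau> :: real
    show "(\<integral>\<xi>. F \<xi> \<tau> \<partial>lborel) = of_real (bessel_weight \<sigma> \<mu> \<tau> * heat_kernel (t + \<tau>) (x - a))"
    proof (cases "\<tau> > 0")
      case True
      have "(\<integral>\<xi>. F \<xi> \<tau> \<partial>lborel) = of_real (bessel_weight \<sigma> \<mu> \<tau>) *
         (\<integral>\<xi>. cis (- 2 * pi * (\<xi> \<bullet> (a - x))) * of_real (gaussian (t + \<tau>) \<xi>) \<partial>lborel)"
        unfolding integral_mult_right_zero[symmetric] F_def
        by (simp add: mult_ac inner_diff_right right_diff_distrib)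
      also have "\<dots> = of_real (bessel_weight \<sigma> \<mu> \<tau>) * of_real (heat_kernel (t + \<tau>) (a - x))"
        using True pos by (subst gaussian_fourier(2)) simp_all
      finally show ?thesis
        by (simp add: heat_kernel_commute)
    qed (simp add: F_def bessel_weight_zero)
  qed
  also have "\<dots> = of_real (bessel_heat \<sigma> \<mu> t (x - a))"
    by (simp add: bessel_heat_def del: of_real_mult)
  finally show ?thesis .
qed

end

subsection \<open>Testing the weak formulation\<close>

lemma integral_lebesgue_eq_lborel:
  fixes f f0 :: "real^'n \<Rightarrow> 'b::{euclidean_space}"
  assumes f0: "f0 \<in> borel_measurable borel" and eq: "AE x in lborel. f x = f0 x"
  shows "integral\<^sup>L lebesgue f = integral\<^sup>L lborel f0"
    and "integrable lebesgue f \<longleftrightarrow> integrable lborel f0"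
proof -
  have m0: "f0 \<in> borel_measurable lebesgue"
    using f0 by (simp add: measurable_completion)
  have AE: "AE x in lebesgue. f0 x = f x" "AE x in lebesgue. f x = f0 x"
    using eq by (auto simp: AE_completion_iff)
  have m: "f \<in> borel_measurable lebesgue"
    by (rule borel_measurable_AE[OF m0 AE(1)])
  show "integral\<^sup>L lebesgue f = integral\<^sup>L lborel f0"
    using integral_cong_AE[OF m m0 AE(2)] f0 by (simp add: integral_completion)
  show "integrable lebesgue f \<longleftrightarrow> integrable lborel f0"
    using integrable_cong_AE[OF m m0 AE(2)] f0 by (simp add: integrable_completion)
qed

lemma symbol_mult_bessel_symbol:
  assumes "\<mu> > 0"
  shows "of_real ((\<mu> + 4 * pi\<^sup>2 * (norm \<xi>)\<^sup>2) powr \<rho>) * bessel_symbol \<sigma> \<mu> t a \<xi> = bessel_symbol (\<sigma> - \<rho>) \<mu> t a \<xi>"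
proof -
  have "(\<mu> + 4 * pi\<^sup>2 * (norm \<xi>)\<^sup>2) powr - (\<sigma> - \<rho>)
     = (\<mu> + 4 * pi\<^sup>2 * (norm \<xi>)\<^sup>2) powr \<rho> * (\<mu> + 4 * pi\<^sup>2 * (norm \<xi>)\<^sup>2) powr - \<sigma>"
    unfolding powr_add[symmetric] by (rule arg_cong2[where f="(powr)"]) simp_all
  then show ?thesis
    unfolding bessel_symbol_def by simp
qed

lemma bessel_symbol_zero:
  assumes "\<mu> > 0"
  shows "bessel_symbol 0 \<mu> t a \<xi> = cis (- 2 * pi * (\<xi> \<bullet> a)) * of_real (gaussian t \<xi>)"
proof -
  have "\<mu> + 4 * pi\<^sup>2 * (norm \<xi>)\<^sup>2 > 0"
    using assms by (intro add_pos_nonneg) auto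
  then show ?thesis
    unfolding bessel_symbol_def by simp
qed

lemma fourier_L2_bessel_heat:
  fixes a :: "real^'n"
  assumes pos: "\<sigma> > 0" "\<mu> > 0" "t > 0"
  shows "AE \<xi> in lborel. fourier_L2 (\<lambda>x. of_real (bessel_heat \<sigma> \<mu> t (x - a))) \<xi> = bessel_symbol \<sigma> \<mu> t a \<xi>"
  using fourier_L2_fourier[OF integrable_bessel_symbol(3,4)[OF pos], of "\<lambda>x. of_real (bessel_heat \<sigma> \<mu> t (x - a))" a]
  by (simp add: bessel_heat_fourier[OF pos])

lemma bessel_heat_in_Hs:
  fixes a :: "real^'n"
  assumes pos: "s > 0" "m \<noteq> 0" "t > 0"
  shows "(\<lambda>x. bessel_heat s (m\<^sup>2) t (x - a)) \<in> Hs m s"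
proof -
  have m2: "m\<^sup>2 > 0" using pos by simp
  note pos' = pos(1) m2 pos(3)
  have "(\<lambda>x. complex_of_real (bessel_heat s (m\<^sup>2) t (x - a))) \<in> Lp 2"
    by (rule sq_integrable_imp_Lp2[OF integrable_bessel_symbol(4)[OF pos', of a]]) simp
  then have "integrable lebesgue (\<lambda>x. norm (bessel_heat s (m\<^sup>2) t (x - a)) powr 2)"
    by (simp add: Lp_def)
  moreover have "(\<lambda>x. bessel_heat s (m\<^sup>2) t (x - a)) \<in> borel_measurable lebesgue"
    by (rule measurable_completion) measurable
  ultimately have Lp: "(\<lambda>x. bessel_heat s (m\<^sup>2) t (x - a)) \<in> Lp 2"
    by (simp add: Lp_def)
  have half: "s / 2 > 0" using pos by simp
  have sq: "sq_integrable (bessel_symbol (s / 2) (m\<^sup>2) t a)"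
    by (rule integrable_bessel_symbol(2)[OF half m2 pos(3)])
  note [measurable] = sq_integrable_measurable[OF sq]
  have int: "integrable lborel (\<lambda>\<xi>. (norm (bessel_symbol (s / 2) (m\<^sup>2) t a \<xi>))\<^sup>2)"
    using sq by (intro integrableI_bounded) (auto simp: sq_integrable_def sq_norm_def)
  \<comment> \<open>The weight of power s meets two factors of power -s; sharing it equally between
    them leaves -s/2 in each.\<close>
  have sym: "(m\<^sup>2 + 4 * pi\<^sup>2 * (norm \<xi>)\<^sup>2) powr s * (norm (bessel_symbol s (m\<^sup>2) t a \<xi>))\<^sup>2
    = (norm (bessel_symbol (s / 2) (m\<^sup>2) t a \<xi>))\<^sup>2" for \<xi>
  proof -
    have "bessel_symbol (s / 2) (m\<^sup>2) t a \<xi> = of_real ((m\<^sup>2 + 4 * pi\<^sup>2 * (norm \<xi>)\<^sup>2) powr (s / 2)) * bessel_symbol s (m\<^sup>2) t a \<xi>"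
      by (simp add: symbol_mult_bessel_symbol[OF m2])
    moreover have "((m\<^sup>2 + 4 * pi\<^sup>2 * (norm \<xi>)\<^sup>2) powr (s / 2))\<^sup>2 = (m\<^sup>2 + 4 * pi\<^sup>2 * (norm \<xi>)\<^sup>2) powr s"
      by (simp add: power2_eq_square flip: powr_add)
    ultimately show ?thesis
      by (simp add: norm_mult power_mult_distrib)
  qed
  have "integrable lebesgue (\<lambda>\<xi>. (m\<^sup>2 + 4 * pi\<^sup>2 * (norm \<xi>)\<^sup>2) powr s *
     (norm (fourier_L2 (\<lambda>x. of_real (bessel_heat s (m\<^sup>2) t (x - a))) \<xi>))\<^sup>2)"
  proof (subst integral_lebesgue_eq_lborel(2))
    show "AE \<xi> in lborel. (m\<^sup>2 + 4 * pi\<^sup>2 * (norm \<xi>)\<^sup>2) powr s *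
     (norm (fourier_L2 (\<lambda>x. of_real (bessel_heat s (m\<^sup>2) t (x - a))) \<xi>))\<^sup>2 = (norm (bessel_symbol (s / 2) (m\<^sup>2) t a \<xi>))\<^sup>2"
      using fourier_L2_bessel_heat[OF pos', of a] by eventually_elim (simp only: sym)
  qed (use int in auto)
  then show ?thesis
    using Lp by (simp add: Hs_def)
qed

lemma frac_op_bessel_heat:
  fixes a :: "real^'n"
  assumes pos: "s > 0" "m \<noteq> 0" "t > 0"
  shows "AE x in lborel. frac_op m (s / 2) (\<lambda>x. bessel_heat s (m\<^sup>2) t (x - a)) x
    = of_real (bessel_heat (s / 2) (m\<^sup>2) t (x - a))"
proof -
  have m2: "m\<^sup>2 > 0" using pos by simp
  have half: "s / 2 > 0" using pos by simp
  note pos' = half m2 pos(3)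
  define g where "g \<xi> = of_real ((m\<^sup>2 + 4 * pi\<^sup>2 * (norm \<xi>)\<^sup>2) powr (s / 2)) *
     fourier_L2 (\<lambda>x. of_real (bessel_heat s (m\<^sup>2) t (x - a))) \<xi>" for \<xi>
  have "AE \<xi> in lborel. g \<xi> = bessel_symbol (s / 2) (m\<^sup>2) t a \<xi>"
    using fourier_L2_bessel_heat[OF pos(1) m2 pos(3), of a]
  proof eventually_elim
    case (elim \<xi>)
    then show ?case
      unfolding g_def by (simp add: symbol_mult_bessel_symbol[OF m2])
  qed
  then have "AE x in lborel. fourier_L2 g x = fourier (bessel_symbol (s / 2) (m\<^sup>2) t a) x"
    by (rule fourier_L2_fourier[OF integrable_bessel_symbol(1,2)[OF pos']])
  then have "AE x in lborel. fourier_L2 g (- x) = fourier (bessel_symbol (s / 2) (m\<^sup>2) t a) (- x)"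
    by (rule AE_lborel_uminus)
  moreover have "frac_op m (s / 2) (\<lambda>x. bessel_heat s (m\<^sup>2) t (x - a)) = (\<lambda>x. fourier_L2 g (- x))"
    unfolding frac_op_def inv_fourier_L2_def g_def[abs_def] by (rule ext) simp
  ultimately show ?thesis
    by (simp add: fourier_bessel_symbol[OF pos'])
qed

text \<open>Names Borel representatives of the two transforms hidden in \<open>frac_op\<close>:
  \<open>v\<close> for the transform of u, and \<open>k\<close> for the transform of the multiplied
  function, which \<open>frac_op\<close> reads at -x. The duality formula can then be applied to
  each of them.\<close>

lemma Hs_fourier:
  fixes u :: "real^'n \<Rightarrow> real"
  assumes u: "u \<in> Hs m s" and [measurable]: "u0 \<in> borel_measurable borel" and eq: "AE x in lborel. u x = u0 x"
  shows "\<exists>v k. is_fourier_L2 (\<lambda>x. of_real (u0 x)) v \<and> sq_integrable (\<lambda>x. complex_of_real (u0 x))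
    \<and> is_fourier_L2 (\<lambda>\<xi>. of_real ((m\<^sup>2 + 4 * pi\<^sup>2 * (norm \<xi>)\<^sup>2) powr (s / 2)) * v \<xi>) k
    \<and> sq_integrable (\<lambda>\<xi>. of_real ((m\<^sup>2 + 4 * pi\<^sup>2 * (norm \<xi>)\<^sup>2) powr (s / 2)) * v \<xi>)
    \<and> (AE x in lborel. frac_op m (s / 2) u x = k (- x))"
proof -
  have "integrable lebesgue (\<lambda>x. norm (u x) powr 2)"
    using u by (simp add: Hs_def Lp_def)
  then have "integrable lborel (\<lambda>x. norm (u0 x) powr 2)"
    by (subst (asm) integral_lebesgue_eq_lborel(2)[where ?f0.0="\<lambda>x. norm (u0 x) powr 2"]) (use eq in auto)
  then have "integrable lborel (\<lambda>x. (norm (u0 x))\<^sup>2)"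
    by simp
  then have u0: "sq_integrable (\<lambda>x. complex_of_real (u0 x))"
    unfolding sq_integrable_def sq_norm_def integrable_iff_bounded by simp
  have "AE x in lborel. complex_of_real (u x) = of_real (u0 x)"
    using eq by auto
  from fourier_L2_is_fourier_L2[OF u0 this]
  obtain v where v: "is_fourier_L2 (\<lambda>x. of_real (u0 x)) v" "AE \<xi> in lborel. fourier_L2 (\<lambda>x. of_real (u x)) \<xi> = v \<xi>"
    by blast
  have [measurable]: "v \<in> borel_measurable borel"
    using v by (simp add: is_fourier_L2_def sq_integrable_def)
  have "integrable lebesgue (\<lambda>\<xi>. (m\<^sup>2 + 4 * pi\<^sup>2 * (norm \<xi>)\<^sup>2) powr s * (norm (fourier_L2 (\<lambda>x. of_real (u x)) \<xi>))\<^sup>2)"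
    using u by (simp add: Hs_def)
  then have "integrable lborel (\<lambda>\<xi>. (m\<^sup>2 + 4 * pi\<^sup>2 * (norm \<xi>)\<^sup>2) powr s * (norm (v \<xi>))\<^sup>2)"
    by (subst (asm) integral_lebesgue_eq_lborel(2)[where ?f0.0="\<lambda>\<xi>. (m\<^sup>2 + 4 * pi\<^sup>2 * (norm \<xi>)\<^sup>2) powr s * (norm (v \<xi>))\<^sup>2"]) (use v(2) in auto)
  moreover have "(m\<^sup>2 + 4 * pi\<^sup>2 * (norm \<xi>)\<^sup>2) powr s * (norm (v \<xi>))\<^sup>2
    = (norm (of_real ((m\<^sup>2 + 4 * pi\<^sup>2 * (norm \<xi>)\<^sup>2) powr (s / 2)) * v \<xi>))\<^sup>2" for \<xi>
    by (simp add: norm_mult power_mult_distrib) (simp add: power2_eq_square flip: powr_add)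
  ultimately have g0: "sq_integrable (\<lambda>\<xi>. of_real ((m\<^sup>2 + 4 * pi\<^sup>2 * (norm \<xi>)\<^sup>2) powr (s / 2)) * v \<xi>)"
    unfolding sq_integrable_def sq_norm_def integrable_iff_bounded by simp
  define g where "g \<xi> = of_real ((m\<^sup>2 + 4 * pi\<^sup>2 * (norm \<xi>)\<^sup>2) powr (s / 2)) * fourier_L2 (\<lambda>x. of_real (u x)) \<xi>" for \<xi>
  have "AE \<xi> in lborel. g \<xi> = of_real ((m\<^sup>2 + 4 * pi\<^sup>2 * (norm \<xi>)\<^sup>2) powr (s / 2)) * v \<xi>"
    using v(2) by eventually_elim (simp add: g_def)
  from fourier_L2_is_fourier_L2[OF g0 this]
  obtain k where k: "is_fourier_L2 (\<lambda>\<xi>. of_real ((m\<^sup>2 + 4 * pi\<^sup>2 * (norm \<xi>)\<^sup>2) powr (s / 2)) * v \<xi>) k"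
      "AE \<xi> in lborel. fourier_L2 g \<xi> = k \<xi>"
    by blast
  have "AE x in lborel. fourier_L2 g (- x) = k (- x)"
    by (rule AE_lborel_uminus[OF k(2)])
  moreover have "frac_op m (s / 2) u = (\<lambda>x. fourier_L2 g (- x))"
    unfolding frac_op_def inv_fourier_L2_def g_def[abs_def] by (rule ext) simp
  ultimately have "AE x in lborel. frac_op m (s / 2) u x = k (- x)"
    by simp
  then show ?thesis
    using v(1) u0 k(1) g0 by blast
qed

text \<open>With A = -\<Delta> + m^2 and p the heat kernel centred at \<open>a\<close>, the test
  function is A^-s p. Formally, pairing A^(s/2) u with A^(s/2) A^-s p is pairing u with p; the
  transforms in between are moved one after the other by duality.\<close>

lemma weak_solution_bessel_heat:
  fixes u :: "real^'n \<Rightarrow> real"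
  assumes ws: "weak_solution m s f u" and pos: "s > 0" "m \<noteq> 0" "t > 0"
    and [measurable]: "u0 \<in> borel_measurable borel" and eq: "AE x in lborel. u x = u0 x"
  shows "integrable lebesgue (\<lambda>x. f (u x) * bessel_heat s (m\<^sup>2) t (x - a))"
    and "(\<integral>x. f (u x) * bessel_heat s (m\<^sup>2) t (x - a) \<partial>lebesgue) = (\<integral>x. u0 x * heat_kernel t (x - a) \<partial>lborel)"
proof -
  have m2: "m\<^sup>2 > 0" using pos by simp
  have half: "s / 2 > 0" using pos by simp
  note pos' = half m2 pos(3)
  define w where "w x = bessel_heat s (m\<^sup>2) t (x - a)" for x
  have w: "w \<in> Hs m s"
    unfolding w_def by (rule bessel_heat_in_Hs[OF pos])
  then show "integrable lebesgue (\<lambda>x. f (u x) * bessel_heat s (m\<^sup>2) t (x - a))"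
    using ws by (simp add: weak_solution_def w_def[abs_def])
  have u: "u \<in> Hs m s"
    using ws by (simp add: weak_solution_def)
  define \<Lambda> where "\<Lambda> \<xi> = complex_of_real ((m\<^sup>2 + 4 * pi\<^sup>2 * (norm \<xi>)\<^sup>2) powr (s / 2))" for \<xi> :: "real^'n"
  obtain v k where v: "is_fourier_L2 (\<lambda>x. of_real (u0 x)) v" and u0: "sq_integrable (\<lambda>x. complex_of_real (u0 x))"
    and k: "is_fourier_L2 (\<lambda>\<xi>. \<Lambda> \<xi> * v \<xi>) k" and g0: "sq_integrable (\<lambda>\<xi>. \<Lambda> \<xi> * v \<xi>)"
    and ku: "AE x in lborel. frac_op m (s / 2) u x = k (- x)"
    using Hs_fourier[OF u _ eq] unfolding \<Lambda>_def by auto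
  have [measurable]: "k \<in> borel_measurable borel" "v \<in> borel_measurable borel"
    using k v by (auto simp: is_fourier_L2_def sq_integrable_def)
  have "complex_of_real (\<integral>x. f (u x) * w x \<partial>lebesgue) = (\<integral>x. frac_op m (s/2) u x * frac_op m (s/2) w x \<partial>lebesgue)"
    using ws w by (simp add: weak_solution_def)
  also have "\<dots> = (\<integral>x. k (- x) * of_real (bessel_heat (s / 2) (m\<^sup>2) t (x - a)) \<partial>lborel)"
  proof (rule integral_lebesgue_eq_lborel)
    show "AE x in lborel. frac_op m (s / 2) u x * frac_op m (s / 2) w x = k (- x) * of_real (bessel_heat (s / 2) (m\<^sup>2) t (x - a))"
      using ku frac_op_bessel_heat[OF pos, of a] unfolding w_def[abs_def] by eventually_elim simp
  qed measurable
  \<comment> \<open>The test function is even about its centre, so a reflection of the variable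
    removes the sign in k(-x) and moves the centre from \<open>a\<close> to
    \<open>- a\<close>.\<close>
  also have "\<dots> = (\<integral>x. k (- x) * of_real (bessel_heat (s / 2) (m\<^sup>2) t (- x - (- a))) \<partial>lborel)"
    using bessel_heat_minus[of "s / 2" "m\<^sup>2" t "x - a" for x] by (intro Bochner_Integration.integral_cong refl) (simp add: minus_diff_eq)
  also have "\<dots> = (\<integral>x. k x * of_real (bessel_heat (s / 2) (m\<^sup>2) t (x - (- a))) \<partial>lborel)"
    by (rule integral_lborel_isometry(1)[of uminus "\<lambda>x. k x * of_real (bessel_heat (s / 2) (m\<^sup>2) t (x - (- a)))"])
       (simp_all add: linear_uminus)
  \<comment> \<open>First duality: the outer transform passes to the test function, where it
    produces the symbol of order s/2 that cancels \<Lambda>.\<close>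
  also have "\<dots> = (\<integral>\<xi>. \<Lambda> \<xi> * v \<xi> * fourier (\<lambda>x. of_real (bessel_heat (s / 2) (m\<^sup>2) t (x - (- a)))) \<xi> \<partial>lborel)"
    by (rule is_fourier_L2_duality[OF k g0 integrable_bessel_symbol(4,3)[OF pos']])
  also have "\<dots> = (\<integral>\<xi>. v \<xi> * bessel_symbol 0 (m\<^sup>2) t (- a) \<xi> \<partial>lborel)"
  proof (intro Bochner_Integration.integral_cong refl)
    fix \<xi> :: "real^'n"
    have "\<Lambda> \<xi> * bessel_symbol (s / 2) (m\<^sup>2) t (- a) \<xi> = bessel_symbol 0 (m\<^sup>2) t (- a) \<xi>"
      unfolding \<Lambda>_def by (simp only: symbol_mult_bessel_symbol[OF m2] diff_self)
    then show "\<Lambda> \<xi> * v \<xi> * fourier (\<lambda>x. of_real (bessel_heat (s / 2) (m\<^sup>2) t (x - (- a)))) \<xi> = v \<xi> * bessel_symbol 0 (m\<^sup>2) t (- a) \<xi>"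
      unfolding bessel_heat_fourier[OF pos'] by (metis mult.assoc mult.commute)
  qed
  also have "bessel_symbol 0 (m\<^sup>2) t (- a) = (\<lambda>\<xi>. cis (2 * pi * (\<xi> \<bullet> a)) * of_real (gaussian t \<xi>))"
    by (rule ext) (simp add: bessel_symbol_zero[OF m2])
  \<comment> \<open>Second duality: the transform of \<open>u0\<close> passes to a modulated
    Gaussian, which it turns into the heat kernel at \<open>a\<close>.\<close>
  also have "(\<integral>\<xi>. v \<xi> * (cis (2 * pi * (\<xi> \<bullet> a)) * of_real (gaussian t \<xi>)) \<partial>lborel)
    = (\<integral>x. of_real (u0 x) * fourier (\<lambda>\<xi>. cis (2 * pi * (\<xi> \<bullet> a)) * of_real (gaussian t \<xi>)) x \<partial>lborel)"
  proof (rule is_fourier_L2_duality[OF v u0 _ gaussian_fourier_cis(1)[OF pos(3)]])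
    have "integrable lborel (\<lambda>\<xi>::real^'n. cis (2 * pi * (\<xi> \<bullet> 0)) * of_real (gaussian (2 * t) \<xi>))"
      using pos by (intro gaussian_fourier_cis(1)) simp
    moreover have "gaussian (2 * t) \<xi> = (gaussian t \<xi>)\<^sup>2" for \<xi> :: "real^'n"
      unfolding exp_double[symmetric] by (rule arg_cong[where f=exp]) simp
    ultimately have "integrable lborel (\<lambda>\<xi>::real^'n. (gaussian t \<xi>)\<^sup>2)"
      by (simp only: inner_zero_right mult_zero_right cis_zero mult_1_left complex_of_real_integrable_eq)
    then show "sq_integrable (\<lambda>\<xi>. cis (2 * pi * (\<xi> \<bullet> a)) * of_real (gaussian t \<xi>))"
      unfolding sq_integrable_def sq_norm_def integrable_iff_bounded by (simp add: norm_mult)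
  qed
  also have "\<dots> = complex_of_real (\<integral>x. u0 x * heat_kernel t (x - a) \<partial>lborel)"
    unfolding gaussian_fourier_cis(2)[OF pos(3)] by (simp flip: integral_complex_of_real)
  finally show "(\<integral>x. f (u x) * bessel_heat s (m\<^sup>2) t (x - a) \<partial>lebesgue) = (\<integral>x. u0 x * heat_kernel t (x - a) \<partial>lborel)"
    unfolding w_def by (simp only: of_real_eq_iff)
qed

subsection \<open>Gaussian test functions determine a function\<close>

text \<open>At distance at least \<delta>, half of the exponent is given up for the factor
  exp(-\<delta>^2/(8t)). The other half is the heat kernel of time 2 t, of mass one; the ratio of
  the two normalizations is 2^(N/2).\<close>

lemma heat_kernel_tail:
  fixes x :: "'a::euclidean_space"
  assumes t: "t > 0" and \<delta>: "\<delta> \<ge> 0"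
    and [measurable]: "A \<in> sets borel" and A: "\<And>y. y \<in> A \<Longrightarrow> dist x y \<ge> \<delta>"
  shows "(\<integral>\<^sup>+y\<in>A. ennreal (heat_kernel t (x - y)) \<partial>lborel) \<le> ennreal (2 powr (real DIM('a) / 2) * exp (- \<delta>\<^sup>2 / (8 * t)))"
proof -
  define C where "C = 2 powr (real DIM('a) / 2) * exp (- \<delta>\<^sup>2 / (8 * t))"
  have C: "C \<ge> 0" by (simp add: C_def)
  have "heat_kernel t (x - y) \<le> C * heat_kernel (2 * t) (x - y)" if "y \<in> A" for y
  proof -
    have "\<delta>\<^sup>2 \<le> (norm (x - y))\<^sup>2"
      using A[OF that] \<delta> by (intro power_mono) (auto simp: dist_norm)
    then have "- (norm (x - y))\<^sup>2 / (4 * t) \<le> - \<delta>\<^sup>2 / (8 * t) + - (norm (x - y))\<^sup>2 / (4 * (2 * t))"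
      using t by (simp add: field_simps)
    then have e: "exp (- (norm (x - y))\<^sup>2 / (4 * t)) \<le> exp (- \<delta>\<^sup>2 / (8 * t)) * exp (- (norm (x - y))\<^sup>2 / (4 * (2 * t)))"
      by (simp only: exp_add[symmetric] exp_le_cancel_iff)
    have p: "(4 * pi * t) powr (- real DIM('a) / 2) = 2 powr (real DIM('a) / 2) * (4 * pi * (2 * t)) powr (- real DIM('a) / 2)"
    proof -
      have "(4 * pi * (2 * t)) powr (- real DIM('a) / 2) = 2 powr (- real DIM('a) / 2) * (4 * pi * t) powr (- real DIM('a) / 2)"
        using t by (subst powr_mult[symmetric]) (simp_all add: mult_ac)
      moreover have "2 powr (real DIM('a) / 2) * 2 powr (- real DIM('a) / 2) = (1::real)"
        by (simp flip: powr_add)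
      ultimately show ?thesis
        by (simp only: mult.assoc[symmetric] mult_1_left)
    qed
    have "heat_kernel t (x - y) \<le> (4 * pi * t) powr (- real DIM('a) / 2) * (exp (- \<delta>\<^sup>2 / (8 * t)) * exp (- (norm (x - y))\<^sup>2 / (4 * (2 * t))))"
      unfolding heat_kernel_def by (intro mult_left_mono e) simp
    also have "\<dots> = C * heat_kernel (2 * t) (x - y)"
      unfolding p C_def heat_kernel_def by (simp only: mult_ac)
    finally show ?thesis .
  qed
  then have "(\<integral>\<^sup>+y\<in>A. ennreal (heat_kernel t (x - y)) \<partial>lborel) \<le> (\<integral>\<^sup>+y. ennreal C * ennreal (heat_kernel (2 * t) (x - y)) \<partial>lborel)"
    using C by (intro nn_integral_mono) (auto simp: indicator_def ennreal_mult[symmetric] intro!: ennreal_leI)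
  also have "\<dots> = ennreal C"
    using t by (simp add: nn_integral_cmult nn_integral_heat_kernel_diff)
  finally show ?thesis by (simp add: C_def)
qed

lemma heat_kernel_tail_tendsto:
  assumes "\<delta> > 0"
  shows "(\<lambda>n. ennreal (C * exp (- \<delta>\<^sup>2 / (8 * (1 / real (Suc n)))))) \<longlonglongrightarrow> 0"
proof -
  have "filterlim (\<lambda>n. (\<delta>\<^sup>2 / 8) * real (Suc n)) at_top sequentially"
    using assms by (intro filterlim_tendsto_pos_mult_at_top[OF tendsto_const] filterlim_compose[OF filterlim_real_sequentially filterlim_Suc]) auto
  then have "(\<lambda>n. exp (- ((\<delta>\<^sup>2 / 8) * real (Suc n)))) \<longlonglongrightarrow> 0"
    by (intro filterlim_compose[OF exp_at_bot] filterlim_compose[OF filterlim_uminus_at_bot_at_top])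
  then have "(\<lambda>n. C * exp (- ((\<delta>\<^sup>2 / 8) * real (Suc n)))) \<longlonglongrightarrow> C * 0"
    by (intro tendsto_mult tendsto_const)
  then have "(\<lambda>n. ennreal (C * exp (- ((\<delta>\<^sup>2 / 8) * real (Suc n))))) \<longlonglongrightarrow> ennreal 0"
    by (intro tendsto_ennrealI) simp
  moreover have "- ((\<delta>\<^sup>2 / 8) * real (Suc n)) = - \<delta>\<^sup>2 / (8 * (1 / real (Suc n)))" for n
    by simp
  ultimately show ?thesis
    by (simp only: ennreal_0)
qed

text \<open>Away from the closure of a set its smoothed indicator tends to 0 by the tail bound. At
  interior points the same holds for the complement, and the total mass is one. No limit is claimed
  on the frontier, so the sets used later have null frontier.\<close>

lemma heat_kernel_smoothing_tendsto:
  fixes x :: "'a::euclidean_space"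
  assumes [measurable]: "A \<in> sets borel" and x: "x \<notin> frontier A"
  shows "(\<lambda>n. \<integral>\<^sup>+y\<in>A. ennreal (heat_kernel (1 / real (Suc n)) (x - y)) \<partial>lborel) \<longlonglongrightarrow> indicator A x"
proof -
  have outside: "(\<lambda>n. \<integral>\<^sup>+y\<in>B. ennreal (heat_kernel (1 / real (Suc n)) (x - y)) \<partial>lborel) \<longlonglongrightarrow> 0"
    if [measurable]: "B \<in> sets borel" and "x \<notin> closure B" for B
  proof -
    obtain \<delta> where \<delta>: "\<delta> > 0" "\<And>y. y \<in> B \<Longrightarrow> dist x y \<ge> \<delta>"
      using \<open>x \<notin> closure B\<close> unfolding closure_approachable by (auto simp: dist_commute not_less)
    show ?thesis
      by (rule tendsto_sandwich[OF always_eventually always_eventually tendsto_const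
            heat_kernel_tail_tendsto[OF \<delta>(1), of "2 powr (real DIM('a) / 2)"]])
         (intro allI zero_le heat_kernel_tail \<open>B \<in> sets borel\<close> \<delta>(2) less_imp_le[OF \<delta>(1)]; simp)+
  qed
  show ?thesis
  proof (cases "x \<in> A")
    case False
    then have "x \<notin> closure A"
      using x interior_subset[of A] by (auto simp: frontier_def)
    then show ?thesis
      using outside[of A] False by simp
  next
    case True
    then have "x \<notin> closure (- A)"
      using x closure_subset[of A] by (auto simp: frontier_def closure_complement)
    then have lim: "(\<lambda>n. 1 - (\<integral>\<^sup>+y\<in>-A. ennreal (heat_kernel (1 / real (Suc n)) (x - y)) \<partial>lborel)) \<longlonglongrightarrow> 1 - 0"
      by (intro tendsto_diff_ennreal_general tendsto_const outside) auto
    have "1 - (\<integral>\<^sup>+y\<in>-A. ennreal (heat_kernel t (x - y)) \<partial>lborel) = (\<integral>\<^sup>+y\<in>A. ennreal (heat_kernel t (x - y)) \<partial>lborel)" if "t > 0" for t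
    proof -
      have "(\<integral>\<^sup>+y\<in>A. ennreal (heat_kernel t (x - y)) \<partial>lborel) + (\<integral>\<^sup>+y\<in>-A. ennreal (heat_kernel t (x - y)) \<partial>lborel)
        = (\<integral>\<^sup>+y. ennreal (heat_kernel t (x - y)) * indicator A y + ennreal (heat_kernel t (x - y)) * indicator (- A) y \<partial>lborel)"
        by (rule nn_integral_add[symmetric]) measurable
      also have "\<dots> = (\<integral>\<^sup>+y. ennreal (heat_kernel t (x - y)) \<partial>lborel)"
        by (intro nn_integral_cong) (auto simp: indicator_def)
      also have "\<dots> = 1"
        by (rule nn_integral_heat_kernel_diff[OF that])
      finally have sum: "(\<integral>\<^sup>+y\<in>A. ennreal (heat_kernel t (x - y)) \<partial>lborel) + (\<integral>\<^sup>+y\<in>-A. ennreal (heat_kernel t (x - y)) \<partial>lborel) = 1" .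
      then have "(\<integral>\<^sup>+y\<in>-A. ennreal (heat_kernel t (x - y)) \<partial>lborel) \<noteq> top"
        by (metis add.commute ennreal_one_neq_top ennreal_add_eq_top)
      then show ?thesis
        unfolding sum[symmetric] by simp
    qed
    then show ?thesis
      using lim True by simp
  qed
qed

text \<open>Completing the square: the product is a multiple of the heat kernel with time t/(1 + t)
  and centre a/(1 + t). The weight \<open>heat_kernel 1\<close> can thus be absorbed without leaving
  the class of test functions.\<close>

lemma heat_kernel_mult_1:
  fixes a :: "'a::euclidean_space"
  assumes t: "t > 0"
  shows "\<exists>C r b. C \<ge> 0 \<and> r > 0 \<and> (\<forall>x. heat_kernel t (x - a) * heat_kernel 1 x = C * heat_kernel r (x - b))"
proof -
  define r where "r = t / (1 + t)"
  define b where "b = (1 / (1 + t)) *\<^sub>R a"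
  define D where "D s = (4 * pi * s) powr (- real DIM('a) / 2)" for s
  have D: "D s > 0" if "s > 0" for s using that by (simp add: D_def)
  have r: "r > 0" using t by (simp add: r_def)
  define C where "C = D t * D 1 * exp (- (norm a)\<^sup>2 / (4 * (1 + t))) / D r"
  have "heat_kernel t (x - a) * heat_kernel 1 x = C * heat_kernel r (x - b)" for x
  proof -
    have "(norm (x - a))\<^sup>2 / (4 * t) + (norm x)\<^sup>2 / (4 * 1) = (norm (x - b))\<^sup>2 / (4 * r) + (norm a)\<^sup>2 / (4 * (1 + t))"
    proof -
      have 1: "(norm (x - a))\<^sup>2 = (norm x)\<^sup>2 - 2 * (x \<bullet> a) + (norm a)\<^sup>2"
        by (simp add: power2_norm_eq_inner inner_diff_left inner_diff_right inner_commute)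
      have 2: "(norm (x - b))\<^sup>2 = (norm x)\<^sup>2 - 2 * (x \<bullet> a) / (1 + t) + (norm a)\<^sup>2 / (1 + t)\<^sup>2"
        unfolding b_def power2_norm_eq_inner
        by (simp add: inner_diff_left inner_diff_right inner_commute power2_eq_square)
      have "1 + t \<noteq> 0" using t by simp
      then show ?thesis
        unfolding 1 2 r_def using t by (simp add: divide_simps) (simp add: algebra_simps power2_eq_square power3_eq_cube)
    qed
    then have "- (norm (x - a))\<^sup>2 / (4 * t) + - (norm x)\<^sup>2 / (4 * 1) = - (norm a)\<^sup>2 / (4 * (1 + t)) + - (norm (x - b))\<^sup>2 / (4 * r)"
      unfolding minus_divide_left[symmetric] by linarith
    then have e: "exp (- (norm (x - a))\<^sup>2 / (4 * t)) * exp (- (norm x)\<^sup>2 / (4 * 1)) = exp (- (norm a)\<^sup>2 / (4 * (1 + t))) * exp (- (norm (x - b))\<^sup>2 / (4 * r))"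
      by (simp only: exp_add[symmetric])
    have "heat_kernel t (x - a) * heat_kernel 1 x = D t * D 1 * (exp (- (norm (x - a))\<^sup>2 / (4 * t)) * exp (- (norm x)\<^sup>2 / (4 * 1)))"
      unfolding heat_kernel_def D_def by (simp only: mult_ac)
    also have "\<dots> = C * (D r * exp (- (norm (x - b))\<^sup>2 / (4 * r)))"
      unfolding e C_def using D[OF r] by simp
    finally show ?thesis
      by (simp add: heat_kernel_def D_def)
  qed
  moreover have "C \<ge> 0"
    using D[OF r] D[OF t] D[of 1] by (simp add: C_def)
  ultimately show ?thesis
    using r by blast
qed

text \<open>The weight \<open>heat_kernel 1\<close> turns \<alpha> and \<beta> into densities of
  finite measures, which still have equal integrals against every heat kernel. Integrating over the
  centres in a box and letting the time tend to 0 gives equal masses of boxes, a generator stable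
  under intersection.\<close>

lemma gaussian_test_unique:
  fixes \<alpha> \<beta> :: "'a::euclidean_space \<Rightarrow> ennreal"
  assumes [measurable]: "\<alpha> \<in> borel_measurable borel" "\<beta> \<in> borel_measurable borel"
    and eq: "\<And>t a. t > 0 \<Longrightarrow> (\<integral>\<^sup>+x. \<alpha> x * ennreal (heat_kernel t (x - a)) \<partial>lborel) = (\<integral>\<^sup>+x. \<beta> x * ennreal (heat_kernel t (x - a)) \<partial>lborel)"
    and fin: "(\<integral>\<^sup>+x. \<alpha> x * ennreal (heat_kernel 1 x) \<partial>lborel) < \<infinity>"
  shows "AE x in lborel. \<alpha> x = \<beta> x"
proof -
  define dens where "dens \<gamma> x = \<gamma> x * ennreal (heat_kernel 1 x)" for \<gamma> and x :: 'a
  have [measurable]: "dens \<gamma> \<in> borel_measurable borel" if "\<gamma> \<in> borel_measurable borel" for \<gamma>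
    using that unfolding dens_def by measurable
  have fin': "(\<integral>\<^sup>+x. dens \<gamma> x \<partial>lborel) < \<infinity>" if "\<gamma> = \<alpha> \<or> \<gamma> = \<beta>" for \<gamma>
    using that fin eq[of 1 0] by (auto simp: dens_def)
  define smooth where "smooth t A x = (\<integral>\<^sup>+y\<in>A. ennreal (heat_kernel t (x - y)) \<partial>lborel)" for t and A :: "'a set" and x
  have [measurable]: "smooth t A \<in> borel_measurable borel" if [measurable]: "A \<in> sets borel" for t A
    unfolding smooth_def by measurable
  have test: "(\<integral>\<^sup>+x. dens \<alpha> x * ennreal (heat_kernel t (x - a)) \<partial>lborel) = (\<integral>\<^sup>+x. dens \<beta> x * ennreal (heat_kernel t (x - a)) \<partial>lborel)"
    if "t > 0" for t a
  proof -
    obtain C r b where C: "C \<ge> 0" and r: "r > 0"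
      and h: "\<And>x. heat_kernel t (x - a) * heat_kernel 1 x = C * heat_kernel r (x - b)"
      using heat_kernel_mult_1[OF \<open>t > 0\<close>, of a] by blast
    have "dens \<gamma> x * ennreal (heat_kernel t (x - a)) = ennreal C * (\<gamma> x * ennreal (heat_kernel r (x - b)))" for \<gamma> x
    proof -
      have "dens \<gamma> x * ennreal (heat_kernel t (x - a)) = \<gamma> x * ennreal (heat_kernel t (x - a) * heat_kernel 1 x)"
        by (simp add: dens_def ennreal_mult mult_ac)
      also have "\<dots> = ennreal C * (\<gamma> x * ennreal (heat_kernel r (x - b)))"
        unfolding h by (simp add: ennreal_mult C mult_ac)
      finally show ?thesis .
    qed
    then show ?thesis
      by (simp add: nn_integral_cmult eq[OF r])
  qed
  have smooth_eq: "(\<integral>\<^sup>+x. dens \<alpha> x * smooth t A x \<partial>lborel) = (\<integral>\<^sup>+x. dens \<beta> x * smooth t A x \<partial>lborel)"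
    if [measurable]: "A \<in> sets borel" and "t > 0" for t A
  proof -
    have "(\<integral>\<^sup>+x. dens \<gamma> x * smooth t A x \<partial>lborel) = (\<integral>\<^sup>+y. indicator A y * (\<integral>\<^sup>+x. dens \<gamma> x * ennreal (heat_kernel t (x - y)) \<partial>lborel) \<partial>lborel)"
      if [measurable]: "\<gamma> \<in> borel_measurable borel" for \<gamma>
    proof -
      have "(\<integral>\<^sup>+x. dens \<gamma> x * smooth t A x \<partial>lborel) = (\<integral>\<^sup>+x. (\<integral>\<^sup>+y. dens \<gamma> x * (ennreal (heat_kernel t (x - y)) * indicator A y) \<partial>lborel) \<partial>lborel)"
        unfolding smooth_def by (simp add: nn_integral_cmult)
      also have "\<dots> = (\<integral>\<^sup>+y. (\<integral>\<^sup>+x. dens \<gamma> x * (ennreal (heat_kernel t (x - y)) * indicator A y) \<partial>lborel) \<partial>lborel)"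
        by (rule lborel_pair.Fubini'[of "\<lambda>y x. dens \<gamma> x * (ennreal (heat_kernel t (x - y)) * indicator A y)", simplified]) measurable
      also have "\<dots> = (\<integral>\<^sup>+y. (\<integral>\<^sup>+x. indicator A y * (dens \<gamma> x * ennreal (heat_kernel t (x - y))) \<partial>lborel) \<partial>lborel)"
        by (simp only: mult_ac)
      finally show ?thesis
        by (simp add: nn_integral_cmult)
    qed
    then show ?thesis
      using test[OF \<open>t > 0\<close>] by simp
  qed
  have lim: "(\<lambda>n. \<integral>\<^sup>+x. dens \<gamma> x * smooth (1 / real (Suc n)) A x \<partial>lborel) \<longlonglongrightarrow> (\<integral>\<^sup>+x. dens \<gamma> x * indicator A x \<partial>lborel)"
    if [measurable]: "A \<in> sets borel" and null: "frontier A \<in> null_sets lborel" and \<gamma>: "\<gamma> = \<alpha> \<or> \<gamma> = \<beta>" for \<gamma> A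
  proof (rule nn_integral_dominated_convergence[where w="dens \<gamma>"])
    have [measurable]: "\<gamma> \<in> borel_measurable borel" using \<gamma> by auto
    show "(\<lambda>x. dens \<gamma> x * smooth (1 / real (Suc n)) A x) \<in> borel_measurable lborel" for n
      by measurable
    show "(\<lambda>x. dens \<gamma> x * indicator A x) \<in> borel_measurable lborel" "dens \<gamma> \<in> borel_measurable lborel"
      by measurable
    show "(\<integral>\<^sup>+x. dens \<gamma> x \<partial>lborel) < \<infinity>"
      by (rule fin'[OF \<gamma>])
    have "smooth (1 / real (Suc n)) A x \<le> 1" for n x
    proof -
      have "smooth (1 / real (Suc n)) A x \<le> (\<integral>\<^sup>+y. ennreal (heat_kernel (1 / real (Suc n)) (x - y)) \<partial>lborel)"
        unfolding smooth_def by (intro nn_integral_mono) (auto simp: indicator_def)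
      also have "\<dots> = 1"
        by (rule nn_integral_heat_kernel_diff) simp
      finally show ?thesis .
    qed
    then have "dens \<gamma> x * smooth (1 / real (Suc n)) A x \<le> dens \<gamma> x * 1" for n x
      by (intro mult_left_mono) auto
    then show "AE x in lborel. dens \<gamma> x * smooth (1 / real (Suc n)) A x \<le> dens \<gamma> x" for n
      by simp
    have dfin: "AE x in lborel. dens \<gamma> x \<noteq> \<infinity>"
      using fin'[OF \<gamma>] by (intro nn_integral_PInf_AE) auto
    have "AE x in lborel. x \<notin> frontier A"
      using null by (rule AE_not_in)
    then show "AE x in lborel. (\<lambda>n. dens \<gamma> x * smooth (1 / real (Suc n)) A x) \<longlonglongrightarrow> dens \<gamma> x * indicator A x"
      using dfin
    proof eventually_elim
      case (elim x)
      then show ?case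
        unfolding smooth_def using heat_kernel_smoothing_tendsto[of A x]
        by (intro tendsto_mult_ennreal tendsto_const) (auto simp: indicator_def)
    qed
  qed
  \<comment> \<open>The frontier of a box lies between the open and the closed box, in a null set,
    as the smoothing limit requires.\<close>
  have box_eq: "emeasure (density lborel (dens \<alpha>)) (box l u) = emeasure (density lborel (dens \<beta>)) (box l u)" for l u
  proof -
    have "frontier (box l u) \<in> null_sets lborel"
    proof (rule null_sets_subset[OF null_sets_cbox_Diff_box])
      show "frontier (box l u) \<subseteq> cbox l u - box l u"
        using closure_minimal[OF box_subset_cbox closed_cbox, of l u] by (auto simp: frontier_def interior_open open_box)
    qed simp
    then have "(\<integral>\<^sup>+x. dens \<alpha> x * indicator (box l u) x \<partial>lborel) = (\<integral>\<^sup>+x. dens \<beta> x * indicator (box l u) x \<partial>lborel)"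
      using LIMSEQ_unique[OF lim[of "box l u" \<alpha>]] lim[of "box l u" \<beta>] by (simp add: smooth_eq)
    then show ?thesis
      by (simp add: emeasure_density)
  qed
  have "density lborel (dens \<alpha>) = density lborel (dens \<beta>)"
  proof (rule measure_eqI_generator_eq)
    let ?E = "range (\<lambda>(a, b). box a b::'a set)"
    show "Int_stable ?E"
      by (auto simp: Int_stable_def box_Int_box)
    show "?E \<subseteq> Pow UNIV" "sets (density lborel (dens \<alpha>)) = sigma_sets UNIV ?E" "sets (density lborel (dens \<beta>)) = sigma_sets UNIV ?E"
      by (simp_all add: borel_eq_box)
    let ?A = "\<lambda>n::nat. box (- (real n *\<^sub>R One)) (real n *\<^sub>R One) :: 'a set"
    show "range ?A \<subseteq> ?E" "(\<Union>i. ?A i) = UNIV"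
      unfolding UN_box_eq_UNIV by auto
    show "emeasure (density lborel (dens \<alpha>)) (?A i) \<noteq> \<infinity>" for i
    proof -
      have "emeasure (density lborel (dens \<alpha>)) (?A i) \<le> (\<integral>\<^sup>+x. dens \<alpha> x \<partial>lborel)"
        unfolding emeasure_density[of "dens \<alpha>" lborel, simplified]
        by (subst emeasure_density) (auto intro!: nn_integral_mono simp: indicator_def)
      then show ?thesis
        using fin'[of \<alpha>] by (auto simp: top_unique)
    qed
    show "emeasure (density lborel (dens \<alpha>)) X = emeasure (density lborel (dens \<beta>)) X" if "X \<in> ?E" for X
      using that box_eq by auto
  qed
  then have "AE x in lborel. dens \<alpha> x = dens \<beta> x"
    by (intro sigma_finite_measure.density_unique[OF sigma_finite_lborel]) auto
  then show ?thesis
  proof eventually_elim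
    case (elim x)
    have "ennreal (heat_kernel 1 x) \<noteq> 0"
      using heat_kernel_pos[of 1 x] by simp
    then show ?case
      using elim unfolding dens_def by (simp add: ennreal_mult_cancel_left mult.commute[of _ "ennreal (heat_kernel 1 x)"])
  qed
qed

subsection \<open>The Bessel kernel\<close>

lemma nn_integral_lborel_translation_diff:
  fixes f :: "'a::euclidean_space \<Rightarrow> ennreal"
  assumes [measurable]: "f \<in> borel_measurable borel"
  shows "(\<integral>\<^sup>+x. f (x - c) \<partial>lborel) = (\<integral>\<^sup>+x. f x \<partial>lborel)" "(\<integral>\<^sup>+x. f (c - x) \<partial>lborel) = (\<integral>\<^sup>+x. f x \<partial>lborel)"
proof -
  show "(\<integral>\<^sup>+x. f (x - c) \<partial>lborel) = (\<integral>\<^sup>+x. f x \<partial>lborel)"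
    using nn_integral_lborel_translation[OF assms, of "- c"] by simp
  have "(\<integral>\<^sup>+x. f (c - x) \<partial>lborel) = (\<integral>\<^sup>+x. f (c + - x) \<partial>lborel)"
    by simp
  also have "\<dots> = (\<integral>\<^sup>+x. f (c + x) \<partial>lborel)"
    by (rule nn_integral_lborel_isometry[of uminus "\<lambda>x. f (c + x)"]) (simp_all add: linear_uminus)
  finally show "(\<integral>\<^sup>+x. f (c - x) \<partial>lborel) = (\<integral>\<^sup>+x. f x \<partial>lborel)"
    using nn_integral_lborel_translation[OF assms, of c] by simp
qed

text \<open>Read off on the frequency side, where Gaussians multiply by adding their times; duality
  leads there, and the transform of the Gaussian leads back.\<close>

lemma heat_kernel_semigroup:
  fixes a y :: "real^'n"
  assumes t: "t > 0" and r: "r > 0"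
  shows "(\<integral>\<^sup>+x. ennreal (heat_kernel t (x - a)) * ennreal (heat_kernel r (x - y)) \<partial>lborel) = ennreal (heat_kernel (t + r) (y - a))"
proof -
  define e where "e s \<xi> = complex_of_real (gaussian s \<xi>)" for s and \<xi> :: "real^'n"
  define g where "g x = complex_of_real (heat_kernel t (x - a))" for x
  have gi: "integrable lborel g"
    unfolding g_def using integral_lborel_translation(2)[of "heat_kernel t" "- a"] integrable_heat_kernel[OF t]
    by (simp add: complex_of_real_integrable_eq)
  have fg: "fourier g \<xi> = cis (- 2 * pi * (\<xi> \<bullet> a)) * e t \<xi>" for \<xi>
  proof -
    have "fourier g \<xi> = (\<integral>x. cis (- 2 * pi * ((a + x) \<bullet> \<xi>)) * of_real (heat_kernel t (a + x - a)) \<partial>lborel)"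
      unfolding g_def
      by (subst fourier_eq_lborel, measurable, subst integral_lborel_translation(1)[where c=a, symmetric]) measurable
    also have "\<dots> = (\<integral>x. cis (- 2 * pi * (\<xi> \<bullet> a)) * (cis (- 2 * pi * (x \<bullet> \<xi>)) * of_real (heat_kernel t x)) \<partial>lborel)"
      by (intro Bochner_Integration.integral_cong refl)
         (simp add: mult.assoc[symmetric] cis_mult inner_add_left distrib_left inner_commute[of \<xi> a])
    also have "\<dots> = cis (- 2 * pi * (\<xi> \<bullet> a)) * e t \<xi>"
      unfolding integral_mult_right_zero heat_kernel_fourier(2)[OF t] e_def ..
    finally show ?thesis .
  qed
  have bound: "heat_kernel t (x - a) * heat_kernel r (x - y) \<le> heat_kernel t (x - a) * (4 * pi * r) powr (- real DIM(real^'n) / 2)" for x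
    by (intro mult_left_mono heat_kernel_le r) simp
  have int: "integrable lborel (\<lambda>x. heat_kernel t (x - a) * heat_kernel r (x - y))"
  proof (rule Bochner_Integration.integrable_bound)
    show "integrable lborel (\<lambda>x. heat_kernel t (x - a) * (4 * pi * r) powr (- real DIM(real^'n) / 2))"
      using integral_lborel_translation(2)[of "heat_kernel t" "- a"] integrable_heat_kernel[OF t] by (intro integrable_mult_left) simp
  qed (use bound in auto)
  have "complex_of_real (\<integral>x. heat_kernel t (x - a) * heat_kernel r (x - y) \<partial>lborel)
    = (\<integral>x. g x * fourier (\<lambda>\<xi>. cis (2 * pi * (\<xi> \<bullet> y)) * e r \<xi>) x \<partial>lborel)"
    unfolding e_def gaussian_fourier_cis(2)[OF r] g_def by (simp flip: integral_complex_of_real)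
  also have "\<dots> = (\<integral>\<xi>. fourier g \<xi> * (cis (2 * pi * (\<xi> \<bullet> y)) * e r \<xi>) \<partial>lborel)"
    unfolding e_def by (rule fourier_duality[OF gi gaussian_fourier_cis(1)[OF r], symmetric])
  also have "\<dots> = (\<integral>\<xi>. cis (- 2 * pi * (\<xi> \<bullet> 0)) * (cis (2 * pi * (\<xi> \<bullet> (y - a))) * e (t + r) \<xi>) \<partial>lborel)"
  proof (intro Bochner_Integration.integral_cong refl)
    fix \<xi> :: "real^'n"
    have "e t \<xi> * e r \<xi> = e (t + r) \<xi>"
      unfolding e_def of_real_mult[symmetric] exp_add[symmetric]
      by (rule arg_cong[where f="\<lambda>z. complex_of_real (exp z)"]) (simp add: algebra_simps)
    moreover have "cis (- 2 * pi * (\<xi> \<bullet> a)) * cis (2 * pi * (\<xi> \<bullet> y)) = cis (2 * pi * (\<xi> \<bullet> (y - a)))"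
      by (simp add: cis_mult inner_diff_right right_diff_distrib)
    ultimately show "fourier g \<xi> * (cis (2 * pi * (\<xi> \<bullet> y)) * e r \<xi>) = cis (- 2 * pi * (\<xi> \<bullet> 0)) * (cis (2 * pi * (\<xi> \<bullet> (y - a))) * e (t + r) \<xi>)"
      unfolding fg by (simp add: mult_ac)
  qed
  also have "\<dots> = fourier (\<lambda>\<xi>. cis (2 * pi * (\<xi> \<bullet> (y - a))) * e (t + r) \<xi>) 0"
    by (rule fourier_eq_lborel[symmetric]) (simp add: e_def)
  also have "\<dots> = of_real (heat_kernel (t + r) (y - a))"
    unfolding e_def using t r by (subst gaussian_fourier_cis(2)) (simp_all add: heat_kernel_commute[of "t + r" a y])
  finally have "(\<integral>x. heat_kernel t (x - a) * heat_kernel r (x - y) \<partial>lborel) = heat_kernel (t + r) (y - a)"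
    by (simp only: of_real_eq_iff)
  then show ?thesis
    using int by (simp add: nn_integral_eq_integral flip: ennreal_mult)
qed

text \<open>The limit t = 0 of \<open>bessel_heat\<close>, which is the kernel of (-\<Delta> +
  \<mu>)^-\<sigma>. It is valued in \<open>ennreal\<close> because the integral diverges at the
  origin when \<sigma> is at most half the dimension.\<close>

definition bessel_kernel :: "real \<Rightarrow> real \<Rightarrow> 'a::euclidean_space \<Rightarrow> ennreal" where
  "bessel_kernel \<sigma> \<mu> x = (\<integral>\<^sup>+\<tau>. ennreal (bessel_weight \<sigma> \<mu> \<tau> * heat_kernel \<tau> x) \<partial>lborel)"

lemma measurable_bessel_kernel [measurable]: "bessel_kernel \<sigma> \<mu> \<in> borel_measurable borel"
  unfolding bessel_kernel_def by measurable

lemma bessel_kernel_commute: "bessel_kernel \<sigma> \<mu> (x - y) = bessel_kernel \<sigma> \<mu> (y - x)"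
  by (simp add: bessel_kernel_def heat_kernel_commute)

lemma bessel_kernel_norm_cong: "norm (x::'a::euclidean_space) = norm (y::'a) \<Longrightarrow> bessel_kernel \<sigma> \<mu> x = bessel_kernel \<sigma> \<mu> y"
  by (simp add: bessel_kernel_def heat_kernel_def)

context
  fixes \<sigma> \<mu> :: real
  assumes pos: "\<sigma> > 0" "\<mu> > 0"
begin

lemma nn_integral_bessel_kernel:
  "(\<integral>\<^sup>+x. bessel_kernel \<sigma> \<mu> x \<partial>(lborel :: 'a::euclidean_space measure)) = ennreal (\<mu> powr - \<sigma>)"
proof -
  have "(\<integral>\<^sup>+x. bessel_kernel \<sigma> \<mu> x \<partial>(lborel :: 'a measure))
    = (\<integral>\<^sup>+\<tau>. (\<integral>\<^sup>+x. ennreal (bessel_weight \<sigma> \<mu> \<tau> * heat_kernel \<tau> x) \<partial>(lborel :: 'a measure)) \<partial>lborel)"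
    unfolding bessel_kernel_def
    by (rule lborel_pair.Fubini'[of "\<lambda>\<tau> x. ennreal (bessel_weight \<sigma> \<mu> \<tau> * heat_kernel \<tau> (x::'a))", simplified]) measurable
  also have "\<dots> = (\<integral>\<^sup>+\<tau>. ennreal (bessel_weight \<sigma> \<mu> \<tau>) \<partial>lborel)"
    using pos by (intro nn_integral_cong nn_integral_bessel_weight_heat_kernel) simp_all
  finally show ?thesis
    using pos by (simp add: nn_integral_bessel_weight)
qed

lemma nn_integral_bessel_kernel_diff:
  fixes x :: "'a::euclidean_space"
  shows "(\<integral>\<^sup>+y. bessel_kernel \<sigma> \<mu> (x - y) \<partial>lborel) = ennreal (\<mu> powr - \<sigma>)"
  using nn_integral_lborel_translation_diff(2)[of "bessel_kernel \<sigma> \<mu>" x] nn_integral_bessel_kernel[where 'a='a]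
  by simp

lemma bessel_kernel_antimono:
  fixes x y :: "'a::euclidean_space"
  assumes "norm x \<le> norm y"
  shows "bessel_kernel \<sigma> \<mu> y \<le> bessel_kernel \<sigma> \<mu> x"
  unfolding bessel_kernel_def
  using pos assms by (intro nn_integral_mono ennreal_leI bessel_weight_heat_kernel_antimono)

text \<open>An integrable radially decreasing function can only be infinite at the origin.\<close>

lemma bessel_kernel_finite:
  fixes x :: "'a::euclidean_space"
  assumes "x \<noteq> 0"
  shows "bessel_kernel \<sigma> \<mu> x < \<infinity>"
proof (rule ccontr)
  assume "\<not> bessel_kernel \<sigma> \<mu> x < \<infinity>"
  then have inf: "bessel_kernel \<sigma> \<mu> x = \<infinity>"
    by (simp add: not_less top_unique)
  have "AE y in lborel. bessel_kernel \<sigma> \<mu> (y::'a) \<noteq> \<infinity>"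
    by (intro nn_integral_PInf_AE) (simp_all add: nn_integral_bessel_kernel)
  moreover have "bessel_kernel \<sigma> \<mu> y = \<infinity>" if "y \<in> ball 0 (norm x)" for y :: 'a
    using bessel_kernel_antimono[of y x] that inf by (simp add: top_unique)
  ultimately have "AE y in lborel. y \<notin> ball (0::'a) (norm x)"
    by (auto elim!: eventually_mono)
  then have "ball (0::'a) (norm x) \<in> null_sets lborel"
    by (subst (asm) AE_iff_null_sets[symmetric]) auto
  then have "negligible (ball (0::'a) (norm x))"
    by (simp add: negligible_iff_null_sets null_sets_completionI)
  then show False
    using assms open_not_negligible[of "ball (0::'a) (norm x)"] by simp
qed

lemma bessel_kernel_strict_antimono:
  fixes x y :: "'a::euclidean_space"
  assumes "norm x < norm y"
  shows "bessel_kernel \<sigma> \<mu> y < bessel_kernel \<sigma> \<mu> x"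
proof -
  \<comment> \<open>The farther point is not the origin, so its kernel value is finite and the
    strict inequality of the integrands survives integration.\<close>
  have y: "y \<noteq> 0" using assms by auto
  have less: "bessel_weight \<sigma> \<mu> \<tau> * heat_kernel \<tau> y < bessel_weight \<sigma> \<mu> \<tau> * heat_kernel \<tau> x" if "\<tau> > 0" for \<tau>
  proof -
    have "bessel_weight \<sigma> \<mu> \<tau> > 0"
      using that Gamma_real_pos[OF pos(1)] by (simp add: bessel_weight_def)
    moreover have "(norm x)\<^sup>2 < (norm y)\<^sup>2"
      using assms by (intro power_strict_mono) auto
    ultimately show ?thesis
      unfolding heat_kernel_def using that by (intro mult_strict_left_mono) (auto simp: divide_strict_right_mono)
  qed
  show ?thesis
    unfolding bessel_kernel_def
  proof (rule nn_integral_less)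
    show "(\<integral>\<^sup>+\<tau>. ennreal (bessel_weight \<sigma> \<mu> \<tau> * heat_kernel \<tau> y) \<partial>lborel) \<noteq> \<infinity>"
      using bessel_kernel_finite[OF y] by (simp add: bessel_kernel_def)
    show "AE \<tau> in lborel. ennreal (bessel_weight \<sigma> \<mu> \<tau> * heat_kernel \<tau> y) \<le> ennreal (bessel_weight \<sigma> \<mu> \<tau> * heat_kernel \<tau> x)"
      using pos assms by (intro AE_I2 ennreal_leI bessel_weight_heat_kernel_antimono) simp_all
    show "\<not> (AE \<tau> in lborel. ennreal (bessel_weight \<sigma> \<mu> \<tau> * heat_kernel \<tau> x) \<le> ennreal (bessel_weight \<sigma> \<mu> \<tau> * heat_kernel \<tau> y))"
    proof
      assume "AE \<tau> in lborel. ennreal (bessel_weight \<sigma> \<mu> \<tau> * heat_kernel \<tau> x) \<le> ennreal (bessel_weight \<sigma> \<mu> \<tau> * heat_kernel \<tau> y)"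
      then have "AE \<tau> in lborel. \<tau> \<notin> {0<..<1::real}"
      proof eventually_elim
        case (elim \<tau>)
        show ?case
        proof
          assume "\<tau> \<in> {0<..<1}"
          moreover have "0 \<le> bessel_weight \<sigma> \<mu> \<tau> * heat_kernel \<tau> y"
            using pos by (intro mult_nonneg_nonneg bessel_weight_nonneg) auto
          ultimately show False
            using elim less[of \<tau>] by (simp add: ennreal_le_iff)
        qed
      qed
      then have "{0<..<1::real} \<in> null_sets lborel"
        by (subst (asm) AE_iff_null_sets[symmetric]) auto
      then show False
        by (simp add: null_sets_def)
    qed
  qed measurable
qed

text \<open>The semigroup law under the integral over \<tau>. In this form the tested equation
  becomes an identity between integrals against heat kernels, to which
  \<open>gaussian_test_unique\<close> applies.\<close>

lemma bessel_heat_eq_convolution: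
  fixes a y :: "real^'n"
  assumes t: "t > 0"
  shows "ennreal (bessel_heat \<sigma> \<mu> t (y - a)) = (\<integral>\<^sup>+x. ennreal (heat_kernel t (x - a)) * bessel_kernel \<sigma> \<mu> (x - y) \<partial>lborel)"
proof -
  have "(\<integral>\<^sup>+x. ennreal (heat_kernel t (x - a)) * bessel_kernel \<sigma> \<mu> (x - y) \<partial>lborel)
    = (\<integral>\<^sup>+x. (\<integral>\<^sup>+\<tau>. ennreal (heat_kernel t (x - a)) * ennreal (bessel_weight \<sigma> \<mu> \<tau> * heat_kernel \<tau> (x - y)) \<partial>lborel) \<partial>lborel)"
    unfolding bessel_kernel_def by (simp add: nn_integral_cmult)
  also have "\<dots> = (\<integral>\<^sup>+\<tau>. (\<integral>\<^sup>+x. ennreal (heat_kernel t (x - a)) * ennreal (bessel_weight \<sigma> \<mu> \<tau> * heat_kernel \<tau> (x - y)) \<partial>lborel) \<partial>lborel)"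
    by (rule lborel_pair.Fubini'[of "\<lambda>\<tau> x. ennreal (heat_kernel t (x - a)) * ennreal (bessel_weight \<sigma> \<mu> \<tau> * heat_kernel \<tau> (x - y))", simplified]) measurable
  also have "\<dots> = (\<integral>\<^sup>+\<tau>. ennreal (bessel_weight \<sigma> \<mu> \<tau> * heat_kernel (t + \<tau>) (y - a)) \<partial>lborel)"
  proof (rule nn_integral_cong)
    fix \<tau> :: real
    show "(\<integral>\<^sup>+x. ennreal (heat_kernel t (x - a)) * ennreal (bessel_weight \<sigma> \<mu> \<tau> * heat_kernel \<tau> (x - y)) \<partial>lborel)
      = ennreal (bessel_weight \<sigma> \<mu> \<tau> * heat_kernel (t + \<tau>) (y - a))"
    proof (cases "\<tau> > 0")
      case True
      have "(\<integral>\<^sup>+x. ennreal (heat_kernel t (x - a)) * ennreal (bessel_weight \<sigma> \<mu> \<tau> * heat_kernel \<tau> (x - y)) \<partial>lborel)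
        = (\<integral>\<^sup>+x. ennreal (bessel_weight \<sigma> \<mu> \<tau>) * (ennreal (heat_kernel t (x - a)) * ennreal (heat_kernel \<tau> (x - y))) \<partial>lborel)"
        using pos by (simp add: ennreal_mult bessel_weight_nonneg mult_ac)
      also have "\<dots> = ennreal (bessel_weight \<sigma> \<mu> \<tau>) * ennreal (heat_kernel (t + \<tau>) (y - a))"
        by (simp add: nn_integral_cmult heat_kernel_semigroup[OF t True])
      finally show ?thesis
        using pos by (simp add: ennreal_mult bessel_weight_nonneg)
    qed (simp add: bessel_weight_zero)
  qed
  finally show ?thesis
    using pos t by (simp add: ennreal_bessel_heat)
qed

text \<open>The elementary inequality \<open>w \<le> l + w\<^sup>p l\<^sup>1\<^sup>-\<^sup>p\<close>, applied with \<open>l\<close> depending on the time \<open>\<tau>\<close>,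
  replaces Hoelder's inequality for the heat kernels.\<close>

lemma bessel_kernel_potential_le:
  fixes p :: real
  assumes p: "p > 1" "real DIM('a::euclidean_space) / (2 * p) < \<sigma>"
  shows "\<exists>C>0. \<forall>W \<delta> x. W \<in> borel_measurable borel \<longrightarrow> (\<forall>y. 0 \<le> W y) \<longrightarrow> 0 < \<delta> \<longrightarrow>
    (\<integral>\<^sup>+y. ennreal (W y) * bessel_kernel \<sigma> \<mu> (x - y :: 'a) \<partial>lborel)
      \<le> ennreal C * (ennreal \<delta> + ennreal (\<delta> powr (1 - p)) * (\<integral>\<^sup>+y. ennreal (W y powr p) \<partial>lborel))"
proof -
  \<comment> \<open>In the exponent dual to p, a heat kernel of time \<tau> has norm of order (4 pi
    \<tau>)^-\<kappa>. Since \<kappa> < \<sigma>, absorbing this power into the weight leaves a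
    multiple of the weight of the positive order \<sigma> - \<kappa>, whose integral is
    finite.\<close>
  define \<kappa> where "\<kappa> = real DIM('a) / (2 * p)"
  have \<kappa>: "0 < \<sigma> - \<kappa>" "\<kappa> > 0" "\<kappa> * p = real DIM('a) / 2"
    using p by (auto simp: \<kappa>_def)
  note G = Gamma_real_pos[OF pos(1)] Gamma_real_pos[OF \<kappa>(1)]
  define C0 where "C0 = (4 * pi) powr - \<kappa> * Gamma (\<sigma> - \<kappa>) / Gamma \<sigma>"
  define C where "C = C0 * \<mu> powr - (\<sigma> - \<kappa>)"
  have C0: "C0 > 0" using G by (simp add: C0_def)
  have C: "C > 0" using C0 pos by (simp add: C_def)
  have weight: "bessel_weight \<sigma> \<mu> \<tau> * (4 * pi * \<tau>) powr - \<kappa> = C0 * bessel_weight (\<sigma> - \<kappa>) \<mu> \<tau>" for \<tau>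
  proof (cases "\<tau> > 0")
    case True
    have "\<tau> powr (\<sigma> - 1) * \<tau> powr - \<kappa> = \<tau> powr (\<sigma> - \<kappa> - 1)"
      by (simp add: algebra_simps flip: powr_add)
    moreover have "(4 * pi * \<tau>) powr - \<kappa> = (4 * pi) powr - \<kappa> * \<tau> powr - \<kappa>"
      using True by (intro powr_mult)
    ultimately have "bessel_weight \<sigma> \<mu> \<tau> * (4 * pi * \<tau>) powr - \<kappa> = (4 * pi) powr - \<kappa> / Gamma \<sigma> * (\<tau> powr (\<sigma> - \<kappa> - 1) * exp (- \<mu> * \<tau>))"
      using True by (simp add: bessel_weight_def mult_ac)
    also have "\<dots> = C0 * bessel_weight (\<sigma> - \<kappa>) \<mu> \<tau>"
      using True less_imp_neq[OF G(2), symmetric] by (simp add: bessel_weight_def C0_def)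
    finally show ?thesis .
  qed (simp add: bessel_weight_zero)
  have "(\<integral>\<^sup>+y. ennreal (W y) * bessel_kernel \<sigma> \<mu> (x - y :: 'a) \<partial>lborel)
      \<le> ennreal C * (ennreal \<delta> + ennreal (\<delta> powr (1 - p)) * (\<integral>\<^sup>+y. ennreal (W y powr p) \<partial>lborel))"
    if [measurable]: "W \<in> borel_measurable borel" and W: "\<And>y. 0 \<le> W y" and \<delta>: "0 < \<delta>" for W \<delta> x
  proof -
    define A where "A = (\<integral>\<^sup>+y. ennreal (W y powr p) \<partial>lborel)"
    have step: "(\<integral>\<^sup>+y. ennreal (W y) * ennreal (heat_kernel \<tau> (x - y)) \<partial>lborel)
       \<le> ennreal ((4 * pi * \<tau>) powr - \<kappa>) * (ennreal \<delta> + ennreal (\<delta> powr (1 - p)) * A)" if \<tau>: "\<tau> > 0" for \<tau>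
    proof -
      define D where "D = (4 * pi * \<tau>) powr - \<kappa>"
      \<comment> \<open>With this threshold both terms scale alike in \<tau>: since \<kappa> p is
        half the dimension, l^(1 - p) times the bound of the heat kernel equals \<delta>^(1 - p)
        D.\<close>
      define l where "l = \<delta> * D"
      have D: "D > 0" using \<tau> by (simp add: D_def)
      have l: "l > 0" using \<delta> D by (simp add: l_def)
      have W_le: "W y \<le> l + W y powr p * l powr (1 - p)" for y
      proof (cases "W y \<le> l")
        case True
        then show ?thesis by (simp add: add_increasing2)
      next
        case False
        have "1 = (W y / l) powr 0" using False l by simp
        also have "\<dots> \<le> (W y / l) powr (p - 1)"
          using False l p by (intro powr_mono) auto
        finally have "W y * 1 \<le> W y * (W y / l) powr (p - 1)"
          by (intro mult_left_mono W)
        also have "\<dots> = W y powr p * l powr (1 - p)"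
          using False l by (simp add: powr_divide powr_diff field_simps)
        finally show ?thesis using l by simp
      qed
      have lD: "l powr (1 - p) * (4 * pi * \<tau>) powr (- real DIM('a) / 2) = \<delta> powr (1 - p) * D"
      proof -
        have "l powr (1 - p) = \<delta> powr (1 - p) * (4 * pi * \<tau>) powr (- \<kappa> * (1 - p))"
          unfolding l_def D_def using \<tau> \<delta> by (simp add: powr_mult powr_powr)
        moreover have "(4 * pi * \<tau>) powr (- \<kappa> * (1 - p)) * (4 * pi * \<tau>) powr (- real DIM('a) / 2) = D"
          unfolding D_def powr_add[symmetric] using \<kappa>(3) by (intro arg_cong2[where f="(powr)"] refl) (simp add: algebra_simps)
        ultimately show ?thesis
          by (simp only: mult.assoc)
      qed
      have "(\<integral>\<^sup>+y. ennreal (W y) * ennreal (heat_kernel \<tau> (x - y)) \<partial>lborel)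
        \<le> (\<integral>\<^sup>+y. ennreal l * ennreal (heat_kernel \<tau> (x - y)) + ennreal (\<delta> powr (1 - p) * D) * ennreal (W y powr p) \<partial>lborel)"
      proof (rule nn_integral_mono)
        fix y
        have "W y * heat_kernel \<tau> (x - y) \<le> (l + W y powr p * l powr (1 - p)) * heat_kernel \<tau> (x - y)"
          by (intro mult_right_mono W_le) simp
        also have "\<dots> \<le> l * heat_kernel \<tau> (x - y) + W y powr p * l powr (1 - p) * (4 * pi * \<tau>) powr (- real DIM('a) / 2)"
          unfolding distrib_right by (intro add_left_mono mult_left_mono heat_kernel_le \<tau>) simp
        also have "\<dots> = l * heat_kernel \<tau> (x - y) + \<delta> powr (1 - p) * D * W y powr p"
          unfolding mult.assoc[of "W y powr p"] lD by (simp only: mult_ac)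
        finally show "ennreal (W y) * ennreal (heat_kernel \<tau> (x - y)) \<le> ennreal l * ennreal (heat_kernel \<tau> (x - y)) + ennreal (\<delta> powr (1 - p) * D) * ennreal (W y powr p)"
          using W l D \<delta> by (simp add: ennreal_leI flip: ennreal_mult ennreal_plus)
      qed
      also have "\<dots> = ennreal l + ennreal (\<delta> powr (1 - p) * D) * A"
        using \<tau> by (simp add: nn_integral_add nn_integral_cmult nn_integral_heat_kernel_diff A_def)
      also have "\<dots> = ennreal D * (ennreal \<delta> + ennreal (\<delta> powr (1 - p)) * A)"
        using \<delta> D by (simp add: l_def ennreal_mult distrib_left mult_ac)
      finally show ?thesis by (simp add: D_def)
    qed
    have "(\<integral>\<^sup>+y. ennreal (W y) * bessel_kernel \<sigma> \<mu> (x - y) \<partial>lborel)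
      = (\<integral>\<^sup>+y. (\<integral>\<^sup>+\<tau>. ennreal (W y) * ennreal (bessel_weight \<sigma> \<mu> \<tau> * heat_kernel \<tau> (x - y)) \<partial>lborel) \<partial>lborel)"
      unfolding bessel_kernel_def by (simp add: nn_integral_cmult)
    also have "\<dots> = (\<integral>\<^sup>+\<tau>. (\<integral>\<^sup>+y. ennreal (W y) * ennreal (bessel_weight \<sigma> \<mu> \<tau> * heat_kernel \<tau> (x - y)) \<partial>lborel) \<partial>lborel)"
      by (rule lborel_pair.Fubini'[of "\<lambda>\<tau> y. ennreal (W y) * ennreal (bessel_weight \<sigma> \<mu> \<tau> * heat_kernel \<tau> (x - y))", simplified]) measurable
    also have "\<dots> \<le> (\<integral>\<^sup>+\<tau>. ennreal C0 * ennreal (bessel_weight (\<sigma> - \<kappa>) \<mu> \<tau>) * (ennreal \<delta> + ennreal (\<delta> powr (1 - p)) * A) \<partial>lborel)"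
    proof (rule nn_integral_mono)
      fix \<tau> :: real
      show "(\<integral>\<^sup>+y. ennreal (W y) * ennreal (bessel_weight \<sigma> \<mu> \<tau> * heat_kernel \<tau> (x - y)) \<partial>lborel)
        \<le> ennreal C0 * ennreal (bessel_weight (\<sigma> - \<kappa>) \<mu> \<tau>) * (ennreal \<delta> + ennreal (\<delta> powr (1 - p)) * A)"
      proof (cases "\<tau> > 0")
        case True
        have "(\<integral>\<^sup>+y. ennreal (W y) * ennreal (bessel_weight \<sigma> \<mu> \<tau> * heat_kernel \<tau> (x - y)) \<partial>lborel)
          = (\<integral>\<^sup>+y. ennreal (bessel_weight \<sigma> \<mu> \<tau>) * (ennreal (W y) * ennreal (heat_kernel \<tau> (x - y))) \<partial>lborel)"
          using pos by (simp add: ennreal_mult bessel_weight_nonneg mult_ac)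
        also have "\<dots> = ennreal (bessel_weight \<sigma> \<mu> \<tau>) * (\<integral>\<^sup>+y. ennreal (W y) * ennreal (heat_kernel \<tau> (x - y)) \<partial>lborel)"
          by (rule nn_integral_cmult) measurable
        also have "\<dots> \<le> ennreal (bessel_weight \<sigma> \<mu> \<tau>) * (ennreal ((4 * pi * \<tau>) powr - \<kappa>) * (ennreal \<delta> + ennreal (\<delta> powr (1 - p)) * A))"
          by (intro mult_left_mono step True) simp
        also have "\<dots> = ennreal (bessel_weight \<sigma> \<mu> \<tau> * (4 * pi * \<tau>) powr - \<kappa>) * (ennreal \<delta> + ennreal (\<delta> powr (1 - p)) * A)"
          using pos by (simp add: ennreal_mult bessel_weight_nonneg mult.assoc)
        also have "\<dots> = ennreal C0 * ennreal (bessel_weight (\<sigma> - \<kappa>) \<mu> \<tau>) * (ennreal \<delta> + ennreal (\<delta> powr (1 - p)) * A)"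
          unfolding weight using C0 \<kappa> by (simp add: ennreal_mult bessel_weight_nonneg)
        finally show ?thesis .
      qed (simp add: bessel_weight_zero)
    qed
    also have "\<dots> = ennreal C0 * (\<integral>\<^sup>+\<tau>. ennreal (bessel_weight (\<sigma> - \<kappa>) \<mu> \<tau>) \<partial>lborel) * (ennreal \<delta> + ennreal (\<delta> powr (1 - p)) * A)"
      by (simp add: nn_integral_cmult nn_integral_multc)
    also have "ennreal C0 * (\<integral>\<^sup>+\<tau>. ennreal (bessel_weight (\<sigma> - \<kappa>) \<mu> \<tau>) \<partial>lborel) = ennreal C"
      using C0 pos by (simp add: nn_integral_bessel_weight[OF \<kappa>(1) pos(2)] C_def ennreal_mult)
    finally show ?thesis by (simp add: A_def)
  qed
  then show ?thesis
    using C by blast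
qed

lemma bessel_kernel_potential_small:
  fixes p :: real
  assumes p: "p > 1" "real DIM('a::euclidean_space) / (2 * p) < \<sigma>"
  shows "\<exists>\<eta>>0. \<forall>W. W \<in> borel_measurable borel \<longrightarrow> (\<forall>y. 0 \<le> W y) \<longrightarrow>
    (\<integral>\<^sup>+y. ennreal (W y powr p) \<partial>lborel) \<le> ennreal \<eta> \<longrightarrow>
    (\<forall>x. (\<integral>\<^sup>+y. ennreal (W y) * bessel_kernel \<sigma> \<mu> (x - y :: 'a) \<partial>lborel) \<le> ennreal (1 / 2))"
proof -
  obtain C where C: "C > 0" and
    bound: "\<And>W \<delta> x. W \<in> borel_measurable borel \<Longrightarrow> (\<And>y. 0 \<le> W y) \<Longrightarrow> 0 < \<delta> \<Longrightarrow>
    (\<integral>\<^sup>+y. ennreal (W y) * bessel_kernel \<sigma> \<mu> (x - y :: 'a) \<partial>lborel)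
      \<le> ennreal C * (ennreal \<delta> + ennreal (\<delta> powr (1 - p)) * (\<integral>\<^sup>+y. ennreal (W y powr p) \<partial>lborel))"
    using bessel_kernel_potential_le[OF p] by blast
  \<comment> \<open>Both terms of the bound become 1/4 with these two choices.\<close>
  define \<delta> where "\<delta> = 1 / (4 * C)"
  define \<eta> where "\<eta> = \<delta> / \<delta> powr (1 - p)"
  have \<delta>: "\<delta> > 0" using C by (simp add: \<delta>_def)
  then have \<eta>: "\<eta> > 0" by (simp add: \<eta>_def)
  have "(\<integral>\<^sup>+y. ennreal (W y) * bessel_kernel \<sigma> \<mu> (x - y :: 'a) \<partial>lborel) \<le> ennreal (1 / 2)"
    if "W \<in> borel_measurable borel" "\<And>y. 0 \<le> W y" "(\<integral>\<^sup>+y. ennreal (W y powr p) \<partial>lborel) \<le> ennreal \<eta>" for W x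
  proof -
    have "(\<integral>\<^sup>+y. ennreal (W y) * bessel_kernel \<sigma> \<mu> (x - y :: 'a) \<partial>lborel)
      \<le> ennreal C * (ennreal \<delta> + ennreal (\<delta> powr (1 - p)) * (\<integral>\<^sup>+y. ennreal (W y powr p) \<partial>lborel))"
      by (rule bound[OF that(1,2) \<delta>])
    also have "\<dots> \<le> ennreal C * (ennreal \<delta> + ennreal (\<delta> powr (1 - p)) * ennreal \<eta>)"
      by (intro mult_left_mono add_left_mono that(3)) simp_all
    also have "\<dots> = ennreal (C * (\<delta> + \<delta> powr (1 - p) * \<eta>))"
      using C \<delta> \<eta> by (simp add: ennreal_mult ennreal_plus)
    also have "C * (\<delta> + \<delta> powr (1 - p) * \<eta>) = 1 / 2"
      using C \<delta> by (simp add: \<eta>_def) (simp add: \<delta>_def)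
    finally show ?thesis .
  qed
  then show ?thesis
    using \<eta> by blast
qed

text \<open>The Schur test in the weighted space \<open>L\<^sup>2(W dx)\<close>: the potential operator has norm at most
  one half there.\<close>

lemma bessel_kernel_contraction:
  fixes W z :: "'a::euclidean_space \<Rightarrow> real"
  assumes [measurable]: "W \<in> borel_measurable borel" "z \<in> borel_measurable borel"
    and W: "\<And>x. 0 \<le> W x" and z: "\<And>x. 0 \<le> z x"
    and small: "\<And>x. (\<integral>\<^sup>+y. ennreal (W y) * bessel_kernel \<sigma> \<mu> (x - y) \<partial>lborel) \<le> ennreal (1 / 2)"
    and le: "AE x in lborel. ennreal (z x) \<le> (\<integral>\<^sup>+y. ennreal (W y * z y) * bessel_kernel \<sigma> \<mu> (x - y) \<partial>lborel)"
    and fin: "(\<integral>\<^sup>+x. ennreal (W x * (z x)\<^sup>2) \<partial>lborel) < \<infinity>"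
  shows "(\<integral>\<^sup>+y. ennreal (W y * z y) * bessel_kernel \<sigma> \<mu> (x - y) \<partial>lborel) = 0"
    and "AE x in lborel. z x = 0"
proof -
  define I where "I = (\<integral>\<^sup>+x. ennreal (W x * (z x)\<^sup>2) \<partial>lborel)"
  have "I \<le> (\<integral>\<^sup>+x. ennreal (W x * z x) * (\<integral>\<^sup>+y. ennreal (W y * z y) * bessel_kernel \<sigma> \<mu> (x - y) \<partial>lborel) \<partial>lborel)"
    unfolding I_def
  proof (rule nn_integral_mono_AE, use le in eventually_elim)
    case (elim x)
    have "ennreal (W x * (z x)\<^sup>2) = ennreal (W x * z x) * ennreal (z x)"
      using W z by (simp add: power2_eq_square mult.assoc flip: ennreal_mult)
    also have "\<dots> \<le> ennreal (W x * z x) * (\<integral>\<^sup>+y. ennreal (W y * z y) * bessel_kernel \<sigma> \<mu> (x - y) \<partial>lborel)"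
      by (intro mult_left_mono elim) simp
    finally show ?case .
  qed
  also have "\<dots> = (\<integral>\<^sup>+x. (\<integral>\<^sup>+y. ennreal (z x) * ennreal (z y) * (ennreal (W x) * ennreal (W y) * bessel_kernel \<sigma> \<mu> (x - y)) \<partial>lborel) \<partial>lborel)"
    by (subst nn_integral_cmult[symmetric]) (auto simp: ennreal_mult W z mult_ac)
  also have "\<dots> \<le> (\<integral>\<^sup>+x. ennreal ((z x)\<^sup>2) * (\<integral>\<^sup>+y. ennreal (W x) * ennreal (W y) * bessel_kernel \<sigma> \<mu> (x - y) \<partial>lborel) \<partial>lborel)"
    by (rule nn_integral_schur) (auto simp: z mult_ac bessel_kernel_commute)
  also have "\<dots> \<le> (\<integral>\<^sup>+x. ennreal (1 / 2) * ennreal (W x * (z x)\<^sup>2) \<partial>lborel)"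
  proof (rule nn_integral_mono)
    fix x
    have "ennreal ((z x)\<^sup>2) * (\<integral>\<^sup>+y. ennreal (W x) * ennreal (W y) * bessel_kernel \<sigma> \<mu> (x - y) \<partial>lborel)
      = ennreal (W x * (z x)\<^sup>2) * (\<integral>\<^sup>+y. ennreal (W y) * bessel_kernel \<sigma> \<mu> (x - y) \<partial>lborel)"
      using W by (simp add: mult.assoc nn_integral_cmult ennreal_mult) (simp add: mult_ac)
    also have "\<dots> \<le> ennreal (W x * (z x)\<^sup>2) * ennreal (1 / 2)"
      by (intro mult_left_mono small) simp
    finally show "ennreal ((z x)\<^sup>2) * (\<integral>\<^sup>+y. ennreal (W x) * ennreal (W y) * bessel_kernel \<sigma> \<mu> (x - y) \<partial>lborel)
       \<le> ennreal (1 / 2) * ennreal (W x * (z x)\<^sup>2)"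
      by (simp only: mult.commute)
  qed
  also have "\<dots> = ennreal (1 / 2) * I"
    unfolding I_def by (rule nn_integral_cmult) measurable
  finally have I_le: "I \<le> ennreal (1 / 2) * I" .
  \<comment> \<open>The inequality just obtained is also satisfied by \<infinity>, a case that
    \<open>fin\<close> excludes.\<close>
  have "I = 0"
  proof -
    obtain i where i: "I = ennreal i" "i \<ge> 0"
      using fin unfolding I_def[symmetric] by (cases I) auto
    then have "ennreal i \<le> ennreal (1 / 2 * i)"
      using I_le by (simp only: ennreal_mult'[symmetric])
    then have "i \<le> 1 / 2 * i"
      using i by (subst (asm) ennreal_le_iff) auto
    then show ?thesis using i by simp
  qed
  then have "AE x in lborel. ennreal (W x * (z x)\<^sup>2) = 0"
    unfolding I_def by (subst (asm) nn_integral_0_iff_AE) auto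
  then have zero: "AE y in lborel. ennreal (W y * z y) = 0"
  proof eventually_elim
    case (elim y)
    then have "W y * (z y)\<^sup>2 \<le> 0"
      by (simp only: ennreal_eq_0_iff)
    then have "W y = 0 \<or> z y = 0"
      using W[of y] by (auto simp: mult_le_0_iff)
    then show ?case by auto
  qed
  \<comment> \<open>This holds at every x, not just almost everywhere, because a null set of y does
    not affect the integral. The moving planes use it for a comparison at every point.\<close>
  show conv0: "(\<integral>\<^sup>+y. ennreal (W y * z y) * bessel_kernel \<sigma> \<mu> (x - y) \<partial>lborel) = 0" for x
    by (subst nn_integral_0_iff_AE) (use zero in auto)
  show "AE x in lborel. z x = 0"
    using le
  proof eventually_elim
    case (elim x)
    then have "ennreal (z x) \<le> 0"
      by (simp only: conv0)
    then show ?case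
      using z[of x] by simp
  qed
qed

end

subsection \<open>Integral equation and boundedness\<close>

text \<open>The constant \<open>c\<close>, later f(0), can have either sign. Its potential is
  \<open>c\<close> times the total mass of the kernel, and sending its positive and negative part to
  opposite sides keeps the identity within \<open>ennreal\<close>. Both sides have the same finite
  integrals against all heat kernels, hence agree almost everywhere.\<close>

lemma weak_solution_representation:
  fixes u u0 h :: "real^'n \<Rightarrow> real"
  assumes ws: "weak_solution m s f u" and pos: "s > 0" "m \<noteq> 0"
    and [measurable]: "u0 \<in> borel_measurable borel" "h \<in> borel_measurable borel"
    and eq: "AE x in lborel. u x = u0 x" and u0: "\<And>x. u0 x \<ge> 0"
    and feq: "AE x in lborel. f (u x) = h x + c" and h: "\<And>x. h x \<ge> 0"
  shows "AE x in lborel. ennreal (u0 x) + ennreal (max 0 (- c) * (m\<^sup>2) powr - s)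
     = (\<integral>\<^sup>+y. ennreal (h y) * bessel_kernel s (m\<^sup>2) (x - y) \<partial>lborel) + ennreal (max 0 c * (m\<^sup>2) powr - s)"
proof -
  define \<mu> where "\<mu> = m\<^sup>2"
  have \<mu>: "\<mu> > 0" using pos by (simp add: \<mu>_def)
  define \<kappa> where "\<kappa> = \<mu> powr - s"
  have \<kappa>: "\<kappa> > 0" using \<mu> by (simp add: \<kappa>_def)
  define Q where "Q x = (\<integral>\<^sup>+y. ennreal (h y) * bessel_kernel s \<mu> (x - y) \<partial>lborel)" for x
  have [measurable]: "Q \<in> borel_measurable borel"
    unfolding Q_def by measurable
  have "integrable lebesgue (\<lambda>x. norm (u x) powr 2)"
    using ws by (simp add: weak_solution_def Hs_def Lp_def)
  then have "integrable lborel (\<lambda>x. norm (u0 x) powr 2)"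
    by (subst (asm) integral_lebesgue_eq_lborel(2)[where ?f0.0="\<lambda>x. norm (u0 x) powr 2"]) (use eq in auto)
  then have u0_sq: "integrable lborel (\<lambda>x. (u0 x)\<^sup>2)"
    by simp
  have key: "(\<integral>\<^sup>+x. (ennreal (u0 x) + ennreal (max 0 (- c) * \<kappa>)) * ennreal (heat_kernel t (x - a)) \<partial>lborel)
      = (\<integral>\<^sup>+x. (Q x + ennreal (max 0 c * \<kappa>)) * ennreal (heat_kernel t (x - a)) \<partial>lborel)
    \<and> (\<integral>\<^sup>+x. (ennreal (u0 x) + ennreal (max 0 (- c) * \<kappa>)) * ennreal (heat_kernel t (x - a)) \<partial>lborel) < \<infinity>"
    if t: "t > 0" for t a
  proof -
    define b where "b x = bessel_heat s \<mu> t (x - a)" for x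
    have [measurable]: "b \<in> borel_measurable borel"
      unfolding b_def by measurable
    have b_nn: "b x \<ge> 0" for x
      unfolding b_def by (rule bessel_heat_nonneg[OF pos(1) \<mu> t])
    have b_int: "integrable lborel b"
      unfolding b_def by (rule integrable_bessel_heat_diff[OF pos(1) \<mu> t])
    \<comment> \<open>Fubini moves the Bessel kernel from the test function onto the source, leaving
      a pure heat kernel.\<close>
    have conv: "(\<integral>\<^sup>+y. ennreal (g y) * ennreal (b y) \<partial>lborel)
       = (\<integral>\<^sup>+x. (\<integral>\<^sup>+y. ennreal (g y) * bessel_kernel s \<mu> (x - y) \<partial>lborel) * ennreal (heat_kernel t (x - a)) \<partial>lborel)"
      if [measurable]: "g \<in> borel_measurable borel" for g
    proof -
      have "(\<integral>\<^sup>+y. ennreal (g y) * ennreal (b y) \<partial>lborel)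
        = (\<integral>\<^sup>+y. (\<integral>\<^sup>+x. ennreal (g y) * (ennreal (heat_kernel t (x - a)) * bessel_kernel s \<mu> (x - y)) \<partial>lborel) \<partial>lborel)"
        unfolding b_def by (simp add: bessel_heat_eq_convolution[OF pos(1) \<mu> t] nn_integral_cmult)
      also have "\<dots> = (\<integral>\<^sup>+x. (\<integral>\<^sup>+y. ennreal (g y) * (ennreal (heat_kernel t (x - a)) * bessel_kernel s \<mu> (x - y)) \<partial>lborel) \<partial>lborel)"
        by (rule lborel_pair.Fubini'[of "\<lambda>x y. ennreal (g y) * (ennreal (heat_kernel t (x - a)) * bessel_kernel s \<mu> (x - y))", simplified]) measurable
      also have "\<dots> = (\<integral>\<^sup>+x. (\<integral>\<^sup>+y. ennreal (g y) * bessel_kernel s \<mu> (x - y) * ennreal (heat_kernel t (x - a)) \<partial>lborel) \<partial>lborel)"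
        by (simp only: mult_ac)
      finally show ?thesis
        by (simp add: nn_integral_multc)
    qed
    have "(\<integral>\<^sup>+y. ennreal 1 * ennreal (b y) \<partial>lborel) = ennreal \<kappa>"
      unfolding conv[of "\<lambda>_. 1", OF borel_measurable_const] \<kappa>_def
      using t \<mu> by (simp add: nn_integral_bessel_kernel_diff[OF pos(1) \<mu>] nn_integral_cmult nn_integral_heat_kernel_diff)
    then have b1: "integral\<^sup>L lborel b = \<kappa>"
      using b_int b_nn \<kappa> by (simp add: nn_integral_eq_integral)
    have AE_b: "AE x in lborel. f (u x) * bessel_heat s (m\<^sup>2) t (x - a) = (h x + c) * b x"
      using feq by eventually_elim (simp add: b_def \<mu>_def)
    have hb: "integrable lborel (\<lambda>x. (h x + c) * b x)"
      using weak_solution_bessel_heat(1)[OF ws pos t _ eq, of a] integral_lebesgue_eq_lborel(2)[OF _ AE_b] by simp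
    have "integrable lborel (\<lambda>x. (h x + c) * b x - c * b x)"
      by (intro Bochner_Integration.integrable_diff hb integrable_mult_right b_int)
    then have h_int: "integrable lborel (\<lambda>x. h x * b x)"
      by (simp add: algebra_simps)
    have u_int: "integrable lborel (\<lambda>x. u0 x * heat_kernel t (x - a))"
    proof (rule Bochner_Integration.integrable_bound)
      define D where "D = (4 * pi * t) powr (- real DIM(real^'n) / 2)"
      have hk: "integrable lborel (\<lambda>x::real^'n. heat_kernel t (x - a))"
        using integral_lborel_translation(2)[of "heat_kernel t" "- a"] integrable_heat_kernel[OF t] by simp
      show "integrable lborel (\<lambda>x. (u0 x)\<^sup>2 + D * heat_kernel t (x - a))"
        by (intro Bochner_Integration.integrable_add u0_sq integrable_mult_right hk)
      have "u0 x * heat_kernel t (x - a) \<le> (u0 x)\<^sup>2 + D * heat_kernel t (x - a)" for x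
      proof -
        have "u0 x * heat_kernel t (x - a) \<le> (u0 x)\<^sup>2 + (heat_kernel t (x - a))\<^sup>2"
          using sum_squares_bound[of "u0 x" "heat_kernel t (x - a)"] mult_nonneg_nonneg[OF u0[of x] heat_kernel_nonneg[of t "x - a"]] by linarith
        also have "(heat_kernel t (x - a))\<^sup>2 \<le> D * heat_kernel t (x - a)"
          unfolding D_def power2_eq_square by (intro mult_right_mono heat_kernel_le t) simp
        finally show ?thesis by simp
      qed
      then show "AE x in lborel. norm (u0 x * heat_kernel t (x - a)) \<le> norm ((u0 x)\<^sup>2 + D * heat_kernel t (x - a))"
        using u0 by (intro AE_I2) (simp add: D_def)
    qed measurable
    have "(\<integral>x. (h x + c) * b x \<partial>lborel) = (\<integral>x. u0 x * heat_kernel t (x - a) \<partial>lborel)"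
      using weak_solution_bessel_heat(2)[OF ws pos t _ eq, of a] integral_lebesgue_eq_lborel(1)[OF _ AE_b] by simp
    moreover have "(\<integral>x. (h x + c) * b x \<partial>lborel) = (\<integral>x. h x * b x \<partial>lborel) + c * \<kappa>"
      by (simp add: distrib_right h_int b_int b1)
    ultimately have real_eq: "(\<integral>x. u0 x * heat_kernel t (x - a) \<partial>lborel) + max 0 (- c) * \<kappa> = (\<integral>x. h x * b x \<partial>lborel) + max 0 c * \<kappa>"
      by (auto simp: max_def)
    have cst: "(\<integral>\<^sup>+x. ennreal r * ennreal (heat_kernel t (x - a)) \<partial>lborel) = ennreal r" for r
      using t by (simp add: nn_integral_cmult nn_integral_heat_kernel_diff)
    have hnn: "(\<integral>x. h x * b x \<partial>lborel) \<ge> 0" "(\<integral>x. u0 x * heat_kernel t (x - a) \<partial>lborel) \<ge> 0"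
      using h b_nn u0 by (auto intro!: integral_nonneg_AE)
    have L: "(\<integral>\<^sup>+x. (ennreal (u0 x) + ennreal (max 0 (- c) * \<kappa>)) * ennreal (heat_kernel t (x - a)) \<partial>lborel)
      = ennreal ((\<integral>x. u0 x * heat_kernel t (x - a) \<partial>lborel) + max 0 (- c) * \<kappa>)"
    proof -
      have "(\<integral>\<^sup>+x. ennreal (u0 x) * ennreal (heat_kernel t (x - a)) \<partial>lborel) = ennreal (\<integral>x. u0 x * heat_kernel t (x - a) \<partial>lborel)"
        using u_int u0 by (simp add: nn_integral_eq_integral flip: ennreal_mult)
      then show ?thesis
        using hnn \<kappa> by (simp add: distrib_right nn_integral_add cst ennreal_plus)
    qed
    have R: "(\<integral>\<^sup>+x. (Q x + ennreal (max 0 c * \<kappa>)) * ennreal (heat_kernel t (x - a)) \<partial>lborel)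
      = ennreal ((\<integral>x. h x * b x \<partial>lborel) + max 0 c * \<kappa>)"
    proof -
      have "(\<integral>\<^sup>+x. Q x * ennreal (heat_kernel t (x - a)) \<partial>lborel) = ennreal (\<integral>x. h x * b x \<partial>lborel)"
        unfolding Q_def conv[of h, OF \<open>h \<in> borel_measurable borel\<close>, symmetric] using h_int h b_nn by (simp add: nn_integral_eq_integral flip: ennreal_mult)
      then show ?thesis
        using hnn \<kappa> by (simp add: distrib_right nn_integral_add cst ennreal_plus)
    qed
    show ?thesis
      unfolding L R real_eq by simp
  qed
  have "AE x in lborel. ennreal (u0 x) + ennreal (max 0 (- c) * \<kappa>) = Q x + ennreal (max 0 c * \<kappa>)"
    by (rule gaussian_test_unique) (use key key[of 1 0] in auto)
  then show ?thesis
    by (simp add: Q_def \<kappa>_def \<mu>_def)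
qed

text \<open>The excess of the solution over a large constant is a subsolution of the linear equation with
  a potential that lives where the solution is large and is therefore small, hence it vanishes.\<close>

lemma bounded_of_potential:
  fixes u h W :: "'a::euclidean_space \<Rightarrow> real" and B :: "real \<Rightarrow> real"
  assumes pos: "\<sigma> > 0" "\<mu> > 0" and p: "p > 1" "real DIM('a) / (2 * p) < \<sigma>"
    and [measurable]: "u \<in> borel_measurable borel" "h \<in> borel_measurable borel" "W \<in> borel_measurable borel"
    and nn: "\<And>x. u x \<ge> 0" "\<And>x. h x \<ge> 0" "\<And>x. W x \<ge> 0" "c \<ge> 0"
    and le: "AE x in lborel. ennreal (u x) \<le> ennreal c + (\<integral>\<^sup>+y. ennreal (h y) * bessel_kernel \<sigma> \<mu> (x - y) \<partial>lborel)"
    and hW: "\<And>x. h x \<le> W x * u x" and hB: "\<And>x M. u x \<le> M \<Longrightarrow> h x \<le> B M"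
    and Wp: "(\<integral>\<^sup>+x. ennreal (W x powr p) \<partial>lborel) < \<infinity>"
    and hu: "(\<integral>\<^sup>+x. ennreal (h x * u x) \<partial>lborel) < \<infinity>"
  shows "\<exists>L. AE x in lborel. u x \<le> L"
proof -
  obtain \<eta> where \<eta>: "\<eta> > 0" and small: "\<And>W x. W \<in> borel_measurable borel \<Longrightarrow> (\<And>y. 0 \<le> W y) \<Longrightarrow>
    (\<integral>\<^sup>+y. ennreal (W y powr p) \<partial>lborel) \<le> ennreal \<eta> \<Longrightarrow>
    (\<integral>\<^sup>+y. ennreal (W y) * bessel_kernel \<sigma> \<mu> (x - y :: 'a) \<partial>lborel) \<le> ennreal (1 / 2)"
    using bessel_kernel_potential_small[OF pos p] by blast
  \<comment> \<open>The sets {u > n} decrease to the empty set, so at some level the p-th power of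
    \<open>W\<close> has a small integral over them.\<close>
  have "(\<lambda>n. \<integral>\<^sup>+x. ennreal ((W x * indicator {x. u x > real n} x) powr p) \<partial>lborel) \<longlonglongrightarrow> (\<integral>\<^sup>+x. 0 \<partial>(lborel :: 'a measure))"
  proof (rule nn_integral_dominated_convergence[where w="\<lambda>x. ennreal (W x powr p)"])
    show "AE x in lborel. (\<lambda>n. ennreal ((W x * indicator {x. u x > real n} x) powr p)) \<longlonglongrightarrow> 0"
    proof (rule AE_I2)
      fix x
      have "\<forall>\<^sub>F n in sequentially. u x \<le> real n"
        using filterlim_real_sequentially by (simp add: filterlim_at_top)
      then have "\<forall>\<^sub>F n in sequentially. ennreal ((W x * indicator {x. u x > real n} x) powr p) = 0"
        by eventually_elim simp
      then show "(\<lambda>n. ennreal ((W x * indicator {x. u x > real n} x) powr p)) \<longlonglongrightarrow> 0"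
        by (rule tendsto_eventually)
    qed
  qed (use Wp in \<open>auto simp: indicator_def\<close>)
  then have "\<forall>\<^sub>F n in sequentially. (\<integral>\<^sup>+x. ennreal ((W x * indicator {x. u x > real n} x) powr p) \<partial>lborel) < ennreal \<eta>"
    by (rule order_tendstoD(2)) (use \<eta> in simp)
  then obtain n where n: "(\<integral>\<^sup>+x. ennreal ((W x * indicator {x. u x > real n} x) powr p) \<partial>lborel) < ennreal \<eta>"
    by (auto simp: eventually_sequentially)
  define M where "M = real n"
  \<comment> \<open>Above the level M the source is exactly \<open>V\<close> times \<open>u\<close>,
    with V \<le> W; below it the source is at most the constant B(M), whose potential is
    bounded.\<close>
  define V where "V x = (if u x > M then h x / u x else 0)" for x
  have [measurable]: "V \<in> borel_measurable borel"
    unfolding V_def by measurable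
  have V_nn: "V x \<ge> 0" for x
    using nn by (simp add: V_def)
  have V_le: "V x \<le> W x * indicator {x. u x > M} x" for x
  proof (cases "u x > M")
    case True
    then have "u x > 0" by (simp add: M_def)
    then show ?thesis
      using True hW[of x] by (simp add: V_def divide_le_eq)
  qed (simp add: V_def)
  have V_small: "(\<integral>\<^sup>+y. ennreal (V y) * bessel_kernel \<sigma> \<mu> (x - y) \<partial>lborel) \<le> ennreal (1 / 2)" for x
  proof (rule small)
    have "(\<integral>\<^sup>+y. ennreal (V y powr p) \<partial>lborel) \<le> (\<integral>\<^sup>+x. ennreal ((W x * indicator {x. u x > M} x) powr p) \<partial>lborel)"
      using p by (intro nn_integral_mono ennreal_leI powr_mono2 V_le V_nn) simp
    then show "(\<integral>\<^sup>+y. ennreal (V y powr p) \<partial>lborel) \<le> ennreal \<eta>"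
      using n by (simp add: M_def)
  qed (simp_all add: V_nn)
  define BM where "BM = max 0 (B M)"
  have h_le: "h x \<le> V x * u x + BM" for x
  proof (cases "u x > M")
    case True
    then have "u x > 0" by (simp add: M_def)
    then show ?thesis using True by (simp add: V_def BM_def)
  next
    case False
    then have "h x \<le> B M" by (intro hB) simp
    then show ?thesis using False by (simp add: V_def BM_def)
  qed
  define L where "L = c + BM * \<mu> powr - \<sigma>"
  have L: "L \<ge> 0" using nn by (simp add: L_def BM_def)
  \<comment> \<open>The excess over 2 L rather than L: bounding u by z + 2 L under the potential
    costs at most half of 2 L, and the constant terms add another L.\<close>
  define z where "z x = max 0 (u x - 2 * L)" for x
  have [measurable]: "z \<in> borel_measurable borel"
    unfolding z_def by measurable
  have z_nn: "z x \<ge> 0" for x by (simp add: z_def)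
  have "AE x in lborel. ennreal (z x) \<le> (\<integral>\<^sup>+y. ennreal (V y * z y) * bessel_kernel \<sigma> \<mu> (x - y) \<partial>lborel)"
    using le
  proof eventually_elim
    case (elim x)
    define K where "K y = bessel_kernel \<sigma> \<mu> (x - y)" for y
    have [measurable]: "K \<in> borel_measurable borel"
      unfolding K_def by measurable
    define J where "J = (\<integral>\<^sup>+y. ennreal (V y * z y) * K y \<partial>lborel)"
    have "h y \<le> V y * z y + 2 * L * V y + BM" for y
    proof -
      have "u y \<le> z y + 2 * L" by (simp add: z_def)
      then have "V y * u y \<le> V y * (z y + 2 * L)"
        by (intro mult_left_mono V_nn)
      then show ?thesis
        using h_le[of y] by (simp add: algebra_simps)
    qed
    then have "ennreal (h y) * K y \<le> (ennreal (V y * z y) + ennreal (2 * L) * ennreal (V y) + ennreal BM) * K y" for y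
      using V_nn z_nn L by (intro mult_right_mono) (auto simp: BM_def ennreal_leI simp flip: ennreal_mult ennreal_plus)
    then have "(\<integral>\<^sup>+y. ennreal (h y) * K y \<partial>lborel) \<le> (\<integral>\<^sup>+y. (ennreal (V y * z y) + ennreal (2 * L) * ennreal (V y) + ennreal BM) * K y \<partial>lborel)"
      by (intro nn_integral_mono)
    also have "\<dots> = J + ennreal (2 * L) * (\<integral>\<^sup>+y. ennreal (V y) * K y \<partial>lborel) + ennreal BM * (\<integral>\<^sup>+y. K y \<partial>lborel)"
      unfolding J_def by (simp add: distrib_right nn_integral_add nn_integral_cmult mult.assoc)
    also have "(\<integral>\<^sup>+y. K y \<partial>lborel) = ennreal (\<mu> powr - \<sigma>)"
      unfolding K_def by (rule nn_integral_bessel_kernel_diff[OF pos])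
    also have "J + ennreal (2 * L) * (\<integral>\<^sup>+y. ennreal (V y) * K y \<partial>lborel) + ennreal BM * ennreal (\<mu> powr - \<sigma>)
      \<le> J + ennreal (2 * L) * ennreal (1 / 2) + ennreal BM * ennreal (\<mu> powr - \<sigma>)"
      unfolding K_def by (intro add_mono mult_left_mono V_small) simp_all
    finally have "ennreal c + (\<integral>\<^sup>+y. ennreal (h y) * K y \<partial>lborel) \<le> ennreal c + (J + ennreal (2 * L) * ennreal (1 / 2) + ennreal BM * ennreal (\<mu> powr - \<sigma>))"
      by (intro add_left_mono)
    also have "\<dots> = J + ennreal (2 * L)"
    proof -
      have "ennreal (2 * L) * ennreal (1 / 2) = ennreal L"
        by (subst ennreal_mult[symmetric]) (use L in simp_all)
      moreover have "ennreal c + ennreal BM * ennreal (\<mu> powr - \<sigma>) = ennreal L"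
        using nn by (simp add: L_def BM_def flip: ennreal_mult ennreal_plus)
      moreover have "ennreal L + ennreal L = ennreal (2 * L)"
        using L by (simp flip: ennreal_plus)
      ultimately show ?thesis
        by (metis add.assoc add.commute)
    qed
    finally have uJ: "ennreal (u x) \<le> J + ennreal (2 * L)"
      using elim by (simp add: K_def)
    have "ennreal (z x) \<le> J"
    proof (cases "J = \<infinity>")
      case False
      then obtain j where j: "J = ennreal j" "j \<ge> 0"
        by (cases J) auto
      then have "u x \<le> j + 2 * L"
        using uJ L by (simp flip: ennreal_plus add: ennreal_le_iff)
      then show ?thesis
        using j by (auto simp: z_def max_def ennreal_leI)
    qed simp
    then show ?case
      by (simp add: J_def K_def)
  qed
  \<comment> \<open>Finiteness comes from the integrability of h u, because V u^2 = h u above the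
    level.\<close>
  moreover have "(\<integral>\<^sup>+x. ennreal (V x * (z x)\<^sup>2) \<partial>lborel) < \<infinity>"
  proof -
    have "V x * (z x)\<^sup>2 \<le> h x * u x" for x
    proof (cases "u x > M")
      case True
      then have u: "u x > 0" by (simp add: M_def)
      have "(z x)\<^sup>2 \<le> (u x)\<^sup>2"
        using L u by (intro power_mono) (auto simp: z_def)
      then have "V x * (z x)\<^sup>2 \<le> V x * (u x)\<^sup>2"
        by (intro mult_left_mono V_nn)
      then show ?thesis
        using u True by (simp add: V_def power2_eq_square)
    qed (simp add: V_def nn)
    then have "(\<integral>\<^sup>+x. ennreal (V x * (z x)\<^sup>2) \<partial>lborel) \<le> (\<integral>\<^sup>+x. ennreal (h x * u x) \<partial>lborel)"
      by (intro nn_integral_mono ennreal_leI)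
    then show ?thesis
      using hu by (rule le_less_trans)
  qed
  ultimately have "AE x in lborel. z x = 0"
    by (intro bessel_kernel_contraction(2)[OF pos _ _ V_nn z_nn V_small]) auto
  then have "AE x in lborel. u x \<le> 2 * L"
    by eventually_elim (simp add: z_def)
  then show ?thesis by blast
qed

text \<open>Real values are wanted for sources of either sign and for differences of kernels. Where
  the kernel is infinite, which can happen only at the origin, \<open>enn2real\<close> returns 0;
  comparisons of values therefore exclude the origin, and integrals do not notice it.\<close>

definition bessel_potential :: "real \<Rightarrow> real \<Rightarrow> 'a::euclidean_space \<Rightarrow> real" where
  "bessel_potential \<sigma> \<mu> x = enn2real (bessel_kernel \<sigma> \<mu> x)"

lemma measurable_bessel_potential [measurable]: "bessel_potential \<sigma> \<mu> \<in> borel_measurable borel"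
  unfolding bessel_potential_def by measurable

lemma bessel_potential_nonneg [simp]: "bessel_potential \<sigma> \<mu> x \<ge> 0"
  by (simp add: bessel_potential_def)

lemma bessel_potential_norm_cong:
  "norm (x::'a::euclidean_space) = norm (y::'a) \<Longrightarrow> bessel_potential \<sigma> \<mu> x = bessel_potential \<sigma> \<mu> y"
  unfolding bessel_potential_def by (simp cong: bessel_kernel_norm_cong)

context
  fixes \<sigma> \<mu> :: real
  assumes pos: "\<sigma> > 0" "\<mu> > 0"
begin

lemma ennreal_bessel_potential:
  "x \<noteq> 0 \<Longrightarrow> ennreal (bessel_potential \<sigma> \<mu> x) = bessel_kernel \<sigma> \<mu> (x::'a::euclidean_space)"
  using bessel_kernel_finite[OF pos, of x] by (simp add: bessel_potential_def)

lemma bessel_potential_strict_antimono: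
  fixes x y :: "'a::euclidean_space"
  assumes "x \<noteq> 0" "norm x < norm y"
  shows "bessel_potential \<sigma> \<mu> y < bessel_potential \<sigma> \<mu> x"
proof -
  have "y \<noteq> 0" using assms by auto
  then have "ennreal (bessel_potential \<sigma> \<mu> y) < ennreal (bessel_potential \<sigma> \<mu> x)"
    using bessel_kernel_strict_antimono[OF pos assms(2)] assms(1) by (simp add: ennreal_bessel_potential)
  then show ?thesis
    by (simp add: ennreal_less_iff)
qed

lemma nn_integral_bessel_potential:
  fixes x :: "'a::euclidean_space"
  assumes [measurable]: "g \<in> borel_measurable borel"
  shows "(\<integral>\<^sup>+y. g y * ennreal (bessel_potential \<sigma> \<mu> (x - y)) \<partial>lborel) = (\<integral>\<^sup>+y. g y * bessel_kernel \<sigma> \<mu> (x - y) \<partial>lborel)"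
  by (rule nn_integral_cong_AE, use AE_lborel_singleton[of x] in eventually_elim) (simp add: ennreal_bessel_potential)

lemma integrable_bessel_potential:
  fixes x :: "'a::euclidean_space"
  shows "integrable lborel (\<lambda>y. bessel_potential \<sigma> \<mu> (x - y))"
    and "(\<integral>\<^sup>+y. ennreal (bessel_potential \<sigma> \<mu> (x - y)) \<partial>lborel) = ennreal (\<mu> powr - \<sigma>)"
proof -
  show eq: "(\<integral>\<^sup>+y. ennreal (bessel_potential \<sigma> \<mu> (x - y)) \<partial>lborel) = ennreal (\<mu> powr - \<sigma>)"
    using nn_integral_bessel_potential[of "\<lambda>_. 1" x] by (simp add: nn_integral_bessel_kernel_diff[OF pos])
  then show "integrable lborel (\<lambda>y. bessel_potential \<sigma> \<mu> (x - y))"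
    by (intro integrableI_bounded) simp_all
qed

lemma integrable_bessel_potential_mult:
  fixes x :: "'a::euclidean_space" and F :: "'a \<Rightarrow> real"
  assumes [measurable]: "F \<in> borel_measurable borel" and B: "\<And>y. \<bar>F y\<bar> \<le> B"
  shows "integrable lborel (\<lambda>y. bessel_potential \<sigma> \<mu> (x - y) * F y)"
proof (rule Bochner_Integration.integrable_bound)
  show "integrable lborel (\<lambda>y. bessel_potential \<sigma> \<mu> (x - y) * B)"
    by (intro integrable_mult_left integrable_bessel_potential)
  have "B \<ge> 0" using order_trans[OF abs_ge_zero B] .
  then show "AE y in lborel. norm (bessel_potential \<sigma> \<mu> (x - y) * F y) \<le> norm (bessel_potential \<sigma> \<mu> (x - y) * B)"
    using B by (intro AE_I2) (auto simp: abs_mult intro!: mult_left_mono)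
qed measurable

lemma bessel_potential_sequentially:
  fixes z :: "'a::euclidean_space"
  assumes z: "z \<noteq> 0" and lim: "Z \<longlonglongrightarrow> z"
  shows "(\<lambda>n. bessel_potential \<sigma> \<mu> (Z n)) \<longlonglongrightarrow> bessel_potential \<sigma> \<mu> z"
proof -
  \<comment> \<open>Monotonicity in the norm supplies the dominating function: points close to
    \<open>z\<close> have larger norm than \<open>w\<close>, and the kernel is finite at
    \<open>w\<close>.\<close>
  define w where "w = (1 / 2) *\<^sub>R z"
  have w: "w \<noteq> 0" "norm w < norm z" using z by (auto simp: w_def)
  have "(\<lambda>n. norm (Z n)) \<longlonglongrightarrow> norm z"
    by (intro tendsto_norm lim)
  then have "\<forall>\<^sub>F n in sequentially. norm w < norm (Z n)"
    by (rule order_tendstoD) (rule w)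
  then obtain N where N: "\<And>n. n \<ge> N \<Longrightarrow> norm w < norm (Z n)"
    by (auto simp: eventually_sequentially)
  define Y where "Y n = Z (n + N)" for n
  have Y: "Y \<longlonglongrightarrow> z"
    unfolding Y_def using lim by (rule LIMSEQ_ignore_initial_segment)
  have Yw: "norm w < norm (Y n)" for n
    using N[of "n + N"] by (simp add: Y_def)
  have "(\<lambda>n. bessel_kernel \<sigma> \<mu> (Y n)) \<longlonglongrightarrow> bessel_kernel \<sigma> \<mu> z"
    unfolding bessel_kernel_def
  proof (rule nn_integral_dominated_convergence[where w="\<lambda>\<tau>. ennreal (bessel_weight \<sigma> \<mu> \<tau> * heat_kernel \<tau> w)"])
    show "(\<integral>\<^sup>+\<tau>. ennreal (bessel_weight \<sigma> \<mu> \<tau> * heat_kernel \<tau> w) \<partial>lborel) < \<infinity>"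
      using bessel_kernel_finite[OF pos w(1)] by (simp add: bessel_kernel_def)
    show "AE \<tau> in lborel. ennreal (bessel_weight \<sigma> \<mu> \<tau> * heat_kernel \<tau> (Y n)) \<le> ennreal (bessel_weight \<sigma> \<mu> \<tau> * heat_kernel \<tau> w)" for n
      using pos Yw[of n] by (intro AE_I2 ennreal_leI bessel_weight_heat_kernel_antimono) simp_all
    show "AE \<tau> in lborel. (\<lambda>n. ennreal (bessel_weight \<sigma> \<mu> \<tau> * heat_kernel \<tau> (Y n))) \<longlonglongrightarrow> ennreal (bessel_weight \<sigma> \<mu> \<tau> * heat_kernel \<tau> z)"
      unfolding heat_kernel_def divide_inverse by (intro AE_I2 tendsto_ennrealI tendsto_intros Y)
  qed measurable
  then have "(\<lambda>n. bessel_potential \<sigma> \<mu> (Y n)) \<longlonglongrightarrow> bessel_potential \<sigma> \<mu> z"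
    unfolding bessel_potential_def using bessel_kernel_finite[OF pos z] by (intro tendsto_enn2real) auto
  then show ?thesis
    unfolding Y_def by (rule LIMSEQ_offset)
qed

text \<open>The translates of the kernel converge almost everywhere and have equal mass, so by
  Scheffe's lemma they converge in L^1; against a bounded \<open>F\<close> this is enough.\<close>

lemma continuous_bessel_potential_convolution:
  fixes F :: "'a::euclidean_space \<Rightarrow> real"
  assumes [measurable]: "F \<in> borel_measurable borel" and B: "\<And>y. \<bar>F y\<bar> \<le> B"
  shows "continuous_on UNIV (\<lambda>x. \<integral>y. bessel_potential \<sigma> \<mu> (x - y) * F y \<partial>lborel)"
proof (rule continuous_on_sequentiallyI)
  fix X :: "nat \<Rightarrow> 'a" and x assume X: "X \<longlonglongrightarrow> x"
  have B0: "B \<ge> 0" using order_trans[OF abs_ge_zero B] .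
  note int = integrable_bessel_potential_mult[OF _ B]
  have scheffe: "(\<lambda>n. \<integral>\<^sup>+y. norm (bessel_potential \<sigma> \<mu> (X n - y) - bessel_potential \<sigma> \<mu> (x - y)) \<partial>lborel) \<longlonglongrightarrow> 0"
  proof (rule Scheffe_lemma2)
    show "AE y in lborel. (\<lambda>n. bessel_potential \<sigma> \<mu> (X n - y)) \<longlonglongrightarrow> bessel_potential \<sigma> \<mu> (x - y)"
      using AE_lborel_singleton[of x]
    proof eventually_elim
      case (elim y)
      then show ?case
        by (intro bessel_potential_sequentially tendsto_intros X) simp
    qed
  qed (simp_all add: integrable_bessel_potential)
  define d where "d n = (\<integral>y. bessel_potential \<sigma> \<mu> (X n - y) * F y \<partial>lborel) - (\<integral>y. bessel_potential \<sigma> \<mu> (x - y) * F y \<partial>lborel)" for n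
  have d_le: "ennreal \<bar>d n\<bar> \<le> ennreal B * (\<integral>\<^sup>+y. norm (bessel_potential \<sigma> \<mu> (X n - y) - bessel_potential \<sigma> \<mu> (x - y)) \<partial>lborel)" for n
  proof -
    have "d n = (\<integral>y. (bessel_potential \<sigma> \<mu> (X n - y) - bessel_potential \<sigma> \<mu> (x - y)) * F y \<partial>lborel)"
      unfolding d_def left_diff_distrib by (simp add: int)
    then have "ennreal (norm (d n)) \<le> (\<integral>\<^sup>+y. ennreal (norm ((bessel_potential \<sigma> \<mu> (X n - y) - bessel_potential \<sigma> \<mu> (x - y)) * F y)) \<partial>lborel)"
      by (simp only: ennreal_norm_integral_le)
    also have "\<dots> \<le> (\<integral>\<^sup>+y. ennreal B * ennreal (norm (bessel_potential \<sigma> \<mu> (X n - y) - bessel_potential \<sigma> \<mu> (x - y))) \<partial>lborel)"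
      using B B0 by (intro nn_integral_mono) (auto simp: abs_mult mult.commute[of B] intro!: ennreal_leI mult_left_mono simp flip: ennreal_mult)
    finally show ?thesis
      by (simp add: nn_integral_cmult)
  qed
  have "(\<lambda>n. ennreal B * (\<integral>\<^sup>+y. norm (bessel_potential \<sigma> \<mu> (X n - y) - bessel_potential \<sigma> \<mu> (x - y)) \<partial>lborel)) \<longlonglongrightarrow> ennreal B * 0"
    by (intro tendsto_mult_ennreal tendsto_const scheffe) simp
  then have lim0: "(\<lambda>n. ennreal B * (\<integral>\<^sup>+y. norm (bessel_potential \<sigma> \<mu> (X n - y) - bessel_potential \<sigma> \<mu> (x - y)) \<partial>lborel)) \<longlonglongrightarrow> 0"
    by simp
  have "(\<lambda>n. ennreal \<bar>d n\<bar>) \<longlonglongrightarrow> 0"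
    by (rule tendsto_sandwich[OF always_eventually always_eventually tendsto_const lim0]) (simp_all only: d_le zero_le simp_thms)
  then have "(\<lambda>n. ennreal \<bar>d n\<bar>) \<longlonglongrightarrow> ennreal 0"
    by simp
  then have "(\<lambda>n. \<bar>d n\<bar>) \<longlonglongrightarrow> 0"
    by (subst (asm) tendsto_ennreal_iff) auto
  then have "d \<longlonglongrightarrow> 0"
    by (rule tendsto_rabs_zero_cancel)
  then show "(\<lambda>n. \<integral>y. bessel_potential \<sigma> \<mu> (X n - y) * F y \<partial>lborel) \<longlonglongrightarrow> (\<integral>y. bessel_potential \<sigma> \<mu> (x - y) * F y \<partial>lborel)"
    unfolding d_def by (simp add: LIM_zero_iff)
qed

end

subsection \<open>Moving planes\<close>

definition refl_plane :: "'a::euclidean_space \<Rightarrow> real \<Rightarrow> 'a \<Rightarrow> 'a" where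
  "refl_plane e l x = x - (2 * (x \<bullet> e - l)) *\<^sub>R e"

context
  fixes e :: "'a::euclidean_space"
  assumes e: "norm e = 1"
begin

lemma inner_unit: "e \<bullet> e = 1"
  using e by (simp flip: power2_norm_eq_inner)

lemma refl_plane_inner [simp]: "refl_plane e l x \<bullet> e = 2 * l - x \<bullet> e"
  by (simp add: refl_plane_def inner_diff_left inner_unit)

text \<open>Two parallel reflections make a translation by twice their distance. Two planes of
  symmetry with the same normal would thus make the solution invariant under a translation, which
  \<open>not_nonincreasing\<close> excludes.\<close>

lemma refl_plane_compose: "refl_plane e l (refl_plane e k x) = x - (2 * (k - l)) *\<^sub>R e"
proof -
  have "2 * (x \<bullet> e - k) + 2 * (2 * k - x \<bullet> e - l) = 2 * (k - l)"
    by simp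
  then show ?thesis
    unfolding refl_plane_def[of e l] refl_plane_inner
    unfolding refl_plane_def diff_diff_eq scaleR_add_left[symmetric] by (simp only:)
qed

lemma refl_plane_involutive [simp]: "refl_plane e l (refl_plane e l x) = x"
  by (simp add: refl_plane_compose)

text \<open>The sign of the last term is the geometric core of the method: for two points on the
  same side of the plane, reflecting one of them increases their distance.\<close>

lemma norm_refl_plane_diff_sq:
  "(norm (refl_plane e l x - y))\<^sup>2 = (norm (x - y))\<^sup>2 + 4 * (x \<bullet> e - l) * (y \<bullet> e - l)"
proof -
  define k where "k = 2 * (x \<bullet> e - l)"
  have "(norm (refl_plane e l x - y))\<^sup>2 = ((x - y) - k *\<^sub>R e) \<bullet> ((x - y) - k *\<^sub>R e)"
    by (simp add: power2_norm_eq_inner refl_plane_def k_def algebra_simps)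
  also have "\<dots> = (x - y) \<bullet> (x - y) - 2 * k * ((x - y) \<bullet> e) + k * k"
    by (simp add: inner_diff_left inner_diff_right inner_unit inner_commute algebra_simps)
  also have "\<dots> = (norm (x - y))\<^sup>2 + 4 * (x \<bullet> e - l) * (y \<bullet> e - l)"
    by (simp add: power2_norm_eq_inner k_def inner_diff_left algebra_simps)
  finally show ?thesis .
qed

lemma norm_refl_plane_diff: "norm (refl_plane e l x - y) = norm (x - refl_plane e l y)"
proof -
  have "4 * (y \<bullet> e - l) * (x \<bullet> e - l) = 4 * (x \<bullet> e - l) * (y \<bullet> e - l)"
    by (simp add: algebra_simps)
  then have "(norm (refl_plane e l x - y))\<^sup>2 = (norm (refl_plane e l y - x))\<^sup>2"
    unfolding norm_refl_plane_diff_sq norm_minus_commute[of y x] by linarith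
  then show ?thesis
    by (simp add: norm_minus_commute)
qed

lemma norm_refl_plane_less:
  assumes "x \<bullet> e > l" "y \<bullet> e > l"
  shows "norm (x - y) < norm (refl_plane e l x - y)"
proof (rule power2_less_imp_less)
  show "(norm (x - y))\<^sup>2 < (norm (refl_plane e l x - y))\<^sup>2"
    using assms unfolding norm_refl_plane_diff_sq by simp
qed simp

lemma measurable_refl_plane [measurable]: "refl_plane e l \<in> borel_measurable borel"
  unfolding refl_plane_def by measurable

lemma refl_plane_eq: "refl_plane e l x = (2 * l) *\<^sub>R e + refl_plane e 0 x"
  by (simp add: refl_plane_def algebra_simps)

lemma refl_plane_linear: "linear (refl_plane e 0)" "norm (refl_plane e 0 x) = norm x"
proof -
  show "linear (refl_plane e 0)"
    by (rule linearI) (simp_all add: refl_plane_def inner_add_left algebra_simps)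
  have "(norm (refl_plane e 0 x))\<^sup>2 = (norm x)\<^sup>2"
    using norm_refl_plane_diff_sq[of 0 x 0] by simp
  then show "norm (refl_plane e 0 x) = norm x" by simp
qed

lemma nn_integral_refl_plane:
  fixes f :: "'a \<Rightarrow> ennreal"
  assumes [measurable]: "f \<in> borel_measurable borel"
  shows "(\<integral>\<^sup>+x. f (refl_plane e l x) \<partial>lborel) = (\<integral>\<^sup>+x. f x \<partial>lborel)"
proof -
  have "(\<integral>\<^sup>+x. f (refl_plane e l x) \<partial>lborel) = (\<integral>\<^sup>+x. f ((2 * l) *\<^sub>R e + refl_plane e 0 x) \<partial>lborel)"
    by (simp only: refl_plane_eq[symmetric])
  also have "\<dots> = (\<integral>\<^sup>+x. f ((2 * l) *\<^sub>R e + x) \<partial>lborel)"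
    by (rule nn_integral_lborel_isometry[OF refl_plane_linear, of "\<lambda>x. f ((2 * l) *\<^sub>R e + x)"]) measurable
  also have "\<dots> = (\<integral>\<^sup>+x. f x \<partial>lborel)"
    by (rule nn_integral_lborel_translation) measurable
  finally show ?thesis .
qed

lemma integral_refl_plane:
  fixes f :: "'a \<Rightarrow> real"
  assumes [measurable]: "f \<in> borel_measurable borel"
  shows "(\<integral>x. f (refl_plane e l x) \<partial>lborel) = (\<integral>x. f x \<partial>lborel)"
    and "integrable lborel (\<lambda>x. f (refl_plane e l x)) \<longleftrightarrow> integrable lborel f"
proof -
  have m: "(\<lambda>x. f ((2 * l) *\<^sub>R e + x)) \<in> borel_measurable borel"
    by measurable
  show "(\<integral>x. f (refl_plane e l x) \<partial>lborel) = (\<integral>x. f x \<partial>lborel)"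
    using integral_lborel_isometry(1)[OF refl_plane_linear m] integral_lborel_translation(1)[of f "(2 * l) *\<^sub>R e"]
    by (simp add: refl_plane_eq[symmetric])
  show "integrable lborel (\<lambda>x. f (refl_plane e l x)) \<longleftrightarrow> integrable lborel f"
    using integral_lborel_isometry(2)[OF refl_plane_linear m] integral_lborel_translation(2)[of f "(2 * l) *\<^sub>R e"]
    by (simp add: refl_plane_eq[symmetric])
qed

lemma AE_not_in_hyperplane: "AE y in lborel. y \<bullet> e \<noteq> l"
proof -
  have "negligible {y. e \<bullet> y = l}"
    using e by (intro negligible_hyperplane) auto
  then have "AE y in lebesgue. y \<notin> {y. e \<bullet> y = l}"
    unfolding negligible_iff_null_sets by (rule AE_not_in)
  then show ?thesis
    by (simp add: AE_completion_iff inner_commute)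
qed

end

text \<open>The integral equation with f abstracted away: \<open>F\<close> stands for f(U) and
  \<open>V\<close> for f'(U), monotonicity of f appears as \<open>F_mono\<close> and convexity as
  \<open>F_lip\<close>. \<open>V_int\<close> makes the potential small on shrinking sets;
  \<open>U_int\<close> gives the finiteness for \<open>bessel_kernel_contraction\<close> and rules
  out invariance under translations.\<close>

locale moving_planes =
  fixes \<sigma> \<mu> p B C :: real and U F V :: "'a::euclidean_space \<Rightarrow> real"
  assumes pos: "\<sigma> > 0" "\<mu> > 0" and p: "p > 1" "real DIM('a) / (2 * p) < \<sigma>"
    and cont: "continuous_on UNIV U" and U_nonneg: "\<And>x. U x \<ge> 0" and U_nontrivial: "\<exists>x. U x > 0"
    and F_meas [measurable]: "F \<in> borel_measurable borel" and F_bound: "\<And>x. \<bar>F x\<bar> \<le> B"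
    and eq: "\<And>x. U x = (\<integral>y. bessel_potential \<sigma> \<mu> (x - y) * F y \<partial>lborel)"
    and F_mono: "\<And>x y. U x \<le> U y \<Longrightarrow> F x \<le> F y"
    and F_lip: "\<And>x y. U x \<le> U y \<Longrightarrow> F y - F x \<le> V y * (U y - U x)"
    and V_meas [measurable]: "V \<in> borel_measurable borel" and V_nonneg: "\<And>x. V x \<ge> 0" and V_le: "\<And>x. V x \<le> C"
    and V_int: "(\<integral>\<^sup>+x. ennreal (V x powr p) \<partial>lborel) < \<infinity>"
    and U_int: "(\<integral>\<^sup>+x. ennreal ((U x)\<^sup>2) \<partial>lborel) < \<infinity>"
begin

abbreviation "G \<equiv> bessel_potential \<sigma> \<mu> :: 'a \<Rightarrow> real"

lemma U_meas [measurable]: "U \<in> borel_measurable borel"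
  by (rule borel_measurable_continuous_onI[OF cont])

definition below :: "'a \<Rightarrow> real \<Rightarrow> bool" where
  "below e l \<longleftrightarrow> (\<forall>x. x \<bullet> e \<ge> l \<longrightarrow> U x \<le> U (refl_plane e l x))"

definition bad :: "'a \<Rightarrow> real \<Rightarrow> 'a set" where
  "bad e l = {x. x \<bullet> e > l \<and> U x > U (refl_plane e l x)}"

lemma G_antimono:
  assumes e: "norm e = 1" and x: "x \<bullet> e > l" and y: "y \<bullet> e > l" "y \<noteq> x"
  shows "G (refl_plane e l x - y) < G (x - y)"
  by (rule bessel_potential_strict_antimono[OF pos]) (use y norm_refl_plane_less[OF e x y(1)] in auto)

lemma G_refl: "norm e = 1 \<Longrightarrow> G (refl_plane e l x - y) = G (x - refl_plane e l y)"
  by (intro bessel_potential_norm_cong norm_refl_plane_diff)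

text \<open>The difference of the two kernels is odd under reflection of y, so averaging the
  integral with its reflected form puts F(y) - F(R y) in place of F(y), with the factor 1/2. The
  integrand becomes even, so it suffices to estimate it on one side of the plane.\<close>

lemma U_refl_diff:
  fixes l :: real
  assumes e: "norm e = 1"
  defines "\<phi> \<equiv> \<lambda>x y. (G (x - y) - G (refl_plane e l x - y)) * (F y - F (refl_plane e l y))"
  shows "integrable lborel (\<phi> x)" "U x - U (refl_plane e l x) = (\<integral>y. \<phi> x y \<partial>lborel) / 2"
    and "\<phi> x (refl_plane e l y) = \<phi> x y"
proof -
  note [measurable] = measurable_refl_plane[OF e]
  define A where "A y = G (x - y) - G (refl_plane e l x - y)" for y
  have [measurable]: "A \<in> borel_measurable borel"
    unfolding A_def by measurable
  have A_refl: "A (refl_plane e l y) = - A y" for y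
    using G_refl[OF e, of l x y] G_refl[OF e, of l x "refl_plane e l y"] by (simp add: A_def refl_plane_involutive[OF e])
  have Fb: "\<bar>F (refl_plane e l y)\<bar> \<le> B" for y
    by (rule F_bound)
  have i1: "integrable lborel (\<lambda>y. A y * F y)" and i2: "integrable lborel (\<lambda>y. A y * F (refl_plane e l y))"
    unfolding A_def left_diff_distrib
    by (intro Bochner_Integration.integrable_diff integrable_bessel_potential_mult[OF pos _ F_bound] integrable_bessel_potential_mult[OF pos _ Fb]; simp)+
  have \<phi>: "\<phi> x = (\<lambda>y. A y * F y - A y * F (refl_plane e l y))"
    by (simp add: \<phi>_def A_def algebra_simps)
  show "integrable lborel (\<phi> x)"
    unfolding \<phi> by (intro Bochner_Integration.integrable_diff i1 i2)
  have "(\<integral>y. A y * F y \<partial>lborel) = U x - U (refl_plane e l x)"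
    unfolding A_def left_diff_distrib eq[of x] eq[of "refl_plane e l x"]
    by (intro Bochner_Integration.integral_diff integrable_bessel_potential_mult[OF pos _ F_bound]) simp_all
  moreover have "(\<integral>y. A y * F y \<partial>lborel) = (\<integral>y. A (refl_plane e l y) * F (refl_plane e l y) \<partial>lborel)"
    by (rule integral_refl_plane(1)[OF e, symmetric]) measurable
  ultimately show "U x - U (refl_plane e l x) = (\<integral>y. \<phi> x y \<partial>lborel) / 2"
    unfolding \<phi> by (simp add: A_refl i1 i2)
  show "\<phi> x (refl_plane e l y) = \<phi> x y"
    unfolding \<phi> by (simp add: A_refl refl_plane_involutive[OF e])
qed

text \<open>On the set where the comparison fails, the difference is a subsolution with potential \<open>V\<close>;
  it vanishes as soon as \<open>V\<close> is small there in \<open>L\<^sup>p\<close>.\<close>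

lemma below_of_small:
  "\<exists>\<eta>>0. \<forall>e l. norm e = 1 \<longrightarrow> (\<integral>\<^sup>+x. ennreal ((V x * indicator (bad e l) x) powr p) \<partial>lborel) \<le> ennreal \<eta> \<longrightarrow> below e l"
proof -
  obtain \<eta> where \<eta>: "\<eta> > 0" and small: "\<And>W x. W \<in> borel_measurable borel \<Longrightarrow> (\<And>y. 0 \<le> W y) \<Longrightarrow>
    (\<integral>\<^sup>+y. ennreal (W y powr p) \<partial>lborel) \<le> ennreal \<eta> \<Longrightarrow>
    (\<integral>\<^sup>+y. ennreal (W y) * bessel_kernel \<sigma> \<mu> (x - y :: 'a) \<partial>lborel) \<le> ennreal (1 / 2)"
    using bessel_kernel_potential_small[OF pos p] by blast
  have "below e l" if e: "norm e = 1" and le: "(\<integral>\<^sup>+x. ennreal ((V x * indicator (bad e l) x) powr p) \<partial>lborel) \<le> ennreal \<eta>" for e l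
  proof -
    note [measurable] = measurable_refl_plane[OF e]
    define R where "R = refl_plane e l"
    have R_R: "R (R x) = x" for x by (simp add: R_def refl_plane_involutive[OF e])
    have R_e: "R x \<bullet> e = 2 * l - x \<bullet> e" for x by (simp add: R_def refl_plane_inner[OF e])
    have [measurable]: "R \<in> borel_measurable borel" unfolding R_def by measurable
    have [measurable]: "bad e l \<in> sets borel"
      unfolding bad_def by measurable
    define W where "W x = V x * indicator (bad e l) x" for x
    define z where "z x = (if x \<bullet> e > l then max 0 (U x - U (R x)) else 0)" for x
    have [measurable]: "W \<in> borel_measurable borel"
      unfolding W_def by measurable
    have [measurable]: "z \<in> borel_measurable borel"
      unfolding z_def by measurable
    have W_nn: "W x \<ge> 0" for x by (simp add: W_def V_nonneg)
    have z_nn: "z x \<ge> 0" for x by (simp add: z_def)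
    have Wz_nn: "W x * z x \<ge> 0" for x by (intro mult_nonneg_nonneg W_nn z_nn)
    have W_small: "(\<integral>\<^sup>+y. ennreal (W y) * bessel_kernel \<sigma> \<mu> (x - y) \<partial>lborel) \<le> ennreal (1 / 2)" for x
      by (rule small) (use le W_nn in \<open>simp_all add: W_def\<close>)
    define J where "J x = (\<integral>\<^sup>+y. ennreal (W y * z y) * bessel_kernel \<sigma> \<mu> (x - y) \<partial>lborel)" for x
    have z_le: "ennreal (z x) \<le> J x" for x
    proof (cases "x \<bullet> e > l")
      case x: True
      define \<phi> where "\<phi> y = (G (x - y) - G (R x - y)) * (F y - F (R y))" for y
      have \<phi>: "integrable lborel \<phi>" "U x - U (R x) = (\<integral>y. \<phi> y \<partial>lborel) / 2" "\<phi> (R y) = \<phi> y" for y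
        using U_refl_diff[OF e, of x l] unfolding \<phi>_def[abs_def] R_def by auto
      have [measurable]: "\<phi> \<in> borel_measurable borel"
        unfolding \<phi>_def by measurable
      define \<psi> where "\<psi> y = W y * z y * G (x - y)" for y
      have [measurable]: "\<psi> \<in> borel_measurable borel"
        unfolding \<psi>_def by measurable
      have \<psi>_nn: "\<psi> y \<ge> 0" for y
        unfolding \<psi>_def by (intro mult_nonneg_nonneg Wz_nn bessel_potential_nonneg)
      \<comment> \<open>On the bad set \<open>F_lip\<close> bounds the difference of F, and the
        subtracted kernel is dropped. Off the bad set \<open>F_mono\<close> makes the product
        nonpositive.\<close>
      have half: "\<phi> y \<le> \<psi> y" if y: "y \<bullet> e > l" "y \<noteq> x" for y
      proof -
        have G_less: "G (R x - y) < G (x - y)"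
          unfolding R_def by (rule G_antimono[OF e x y])
        show ?thesis
        proof (cases "U (R y) < U y")
          case True
          then have "y \<in> bad e l" using y by (simp add: bad_def R_def)
          then have "F y - F (R y) \<le> W y * z y"
            using F_lip[of "R y" y] True y by (simp add: W_def z_def)
          then have "\<phi> y \<le> (G (x - y) - G (R x - y)) * (W y * z y)"
            unfolding \<phi>_def using G_less by (intro mult_left_mono) auto
          also have "\<dots> \<le> G (x - y) * (W y * z y)"
            by (intro mult_right_mono Wz_nn) simp
          finally show ?thesis
            by (simp add: \<psi>_def mult.commute)
        next
          case False
          then have "F y - F (R y) \<le> 0"
            using F_mono[of y "R y"] by simp
          then have "\<phi> y \<le> 0"
            unfolding \<phi>_def using G_less by (intro mult_nonneg_nonpos) auto
          then show ?thesis using \<psi>_nn[of y] by simp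
        qed
      qed
      \<comment> \<open>Evenness of \<phi> transfers the bound to the other side of the plane
        through \<open>R\<close>. The two resulting copies of \<open>J x\<close> cancel the factor
        1/2 in \<open>U_refl_diff\<close>.\<close>
      have AE_le: "AE y in lborel. \<phi> y \<le> \<psi> y + \<psi> (R y)"
        using AE_lborel_singleton[of x] AE_lborel_singleton[of "R x"]
      proof eventually_elim
        case (elim y)
        have "R y \<noteq> x" using elim R_R by metis
        consider "y \<bullet> e > l" | "y \<bullet> e < l" | "y \<bullet> e = l" by linarith
        then show ?case
        proof cases
          case 1
          then show ?thesis using half[of y] elim \<psi>_nn[of "R y"] by simp
        next
          case 2
          then have "R y \<bullet> e > l" by (simp add: R_e)
          then have "\<phi> (R y) \<le> \<psi> (R y)" using half[of "R y"] \<open>R y \<noteq> x\<close> by simp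
          then show ?thesis using \<phi>(3)[of y] \<psi>_nn[of y] by simp
        next
          case 3
          then have "R y = y" by (simp add: R_def refl_plane_def)
          then show ?thesis using \<psi>_nn[of y] by (simp add: \<phi>_def)
        qed
      qed
      have \<psi>_J: "(\<integral>\<^sup>+y. ennreal (\<psi> y) \<partial>lborel) = J x"
        unfolding J_def \<psi>_def using nn_integral_bessel_potential[OF pos, of "\<lambda>y. ennreal (W y * z y)" x] Wz_nn
        by (simp add: ennreal_mult)
      have "ennreal (\<integral>y. \<phi> y \<partial>lborel) \<le> (\<integral>\<^sup>+y. ennreal (\<phi> y) \<partial>lborel)"
      proof -
        have "(\<integral>y. \<phi> y \<partial>lborel) \<le> (\<integral>y. max 0 (\<phi> y) \<partial>lborel)"
          using \<phi>(1) by (intro integral_mono) auto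
        then have "ennreal (\<integral>y. \<phi> y \<partial>lborel) \<le> ennreal (\<integral>y. max 0 (\<phi> y) \<partial>lborel)"
          by (rule ennreal_leI)
        also have "\<dots> = (\<integral>\<^sup>+y. ennreal (max 0 (\<phi> y)) \<partial>lborel)"
          using \<phi>(1) by (intro nn_integral_eq_integral[symmetric]) auto
        also have "\<dots> = (\<integral>\<^sup>+y. ennreal (\<phi> y) \<partial>lborel)"
          by (intro nn_integral_cong) (auto simp: max_def ennreal_neg)
        finally show ?thesis .
      qed
      also have "\<dots> \<le> (\<integral>\<^sup>+y. ennreal (\<psi> y) + ennreal (\<psi> (R y)) \<partial>lborel)"
        using AE_le by (intro nn_integral_mono_AE) (auto simp: \<psi>_nn ennreal_leI simp flip: ennreal_plus)
      also have "\<dots> = J x + (\<integral>\<^sup>+y. ennreal (\<psi> (R y)) \<partial>lborel)"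
        by (simp add: nn_integral_add \<psi>_J)
      also have "(\<integral>\<^sup>+y. ennreal (\<psi> (R y)) \<partial>lborel) = J x"
        unfolding R_def using nn_integral_refl_plane[OF e, of "\<lambda>y. ennreal (\<psi> y)" l] by (simp add: \<psi>_J)
      finally have J2: "ennreal (\<integral>y. \<phi> y \<partial>lborel) \<le> J x + J x" .
      show ?thesis
      proof (cases "J x = \<infinity>")
        case False
        then obtain j where j: "J x = ennreal j" "j \<ge> 0"
          by (cases "J x") auto
        then have "(\<integral>y. \<phi> y \<partial>lborel) \<le> j + j"
          using J2 by (simp add: ennreal_le_iff flip: ennreal_plus)
        then have "z x \<le> j"
          using \<phi>(2) j x by (auto simp: z_def)
        then show ?thesis using j by (simp add: ennreal_leI)
      qed simp
    qed (simp add: z_def)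
    have "(\<integral>\<^sup>+x. ennreal (W x * (z x)\<^sup>2) \<partial>lborel) < \<infinity>"
    proof -
      have C0: "C \<ge> 0" using order_trans[OF V_nonneg V_le] .
      have "W x * (z x)\<^sup>2 \<le> C * (U x)\<^sup>2" for x
      proof (rule mult_mono)
        show "W x \<le> C"
          using V_le[of x] C0 by (simp add: W_def indicator_def)
        show "(z x)\<^sup>2 \<le> (U x)\<^sup>2"
          using U_nonneg[of x] U_nonneg[of "R x"] by (intro power_mono) (auto simp: z_def)
      qed (use C0 in auto)
      then have "(\<integral>\<^sup>+x. ennreal (W x * (z x)\<^sup>2) \<partial>lborel) \<le> (\<integral>\<^sup>+x. ennreal C * ennreal ((U x)\<^sup>2) \<partial>lborel)"
        using C0 by (intro nn_integral_mono) (simp add: ennreal_leI flip: ennreal_mult)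
      also have "\<dots> < \<infinity>"
        using U_int by (simp add: nn_integral_cmult ennreal_mult_less_top)
      finally show ?thesis .
    qed
    then have J0: "J x = 0" for x
      unfolding J_def using z_le unfolding J_def
      by (intro bessel_kernel_contraction(1)[OF pos _ _ W_nn z_nn W_small]) auto
    have "U x \<le> U (refl_plane e l x)" if "x \<bullet> e \<ge> l" for x
    proof (cases "x \<bullet> e = l")
      case True
      then show ?thesis by (simp add: refl_plane_def)
    next
      case False
      have "ennreal (z x) \<le> 0" using z_le[of x] by (simp only: J0)
      then have "z x \<le> 0" by (metis ennreal_eq_0_iff le_zero_eq)
      then show ?thesis using False that by (simp add: z_def R_def max_def split: if_splits)
    qed
    then show ?thesis by (simp add: below_def)
  qed
  then show ?thesis using \<eta> by blast
qed

text \<open>Dominated convergence with majorant V^p, followed by \<open>below_of_small\<close>. The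
  hypothesis holds both for planes moving off to infinity, which leave every point behind, and for
  planes approaching one at which the comparison is strict; so the start and the continuation of the
  method share this lemma.\<close>

lemma below_eventually:
  assumes e: "norm e = 1" and lim: "AE x in lborel. \<forall>\<^sub>F n in sequentially. x \<notin> bad e (l n)"
  shows "\<exists>n. below e (l n)"
proof -
  note [measurable] = measurable_refl_plane[OF e]
  obtain \<eta> where \<eta>: "\<eta> > 0" and small: "\<And>l. (\<integral>\<^sup>+x. ennreal ((V x * indicator (bad e l) x) powr p) \<partial>lborel) \<le> ennreal \<eta> \<Longrightarrow> below e l"
    using below_of_small e by blast
  have [measurable]: "bad e l \<in> sets borel" for l
    unfolding bad_def by measurable
  have "(\<lambda>n. \<integral>\<^sup>+x. ennreal ((V x * indicator (bad e (l n)) x) powr p) \<partial>lborel) \<longlonglongrightarrow> (\<integral>\<^sup>+x. 0 \<partial>(lborel :: 'a measure))"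
  proof (rule nn_integral_dominated_convergence[where w="\<lambda>x. ennreal (V x powr p)"])
    show "AE x in lborel. (\<lambda>n. ennreal ((V x * indicator (bad e (l n)) x) powr p)) \<longlonglongrightarrow> 0"
      using lim
    proof eventually_elim
      case (elim x)
      then have "\<forall>\<^sub>F n in sequentially. ennreal ((V x * indicator (bad e (l n)) x) powr p) = 0"
        by eventually_elim simp
      then show ?case by (rule tendsto_eventually)
    qed
  qed (use V_int in \<open>auto simp: indicator_def\<close>)
  then have "(\<lambda>n. \<integral>\<^sup>+x. ennreal ((V x * indicator (bad e (l n)) x) powr p) \<partial>lborel) \<longlonglongrightarrow> 0"
    by simp
  then have "\<forall>\<^sub>F n in sequentially. (\<integral>\<^sup>+x. ennreal ((V x * indicator (bad e (l n)) x) powr p) \<partial>lborel) < ennreal \<eta>"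
    by (rule order_tendstoD(2)) (use \<eta> in simp)
  then obtain n where "(\<integral>\<^sup>+x. ennreal ((V x * indicator (bad e (l n)) x) powr p) \<partial>lborel) < ennreal \<eta>"
    by (auto simp: eventually_sequentially)
  then show ?thesis
    using small[of "l n"] by (auto simp: less_imp_le)
qed

text \<open>A strong maximum principle. Equality at one point beyond the plane means that an
  integrand of constant sign has integral zero; as the kernel difference is strict, F agrees with
  its reflection almost everywhere, and the integral formula then makes U symmetric. The detour
  through F is due to f being merely nondecreasing.\<close>

lemma below_dichotomy:
  assumes e: "norm e = 1" and b: "below e l"
  shows "(\<forall>x. U (refl_plane e l x) = U x) \<or> (\<forall>x. x \<bullet> e > l \<longrightarrow> U x < U (refl_plane e l x))"
proof (rule disjCI)
  assume "\<not> (\<forall>x. x \<bullet> e > l \<longrightarrow> U x < U (refl_plane e l x))"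
  then obtain x where x: "x \<bullet> e > l" "U x \<ge> U (refl_plane e l x)"
    by (auto simp: not_less)
  then have Ux: "U x - U (refl_plane e l x) = 0"
    using b by (auto simp: below_def intro!: antisym)
  define R where "R = refl_plane e l"
  have R_R: "R (R x) = x" for x by (simp add: R_def refl_plane_involutive[OF e])
  have R_e: "R x \<bullet> e = 2 * l - x \<bullet> e" for x by (simp add: R_def refl_plane_inner[OF e])
  have below_R: "U y \<le> U (R y)" if "y \<bullet> e > l" for y
    using b that by (simp add: below_def R_def)
  define \<phi> where "\<phi> x y = (G (x - y) - G (R x - y)) * (F y - F (R y))" for x y
  have \<phi>: "integrable lborel (\<phi> w)" "U w - U (R w) = (\<integral>y. \<phi> w y \<partial>lborel) / 2" "\<phi> w (R y) = \<phi> w y" for w y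
    using U_refl_diff[OF e, of w l] unfolding \<phi>_def[abs_def] R_def by auto
  have sgn: "\<phi> x y \<le> 0 \<and> (\<phi> x y = 0 \<longrightarrow> F y = F (R y))" if y: "y \<bullet> e > l" "y \<noteq> x" for y
  proof -
    have "G (R x - y) < G (x - y)"
      unfolding R_def by (rule G_antimono[OF e x(1) y])
    moreover have "F y \<le> F (R y)"
      by (rule F_mono[OF below_R[OF y(1)]])
    ultimately show ?thesis
      by (auto simp: \<phi>_def mult_nonneg_nonpos)
  qed
  have sgn_AE: "AE y in lborel. \<phi> x y \<le> 0 \<and> (\<phi> x y = 0 \<longrightarrow> F y = F (R y))"
    using AE_lborel_singleton[of x] AE_lborel_singleton[of "R x"] AE_not_in_hyperplane[OF e, of l]
  proof eventually_elim
    case (elim y)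
    have "R y \<noteq> x" using elim R_R by metis
    show ?case
    proof (cases "y \<bullet> e > l")
      case True
      then show ?thesis using sgn elim by simp
    next
      case False
      then have "R y \<bullet> e > l" using elim by (simp add: R_e)
      then show ?thesis
        using sgn[of "R y"] \<open>R y \<noteq> x\<close> \<phi>(3)[of x y] by (auto simp: R_R)
    qed
  qed
  have int0: "(\<integral>y. - \<phi> x y \<partial>lborel) = 0"
    using \<phi>(2)[of x] Ux by (simp add: R_def)
  have "AE y in lborel. - \<phi> x y = 0"
  proof (subst integral_nonneg_eq_0_iff_AE[symmetric])
    show "integrable lborel (\<lambda>y. - \<phi> x y)"
      using \<phi>(1)[of x] by simp
    show "AE y in lborel. 0 \<le> - \<phi> x y"
      using sgn_AE by eventually_elim simp
  qed (rule int0)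
  then have F_eq: "AE y in lborel. F y = F (R y)"
    using sgn_AE by eventually_elim simp
  have "U w - U (R w) = 0" for w
  proof -
    have "AE y in lborel. \<phi> w y = 0"
      using F_eq by eventually_elim (simp add: \<phi>_def)
    then have "(\<integral>y. \<phi> w y \<partial>lborel) = 0"
      by (rule integral_eq_zero_AE)
    then show ?thesis
      by (simp add: \<phi>(2))
  qed
  then show "\<forall>x. U (refl_plane e l x) = U x"
    by (simp add: R_def)
qed

text \<open>Iterating the inequality bounds the integral of U^2 over a half space by integrals over
  half spaces receding to infinity, which tend to 0. Invariance under a translation is the case of
  equality.\<close>

lemma not_nonincreasing:
  assumes v: "v \<noteq> 0" and le: "\<And>x. U x \<le> U (x - v)"
  shows False
proof -
  define I where "I c = (\<integral>\<^sup>+x. ennreal ((U x)\<^sup>2) * indicator {x. x \<bullet> v \<le> c} x \<partial>lborel)" for c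
  have step: "I c \<le> I (c - v \<bullet> v)" for c
  proof -
    have "I c \<le> (\<integral>\<^sup>+x. ennreal ((U (x - v))\<^sup>2) * indicator {x. x \<bullet> v \<le> c - v \<bullet> v} (x - v) \<partial>lborel)"
      unfolding I_def
    proof (rule nn_integral_mono)
      fix x
      have "(U x)\<^sup>2 \<le> (U (x - v))\<^sup>2"
        by (intro power_mono le U_nonneg)
      then show "ennreal ((U x)\<^sup>2) * indicator {x. x \<bullet> v \<le> c} x \<le> ennreal ((U (x - v))\<^sup>2) * indicator {x. x \<bullet> v \<le> c - v \<bullet> v} (x - v)"
        by (auto simp: indicator_def inner_diff_left ennreal_leI)
    qed
    also have "\<dots> = I (c - v \<bullet> v)"
      unfolding I_def
      by (rule nn_integral_lborel_translation_diff(1)[of "\<lambda>x. ennreal ((U x)\<^sup>2) * indicator {x. x \<bullet> v \<le> c - v \<bullet> v} x"]) measurable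
    finally show ?thesis .
  qed
  have iter: "I c \<le> I (c - real n * (v \<bullet> v))" for c n
  proof (induction n)
    case (Suc n)
    then have "I c \<le> I (c - real n * (v \<bullet> v) - v \<bullet> v)"
      using step order_trans by blast
    then show ?case by (simp add: algebra_simps)
  qed simp
  have I0: "I c = 0" for c
  proof -
    have "(\<lambda>n. I (c - real n * (v \<bullet> v))) \<longlonglongrightarrow> (\<integral>\<^sup>+x. 0 \<partial>(lborel :: 'a measure))"
      unfolding I_def
    proof (rule nn_integral_dominated_convergence[where w="\<lambda>x. ennreal ((U x)\<^sup>2)"])
      show "AE x in lborel. (\<lambda>n. ennreal ((U x)\<^sup>2) * indicator {x. x \<bullet> v \<le> c - real n * (v \<bullet> v)} x) \<longlonglongrightarrow> 0"
      proof (rule AE_I2)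
        fix x
        have "filterlim (\<lambda>n. (v \<bullet> v) * real n) at_top sequentially"
          using v by (intro filterlim_tendsto_pos_mult_at_top[OF tendsto_const] filterlim_real_sequentially) simp
        then have "\<forall>\<^sub>F n in sequentially. c - x \<bullet> v < (v \<bullet> v) * real n"
          by (simp add: filterlim_at_top_dense)
        then have "\<forall>\<^sub>F n in sequentially. ennreal ((U x)\<^sup>2) * indicator {x. x \<bullet> v \<le> c - real n * (v \<bullet> v)} x = 0"
          by eventually_elim (simp add: mult.commute)
        then show "(\<lambda>n. ennreal ((U x)\<^sup>2) * indicator {x. x \<bullet> v \<le> c - real n * (v \<bullet> v)} x) \<longlonglongrightarrow> 0"
          by (rule tendsto_eventually)
      qed
    qed (use U_int in \<open>auto simp: indicator_def\<close>)
    then have "(\<lambda>n. I (c - real n * (v \<bullet> v))) \<longlonglongrightarrow> 0"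
      by simp
    then have "I c \<le> 0"
      by (rule LIMSEQ_le_const) (use iter in auto)
    then show ?thesis by simp
  qed
  \<comment> \<open>The half space at level x0 \<bullet> v + |v| contains the unit ball about
    \<open>x0\<close>, and by continuity U is positive on a nonempty open part of that ball.\<close>
  obtain x0 where x0: "U x0 > 0" using U_nontrivial by blast
  have zero: "AE x in lborel. ennreal ((U x)\<^sup>2) * indicator {x. x \<bullet> v \<le> x0 \<bullet> v + norm v} x = 0"
    using I0[of "x0 \<bullet> v + norm v"] unfolding I_def by (subst (asm) nn_integral_0_iff_AE) auto
  have near: "x \<bullet> v \<le> x0 \<bullet> v + norm v" if "x \<in> ball x0 1" for x
  proof -
    have "(x - x0) \<bullet> v \<le> norm (x - x0) * norm v"
      by (rule norm_cauchy_schwarz)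
    also have "\<dots> \<le> 1 * norm v"
      using that by (intro mult_right_mono) (auto simp: dist_norm norm_minus_commute)
    finally show ?thesis by (simp add: inner_diff_left)
  qed
  have "AE x in lborel. x \<notin> ball x0 1 \<inter> {x. U x > 0}"
    using zero
  proof eventually_elim
    case (elim x)
    then show ?case using near[of x] by (auto simp: indicator_def split: if_splits)
  qed
  moreover have op: "open (ball x0 1 \<inter> {x. U x > 0})"
    by (intro open_Int open_ball open_Collect_less continuous_on_const cont)
  ultimately have "ball x0 1 \<inter> {x. U x > 0} \<in> null_sets lborel"
    by (subst (asm) AE_iff_null_sets[symmetric]) auto
  then have "negligible (ball x0 1 \<inter> {x. U x > 0})"
    by (simp add: negligible_iff_null_sets null_sets_completionI)
  moreover have "x0 \<in> ball x0 1 \<inter> {x. U x > 0}"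
    using x0 by simp
  ultimately show False
    using open_not_negligible[OF op] by blast
qed

text \<open>The planes come down from infinity to the infimum \<open>l0\<close> of the admissible
  levels. If U were not symmetric there, the comparison at \<open>l0\<close> would be strict, and
  the bad sets of levels increasing to \<open>l0\<close> would shrink to a null set; the comparison
  would then hold at a level where it is known to fail.\<close>

lemma symmetric_plane:
  assumes e: "norm e = 1"
  shows "\<exists>l0. (\<forall>x. U (refl_plane e l0 x) = U x) \<and> (\<forall>l>l0. \<forall>x. x \<bullet> e > l \<longrightarrow> U x < U (refl_plane e l x))"
proof -
  have refl_lim: "(\<lambda>n. U (refl_plane e (L n) x)) \<longlonglongrightarrow> U (refl_plane e l x)" if "L \<longlonglongrightarrow> l" for L l x
  proof -
    have "(\<lambda>n. refl_plane e (L n) x) \<longlonglongrightarrow> refl_plane e l x"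
      unfolding refl_plane_def by (intro tendsto_intros that)
    then show ?thesis
      by (rule continuous_on_tendsto_compose[OF cont]) simp_all
  qed
  \<comment> \<open>Comparison is demanded at all higher levels too, so that every level above the
    infimum is covered.\<close>
  define S where "S = {l. \<forall>k\<ge>l. below e k}"
  have "S \<noteq> {}"
  proof
    assume "S = {}"
    then have "\<forall>n::nat. \<exists>k\<ge>real n. \<not> below e k"
      by (auto simp: S_def)
    then obtain L where L: "\<And>n. L n \<ge> real n" "\<And>n. \<not> below e (L n)"
      by metis
    have "\<forall>\<^sub>F n in sequentially. x \<notin> bad e (L n)" for x
    proof -
      have "\<forall>\<^sub>F n in sequentially. x \<bullet> e \<le> real n"
        using filterlim_real_sequentially by (simp add: filterlim_at_top)
      then show ?thesis
      proof eventually_elim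
        case (elim n)
        then show ?case using L(1)[of n] by (auto simp: bad_def)
      qed
    qed
    then show False
      using below_eventually[OF e, of L] L(2) by auto
  qed
  have up: "k \<in> S" if "l \<in> S" "k \<ge> l" for l k
    using that by (auto simp: S_def)
  have "bdd_below S"
  proof (rule ccontr)
    assume nb: "\<not> bdd_below S"
    have all: "below e l" for l
    proof -
      obtain k where "k \<in> S" "k < l"
        using nb by (auto simp: bdd_below_def not_le)
      then show ?thesis using up[of k l] by (auto simp: S_def)
    qed
    \<comment> \<open>Reflection in the plane at level x \<bullet> e - 1/2 sends x to x - e.\<close>
    have "U x \<le> U (x - e)" for x
      using all[of "x \<bullet> e - 1 / 2"] unfolding below_def by (auto simp: refl_plane_def dest!: spec[of _ x])
    moreover have "e \<noteq> 0" using e by auto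
    ultimately show False
      using not_nonincreasing[of e] by blast
  qed
  define l0 where "l0 = Inf S"
  have above: "below e l" if "l > l0" for l
  proof -
    have "Inf S < l" using that by (simp only: l0_def)
    then obtain k where "k \<in> S" "k < l"
      using cInf_lessD[OF \<open>S \<noteq> {}\<close>] by blast
    then show ?thesis by (auto simp: S_def)
  qed
  have below0: "below e l0"
    unfolding below_def
  proof (intro allI impI)
    fix x assume x: "x \<bullet> e \<ge> l0"
    show "U x \<le> U (refl_plane e l0 x)"
    proof (cases "x \<bullet> e = l0")
      case True
      then show ?thesis by (simp add: refl_plane_def)
    next
      case False
      define L where "L n = l0 + (x \<bullet> e - l0) * (1 / real (Suc n))" for n
      have "L \<longlonglongrightarrow> l0 + (x \<bullet> e - l0) * 0"
        unfolding L_def by (intro tendsto_intros LIMSEQ_inverse_real_of_nat[unfolded inverse_eq_divide])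
      then have L: "L \<longlonglongrightarrow> l0" by simp
      have "U x \<le> U (refl_plane e (L n) x)" for n
      proof -
        have "L n > l0"
          using False x by (simp add: L_def)
        moreover have "L n \<le> x \<bullet> e"
        proof -
          have "(x \<bullet> e - l0) * (1 / real (Suc n)) \<le> (x \<bullet> e - l0) * 1"
            using x by (intro mult_left_mono) auto
          then show ?thesis by (simp add: L_def)
        qed
        ultimately show ?thesis
          using above[of "L n"] by (simp add: below_def)
      qed
      then show ?thesis
        by (intro LIMSEQ_le_const[OF refl_lim[OF L]]) auto
    qed
  qed
  have sym: "\<forall>x. U (refl_plane e l0 x) = U x"
  proof (rule ccontr)
    assume "\<not> (\<forall>x. U (refl_plane e l0 x) = U x)"
    then have strict: "\<And>x. x \<bullet> e > l0 \<Longrightarrow> U x < U (refl_plane e l0 x)"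
      using below_dichotomy[OF e below0] by blast
    have "\<exists>k. l0 - 1 / real (Suc n) \<le> k \<and> k < l0 \<and> \<not> below e k" for n
    proof -
      have "l0 - 1 / real (Suc n) \<notin> S"
        using cInf_lower[OF _ \<open>bdd_below S\<close>, of "l0 - 1 / real (Suc n)"] by (auto simp: l0_def[symmetric])
      then obtain k where k: "k \<ge> l0 - 1 / real (Suc n)" "\<not> below e k"
        unfolding S_def by blast
      have "k < l0"
      proof (cases k l0 rule: linorder_cases)
        case equal
        then show ?thesis using k below0 by simp
      next
        case greater
        then show ?thesis using k above[of k] by simp
      qed
      then show ?thesis using k by blast
    qed
    then obtain L where L: "\<And>n. l0 - 1 / real (Suc n) \<le> L n" "\<And>n. L n < l0" "\<And>n. \<not> below e (L n)"
      by metis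
    have "(\<lambda>n. l0 - 1 / real (Suc n)) \<longlonglongrightarrow> l0 - 0"
      by (intro tendsto_intros LIMSEQ_inverse_real_of_nat[unfolded inverse_eq_divide])
    then have low: "(\<lambda>n. l0 - 1 / real (Suc n)) \<longlonglongrightarrow> l0"
      by simp
    have L_lim: "L \<longlonglongrightarrow> l0"
      by (rule tendsto_sandwich[OF always_eventually always_eventually low tendsto_const])
         (simp_all only: L(1) less_imp_le[OF L(2)] simp_thms)
    \<comment> \<open>For points beyond the limiting plane, strictness persists nearby by continuity
      in the level; points before it are eventually before the plane at \<open>L n\<close>. Only the
      limiting plane itself is left out.\<close>
    have "AE x in lborel. \<forall>\<^sub>F n in sequentially. x \<notin> bad e (L n)"
      using AE_not_in_hyperplane[OF e, of l0]
    proof eventually_elim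
      case (elim x)
      show ?case
      proof (cases "x \<bullet> e > l0")
        case True
        have "\<forall>\<^sub>F n in sequentially. U x < U (refl_plane e (L n) x)"
          by (rule order_tendstoD(1)[OF refl_lim[OF L_lim]]) (rule strict[OF True])
        then show ?thesis
          by eventually_elim (simp add: bad_def)
      next
        case False
        then have "x \<bullet> e < l0" using elim by simp
        then have "\<forall>\<^sub>F n in sequentially. x \<bullet> e < L n"
          by (rule order_tendstoD(1)[OF L_lim])
        then show ?thesis
          by eventually_elim (simp add: bad_def)
      qed
    qed
    then show False
      using below_eventually[OF e, of L] L(3) by auto
  qed
  \<comment> \<open>Equality at one point would make the plane at level \<open>l\<close> a second
    plane of symmetry, parallel to the one at \<open>l0\<close>.\<close>
  have "U x < U (refl_plane e l x)" if l: "l > l0" and x: "x \<bullet> e > l" for l x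
  proof (rule ccontr)
    assume "\<not> U x < U (refl_plane e l x)"
    then have sym': "\<forall>x. U (refl_plane e l x) = U x"
      using below_dichotomy[OF e above[OF l]] x by blast
    have "U y \<le> U (y - (2 * (l - l0)) *\<^sub>R e)" for y
    proof -
      have "refl_plane e l0 (refl_plane e l y) = y - (2 * (l - l0)) *\<^sub>R e"
        by (rule refl_plane_compose[OF e])
      then have "U (y - (2 * (l - l0)) *\<^sub>R e) = U y"
        using sym sym' by metis
      then show ?thesis by simp
    qed
    moreover have "(2 * (l - l0)) *\<^sub>R e \<noteq> 0"
      using l e by auto
    ultimately show False
      using not_nonincreasing by blast
  qed
  then show ?thesis
    using sym by blast
qed

text \<open>The planes of symmetry for different directions are found independently. What ties them
  together is a point symmetry, obtained from the coordinate directions: it maps planes of symmetry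
  to planes of symmetry. Strict decrease along a ray comes from the strict comparison at planes
  beyond the centre.\<close>

theorem radial:
  "\<exists>a g. (\<forall>r t. 0 \<le> r \<and> r < t \<longrightarrow> g t < (g r :: real)) \<and> (\<forall>x. U (x + a) = g (norm x))"
proof -
  obtain l0 where l0: "\<And>e x. norm e = 1 \<Longrightarrow> U (refl_plane e (l0 e) x) = U x"
    and strict: "\<And>e l x. norm e = 1 \<Longrightarrow> l > l0 e \<Longrightarrow> x \<bullet> e > l \<Longrightarrow> U x < U (refl_plane e l x)"
  proof -
    have "\<forall>e. \<exists>l. norm e = 1 \<longrightarrow> (\<forall>x. U (refl_plane e l x) = U x) \<and> (\<forall>k>l. \<forall>x. x \<bullet> e > k \<longrightarrow> U x < U (refl_plane e k x))"
      using symmetric_plane by blast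
    then obtain l0 where "\<forall>e. norm e = 1 \<longrightarrow> (\<forall>x. U (refl_plane e (l0 e) x) = U x) \<and> (\<forall>k>l0 e. \<forall>x. x \<bullet> e > k \<longrightarrow> U x < U (refl_plane e k x))"
      by metis
    then show ?thesis using that[of l0] by blast
  qed
  have unique: "l = l'" if e: "norm e = 1" and l: "\<And>x. U (refl_plane e l x) = U x" and l': "\<And>x. U (refl_plane e l' x) = U x" for e l l'
  proof (rule ccontr)
    assume "l \<noteq> l'"
    have "U y \<le> U (y - (2 * (l - l')) *\<^sub>R e)" for y
    proof -
      have "refl_plane e l' (refl_plane e l y) = y - (2 * (l - l')) *\<^sub>R e"
        by (rule refl_plane_compose[OF e])
      then have "U (y - (2 * (l - l')) *\<^sub>R e) = U y"
        using l l' by metis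
      then show ?thesis by simp
    qed
    moreover have "(2 * (l - l')) *\<^sub>R e \<noteq> 0"
      using \<open>l \<noteq> l'\<close> e by auto
    ultimately show False
      using not_nonincreasing by blast
  qed
  \<comment> \<open>The common point of the planes of symmetry that are orthogonal to the coordinate
    axes.\<close>
  define a where "a = (\<Sum>b\<in>Basis. l0 b *\<^sub>R (b::'a))"
  have point: "U (2 *\<^sub>R a - x) = U x" for x
  proof -
    \<comment> \<open>One coordinate reflection after another; orthogonality of the basis leaves the
      remaining coordinates unchanged, so that the composition of all is the point symmetry.\<close>
    have "U (x - (\<Sum>b\<in>S. (2 * (x \<bullet> b - l0 b)) *\<^sub>R b)) = U x" if "S \<subseteq> Basis" for S
      using finite_subset[OF that finite_Basis] that
    proof (induction S rule: finite_induct)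
      case (insert c S)
      define y where "y = x - (\<Sum>b\<in>S. (2 * (x \<bullet> b - l0 b)) *\<^sub>R b)"
      have c: "c \<in> Basis" "norm c = 1" using insert by auto
      have "(\<Sum>b\<in>S. (2 * (x \<bullet> b - l0 b)) *\<^sub>R b) \<bullet> c = (\<Sum>b\<in>S. (2 * (x \<bullet> b - l0 b)) * (b \<bullet> c))"
        by (simp add: inner_sum_left)
      also have "\<dots> = 0"
      proof (rule sum.neutral, rule ballI)
        fix b assume "b \<in> S"
        then have "b \<bullet> c = 0"
          using insert c by (auto simp: inner_Basis)
        then show "2 * (x \<bullet> b - l0 b) * (b \<bullet> c) = 0" by simp
      qed
      finally have "y \<bullet> c = x \<bullet> c"
        by (simp add: y_def inner_diff_left)
      then have "refl_plane c (l0 c) y = x - (\<Sum>b\<in>insert c S. (2 * (x \<bullet> b - l0 b)) *\<^sub>R b)"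
        using insert by (simp add: refl_plane_def y_def algebra_simps)
      then have "U (x - (\<Sum>b\<in>insert c S. (2 * (x \<bullet> b - l0 b)) *\<^sub>R b)) = U y"
        using l0[OF c(2), of y] by simp
      then show ?case
        using insert by (simp add: y_def)
    qed simp
    from this[of Basis] have "U (x - (\<Sum>b\<in>Basis. (2 * (x \<bullet> b - l0 b)) *\<^sub>R b)) = U x"
      by simp
    also have "(\<Sum>b\<in>Basis. (2 * (x \<bullet> b - l0 b)) *\<^sub>R b) = 2 *\<^sub>R (\<Sum>b\<in>Basis. (x \<bullet> b) *\<^sub>R b) - 2 *\<^sub>R a"
      by (simp add: a_def scaleR_sum_right right_diff_distrib scaleR_diff_left sum_subtractf)
    also have "(\<Sum>b\<in>Basis. (x \<bullet> b) *\<^sub>R b) = x"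
      by (rule euclidean_representation)
    finally show ?thesis
      by (simp add: scaleR_2)
  qed
  have center: "l0 e = a \<bullet> e" if e: "norm e = 1" for e
  proof -
    \<comment> \<open>Conjugating the reflection with the point symmetry about \<open>a\<close>
      gives the reflection in the mirrored plane. By uniqueness the two planes coincide, hence
      contain \<open>a\<close>.\<close>
    have "U (refl_plane e (2 * (a \<bullet> e) - l0 e) x) = U x" for x
    proof -
      have "refl_plane e (2 * (a \<bullet> e) - l0 e) x = 2 *\<^sub>R a - refl_plane e (l0 e) (2 *\<^sub>R a - x)"
        by (simp add: refl_plane_def inner_diff_left algebra_simps)
      then show ?thesis
        using point[of "refl_plane e (l0 e) (2 *\<^sub>R a - x)"] l0[OF e, of "2 *\<^sub>R a - x"] point[of x] by simp
    qed
    then have "l0 e = 2 * (a \<bullet> e) - l0 e"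
      by (intro unique[OF e l0[OF e]])
    then show ?thesis by simp
  qed
  have radial: "U (x + a) = U (y + a)" if "norm x = norm y" for x y
  proof (cases "x = y")
    case False
    \<comment> \<open>Two points of equal norm are exchanged by reflection in the plane through the
      origin orthogonal to their difference. Shifted by \<open>a\<close>, this is the plane of
      symmetry in direction \<open>e\<close>, by \<open>center\<close>.\<close>
    define e where "e = (1 / norm (x - y)) *\<^sub>R (x - y)"
    have e: "norm e = 1" using False by (simp add: e_def)
    have "x \<bullet> x = y \<bullet> y"
      using that by (metis power2_norm_eq_inner)
    then have "2 * (x \<bullet> (x - y)) = (x - y) \<bullet> (x - y)"
      by (simp add: inner_diff_left inner_diff_right inner_commute[of y x])
    then have 1: "2 * (x \<bullet> e) = norm (x - y)"
      using False by (simp add: e_def flip: power2_norm_eq_inner) (simp add: power2_eq_square)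
    have "refl_plane e (l0 e) (x + a) = x + a - norm (x - y) *\<^sub>R e"
      unfolding center[OF e] refl_plane_def using 1 by (simp add: inner_add_left)
    also have "\<dots> = y + a"
      using False by (simp add: e_def)
    finally show ?thesis
      using l0[OF e, of "x + a"] by simp
  qed simp
  define b where "b = (SOME b. b \<in> (Basis :: 'a set))"
  have b: "norm b = 1"
    using someI_ex[of "\<lambda>b. b \<in> (Basis :: 'a set)"] nonempty_Basis unfolding b_def by auto
  define g where "g r = U (r *\<^sub>R b + a)" for r
  have "U (x + a) = g (norm x)" for x
    unfolding g_def by (rule radial) (use b in simp)
  moreover have "g t < g r" if "0 \<le> r" "r < t" for r t
  proof -
    \<comment> \<open>The plane midway between the radii r and t takes the outer point to the inner
      one. It lies beyond the centre because r + t > 0.\<close>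
    define l where "l = a \<bullet> b + (r + t) / 2"
    have "l > l0 b" using that by (simp add: l_def center[OF b])
    moreover have "(t *\<^sub>R b + a) \<bullet> b > l"
      using that by (simp add: l_def inner_add_left inner_unit[OF b])
    ultimately have "U (t *\<^sub>R b + a) < U (refl_plane b l (t *\<^sub>R b + a))"
      by (rule strict[OF b])
    moreover have "refl_plane b l (t *\<^sub>R b + a) = r *\<^sub>R b + a"
    proof -
      have "2 * ((t *\<^sub>R b + a) \<bullet> b - l) = t - r"
        by (simp add: l_def inner_add_left inner_unit[OF b] field_simps)
      then show ?thesis
        unfolding refl_plane_def by (simp only:) (simp add: algebra_simps)
    qed
    ultimately show ?thesis by (simp add: g_def)
  qed
  ultimately show ?thesis by blast
qed

end

section \<open>Calculus on the closed half line, and the final assembly\<close>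

lemma mvt_within_atLeast:
  fixes f f' :: "real \<Rightarrow> real"
  assumes der: "\<And>t. t \<ge> 0 \<Longrightarrow> (f has_real_derivative f' t) (at t within {0..})" and ab: "0 \<le> a" "a < b"
  shows "\<exists>\<xi>. a < \<xi> \<and> \<xi> < b \<and> f b - f a = f' \<xi> * (b - a)"
proof -
  have "continuous_on {0..} f"
    using der by (intro DERIV_continuous_on) auto
  then have cont: "continuous_on {a..b} f"
    by (rule continuous_on_subset) (use ab in auto)
  \<comment> \<open>The derivative is one-sided only at 0, which is never in the open interval (a,
    b).\<close>
  have "(f has_derivative (\<lambda>h. f' t * h)) (at t)" if "a < t" "t < b" for t
  proof -
    have "t \<in> interior {0..}" using that ab by (simp add: interior_real_atLeast)
    then have "at t within {0..} = at t"
      by (rule at_within_interior)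
    then show ?thesis
      using der[of t] that ab by (simp add: has_field_derivative_def)
  qed
  from mvt[OF ab(2) cont this] show ?thesis
    by (auto simp: mult.commute)
qed

lemma mono_on_of_derivative:
  fixes f f' :: "real \<Rightarrow> real"
  assumes der: "\<And>t. t \<ge> 0 \<Longrightarrow> (f has_real_derivative f' t) (at t within {0..})" and nn: "\<And>t. t \<ge> 0 \<Longrightarrow> f' t \<ge> 0"
    and ab: "0 \<le> a" "a \<le> b"
  shows "f a \<le> f b"
proof (cases "a = b")
  case False
  then obtain \<xi> where "a < \<xi>" "f b - f a = f' \<xi> * (b - a)"
    using mvt_within_atLeast[OF der ab(1), of b] ab by auto
  moreover have "f' \<xi> * (b - a) \<ge> 0"
    using nn[of \<xi>] calculation(1) ab by (intro mult_nonneg_nonneg) auto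
  ultimately show ?thesis by simp
qed simp

lemma AE_lborel_translation:
  assumes "AE x in lborel. P (x::'a::euclidean_space)"
  shows "AE x in lborel. P (c + x)"
proof -
  have "AE x in distr lborel borel ((+) c). P x"
    using assms by (simp only: lborel_distr_plus)
  then show ?thesis
    by (rule AE_distrD[rotated]) simp
qed

lemma integrable_imp_nn_integral_powr:
  fixes g :: "'a \<Rightarrow> real"
  assumes "integrable M (\<lambda>x. norm (g x) powr p)" "\<And>x. g x \<ge> 0"
  shows "(\<integral>\<^sup>+x. ennreal (g x powr p) \<partial>M) < \<infinity>"
  using assms by (simp add: integrable_iff_bounded)

text \<open>The equation is invariant under translations, so the centre of symmetry can only be some
  point \<open>a\<close>. Since f is given on the half line, the integrability assumption speaks
  about nonnegative \<open>w\<close>.\<close>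

theorem theorem4:
  fixes f f' f'' :: "real \<Rightarrow> real" and s m :: real and u :: "real^'n \<Rightarrow> real"
  assumes "0 < s" and "s < 1" and "real CARD('n) > 2 * s" and "m \<noteq> 0"
    and "continuous_on {0..} f"
    and "\<And>t. t \<ge> 0 \<Longrightarrow> (f has_real_derivative f' t) (at t within {0..})"
    and "\<And>t. t \<ge> 0 \<Longrightarrow> (f' has_real_derivative f'' t) (at t within {0..})"
    and "\<And>t. t \<ge> 0 \<Longrightarrow> f' t \<ge> 0" and "\<And>t. t \<ge> 0 \<Longrightarrow> f'' t \<ge> 0"
    and "\<And>\<beta>. 1 < \<beta> \<Longrightarrow> \<beta> < crit_exp CARD('n) s - 1 \<Longrightarrow>
           \<exists>q. 2 \<le> q \<and> q \<le> crit_exp CARD('n) s \<and>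
             q > max \<beta> (real CARD('n) * (\<beta> - 1) / (2 * s)) \<and>
             (\<forall>w :: real^'n \<Rightarrow> real. w \<in> Hs m s \<and> (AE x in lebesgue. w x \<ge> 0) \<longrightarrow>
                (\<lambda>x. f' (w x)) \<in> Lp (q / (\<beta> - 1)))"
    and "weak_solution m s f u" and "AE x in lebesgue. u x > 0"
  shows "\<exists>a. radially_decreasing (\<lambda>x. u (x + a))"
proof -
  note s = assms(1) and m = assms(4) and ws = assms(11)
  have m2: "m\<^sup>2 > 0" using m by simp
  have f'_mono: "f' a \<le> f' b" if "0 \<le> a" "a \<le> b" for a b
    by (rule mono_on_of_derivative[OF assms(7,9) that])
  have f_mono: "f a \<le> f b" if "0 \<le> a" "a \<le> b" for a b
    by (rule mono_on_of_derivative[OF assms(6,8) that])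
  have f_lip: "f b - f a \<le> f' b * (b - a)" if ab: "0 \<le> a" "a \<le> b" for a b
  proof (cases "a = b")
    case False
    then obtain \<xi> where \<xi>: "a < \<xi>" "\<xi> < b" "f b - f a = f' \<xi> * (b - a)"
      using mvt_within_atLeast[OF assms(6) ab(1), of b] ab by auto
    have "f' \<xi> * (b - a) \<le> f' b * (b - a)"
      using \<xi> ab by (intro mult_right_mono f'_mono) auto
    then show ?thesis using \<xi> by simp
  qed simp
  \<comment> \<open>Composition with max 0 turns f and f', controlled only on the half line, into
    Borel functions on the whole line, without changing them at the arguments that occur.\<close>
  define fe where "fe t = f (max 0 t)" for t
  define fd where "fd t = f' (max 0 t)" for t
  have max_meas: "(\<lambda>t. k (max 0 t)) \<in> borel_measurable borel" if "continuous_on {0..} k" for k :: "real \<Rightarrow> real"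
  proof (rule borel_measurable_continuous_onI, rule continuous_on_compose2[OF that])
    show "continuous_on UNIV (\<lambda>t::real. max 0 t)"
      by (intro continuous_on_max continuous_on_const continuous_on_id)
  qed auto
  have [measurable]: "fe \<in> borel_measurable borel"
    unfolding fe_def by (rule max_meas[OF assms(5)])
  have "continuous_on {0..} f'"
    using assms(7) by (intro DERIV_continuous_on) auto
  then have [measurable]: "fd \<in> borel_measurable borel"
    unfolding fd_def by (rule max_meas)
  have fd_nn: "fd t \<ge> 0" for t by (simp add: fd_def assms(8))
  obtain p where p: "p > 1" "real CARD('n) / (2 * p) < s"
    and Lp: "\<And>w :: real^'n \<Rightarrow> real. w \<in> Hs m s \<Longrightarrow> (AE x in lebesgue. w x \<ge> 0) \<Longrightarrow> (\<lambda>x. f' (w x)) \<in> Lp p"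
  proof -
    \<comment> \<open>The critical exponent exceeds 2, so its half lies in the admissible range. The
      two lower bounds for q then say that p = q/(\<beta> - 1) is larger than 1 and larger than
      N/(2s).\<close>
    define \<beta> where "\<beta> = crit_exp CARD('n) s / 2"
    have crit: "crit_exp CARD('n) s > 2"
      using s assms(3) by (simp add: crit_exp_def less_divide_eq)
    then have \<beta>: "1 < \<beta>" "\<beta> < crit_exp CARD('n) s - 1"
      by (simp_all add: \<beta>_def)
    obtain q where q: "q > \<beta>" "q > real CARD('n) * (\<beta> - 1) / (2 * s)"
      and w: "\<And>w :: real^'n \<Rightarrow> real. w \<in> Hs m s \<Longrightarrow> (AE x in lebesgue. w x \<ge> 0) \<Longrightarrow> (\<lambda>x. f' (w x)) \<in> Lp (q / (\<beta> - 1))"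
      using assms(10)[OF \<beta>] by auto
    show ?thesis
    proof (rule that[of "q / (\<beta> - 1)"])
      show "1 < q / (\<beta> - 1)"
        using \<beta> q by (simp add: less_divide_eq)
      show "real CARD('n) / (2 * (q / (\<beta> - 1))) < s"
        using \<beta> q s by (simp add: field_simps)
    qed (rule w)
  qed
  have u_Hs: "u \<in> Hs m s"
    using ws by (simp add: weak_solution_def)
  then have "u \<in> borel_measurable lebesgue" and u_sq: "integrable lebesgue (\<lambda>x. norm (u x) powr 2)"
    by (simp_all add: Hs_def Lp_def)
  then obtain v where [measurable]: "v \<in> borel_measurable borel" and v: "AE x in lborel. u x = v x"
    using completion_ex_borel_measurable_real[of u lborel] by auto
  have u_pos: "AE x in lborel. u x > 0"
    using assms(12) by (simp add: AE_completion_iff)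
  \<comment> \<open>Nonnegative at every point, so that no later estimate involving f carries an
    exceptional set.\<close>
  define u0 where "u0 x = max 0 (v x)" for x
  have [measurable]: "u0 \<in> borel_measurable borel"
    unfolding u0_def by measurable
  have u0_nn: "u0 x \<ge> 0" for x by (simp add: u0_def)
  have u0: "AE x in lborel. u x = u0 x"
    using v u_pos by eventually_elim (simp add: u0_def)
  \<comment> \<open>Subtracting f(0) makes the source nonnegative and bounded by \<open>W\<close>
    times \<open>u0\<close>; f(0) itself is treated as a constant source.\<close>
  define h where "h x = fe (u0 x) - f 0" for x
  have [measurable]: "h \<in> borel_measurable borel"
    unfolding h_def by measurable
  have fe_u0: "fe (u0 x) = f (u0 x)" for x by (simp add: fe_def u0_nn max_def)
  have h_nn: "h x \<ge> 0" for x
    unfolding h_def fe_u0 using f_mono[of 0 "u0 x"] u0_nn by simp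
  have fh: "AE x in lborel. f (u x) = h x + f 0"
    using u0 by eventually_elim (simp add: h_def fe_u0)
  define W where "W x = fd (u0 x)" for x
  have [measurable]: "W \<in> borel_measurable borel"
    unfolding W_def by measurable
  have W_nn: "W x \<ge> 0" for x by (simp add: W_def fd_nn)
  have W_eq: "W x = f' (u0 x)" for x by (simp add: W_def fd_def u0_nn max_def)
  define \<kappa> where "\<kappa> = (m\<^sup>2) powr - s"
  have \<kappa>: "\<kappa> \<ge> 0" by (simp add: \<kappa>_def)
  have rep: "AE x in lborel. ennreal (u0 x) + ennreal (max 0 (- f 0) * \<kappa>)
     = (\<integral>\<^sup>+y. ennreal (h y) * bessel_kernel s (m\<^sup>2) (x - y) \<partial>lborel) + ennreal (max 0 (f 0) * \<kappa>)"
    unfolding \<kappa>_def by (rule weak_solution_representation[OF ws s m _ _ u0 u0_nn fh h_nn]) measurable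
  have W_int: "(\<integral>\<^sup>+x. ennreal (W x powr p) \<partial>lborel) < \<infinity>"
  proof (rule integrable_imp_nn_integral_powr[OF _ W_nn])
    have "AE x in lebesgue. u x \<ge> 0"
      using assms(12) by eventually_elim simp
    then have "integrable lebesgue (\<lambda>x. norm (f' (u x)) powr p)"
      using Lp[OF u_Hs] by (simp add: Lp_def)
    moreover have "AE x in lborel. norm (f' (u x)) powr p = norm (W x) powr p"
      using u0 by eventually_elim (simp add: W_eq)
    ultimately show "integrable lborel (\<lambda>x. norm (W x) powr p)"
      by (subst (asm) integral_lebesgue_eq_lborel(2)) simp_all
  qed
  have u0_sq: "integrable lborel (\<lambda>x. (u0 x)\<^sup>2)"
  proof -
    have "integrable lborel (\<lambda>x. norm (u0 x) powr 2)"
      using u_sq by (subst (asm) integral_lebesgue_eq_lborel(2)[where ?f0.0="\<lambda>x. norm (u0 x) powr 2"]) (use u0 in auto)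
    then show ?thesis by simp
  qed
  have hW: "h x \<le> W x * u0 x" for x
    using f_lip[of 0 "u0 x"] u0_nn[of x] by (simp add: h_def fe_u0 W_eq)
  \<comment> \<open>Testing the equation with u itself makes f(u) u integrable, but f(0) u need not
    be. Where u \<le> 1, convexity bounds h u by f'(1) u^2; where u > 1, the product f(0) u is
    dominated by a multiple of u^2.\<close>
  have hu_int: "(\<integral>\<^sup>+x. ennreal (h x * u0 x) \<partial>lborel) < \<infinity>"
  proof -
    have "integrable lebesgue (\<lambda>x. f (u x) * u x)"
      using ws u_Hs by (simp add: weak_solution_def)
    then have "integrable lborel (\<lambda>x. (h x + f 0) * u0 x)"
      by (subst (asm) integral_lebesgue_eq_lborel(2)[where ?f0.0="\<lambda>x. (h x + f 0) * u0 x"])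
         (use u0 fh in auto)
    then have int: "integrable lborel (\<lambda>x. \<bar>(h x + f 0) * u0 x\<bar> + (f' 1 + \<bar>f 0\<bar>) * (u0 x)\<^sup>2)"
      by (intro Bochner_Integration.integrable_add integrable_abs integrable_mult_right u0_sq)
    have le: "h x * u0 x \<le> \<bar>(h x + f 0) * u0 x\<bar> + (f' 1 + \<bar>f 0\<bar>) * (u0 x)\<^sup>2" for x
    proof (cases "u0 x \<le> 1")
      case True
      have "h x * u0 x \<le> (W x * u0 x) * u0 x"
        by (intro mult_right_mono hW u0_nn)
      also have "\<dots> \<le> f' 1 * (u0 x)\<^sup>2"
        unfolding W_eq power2_eq_square mult.assoc using True u0_nn by (intro mult_right_mono f'_mono) auto
      finally have "h x * u0 x \<le> f' 1 * (u0 x)\<^sup>2" .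
      moreover have "0 \<le> \<bar>f 0\<bar> * (u0 x)\<^sup>2"
        by simp
      ultimately show ?thesis
        unfolding distrib_right[of "f' 1"] using abs_ge_zero[of "(h x + f 0) * u0 x"] by linarith
    next
      case False
      have "h x * u0 x = (h x + f 0) * u0 x - f 0 * u0 x"
        by (simp add: algebra_simps)
      also have "\<dots> \<le> \<bar>(h x + f 0) * u0 x\<bar> + \<bar>f 0\<bar> * u0 x"
        using u0_nn[of x] abs_mult[of "f 0" "u0 x"] by linarith
      also have "\<bar>f 0\<bar> * u0 x \<le> (f' 1 + \<bar>f 0\<bar>) * (u0 x)\<^sup>2"
      proof (rule mult_mono)
        show "u0 x \<le> (u0 x)\<^sup>2"
          using False by (simp add: power2_eq_square)
      qed (use assms(8)[of 1] u0_nn in auto)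
      finally show ?thesis by simp
    qed
    have "(\<integral>\<^sup>+x. ennreal (h x * u0 x) \<partial>lborel) \<le> (\<integral>\<^sup>+x. ennreal (norm (\<bar>(h x + f 0) * u0 x\<bar> + (f' 1 + \<bar>f 0\<bar>) * (u0 x)\<^sup>2)) \<partial>lborel)"
      using le by (intro nn_integral_mono ennreal_leI) (auto intro: order_trans[OF _ abs_ge_self])
    also have "\<dots> < \<infinity>"
      using int by (simp add: integrable_iff_bounded)
    finally show ?thesis .
  qed
  have "\<exists>L. AE x in lborel. u0 x \<le> L"
  proof (rule bounded_of_potential[OF s m2 p(1) _ _ _ _ u0_nn h_nn W_nn _ _ hW _ W_int hu_int])
    show "real DIM(real^'n) / (2 * p) < s" using p by simp
    show "AE x in lborel. ennreal (u0 x) \<le> ennreal (max 0 (f 0) * \<kappa>) + (\<integral>\<^sup>+y. ennreal (h y) * bessel_kernel s (m\<^sup>2) (x - y) \<partial>lborel)"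
      using rep
    proof eventually_elim
      case (elim x)
      have "ennreal (u0 x) \<le> ennreal (u0 x) + ennreal (max 0 (- f 0) * \<kappa>)"
        by simp
      then show ?case
        unfolding elim by (simp only: add.commute)
    qed
    show "h x \<le> fe M - f 0" if "u0 x \<le> M" for x M
      unfolding h_def fe_u0 using that u0_nn[of x] f_mono[of "u0 x" M] by (simp add: fe_def max_def)
  qed (use \<kappa> in simp_all)
  then obtain L0 where L0: "AE x in lborel. u0 x \<le> L0"
    by blast
  define L where "L = max 0 L0"
  have L: "L \<ge> 0" "AE x in lborel. u0 x \<le> L"
    using L0 by (auto simp: L_def)
  \<comment> \<open>The cut at the essential bound makes the source bounded at every point, as
    continuity of its potential \<open>U\<close> requires; it changes the source only on a null
    set.\<close>
  define F0 where "F0 x = f (min (u0 x) L)" for x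
  have F0_eq: "F0 x = fe (min (u0 x) L)" for x
    using u0_nn[of x] L by (simp add: F0_def fe_def max_def)
  have [measurable]: "F0 \<in> borel_measurable borel"
    unfolding F0_eq[abs_def] by measurable
  define B where "B = max \<bar>f 0\<bar> \<bar>f L\<bar>"
  have f_bound: "\<bar>f t\<bar> \<le> B" if "0 \<le> t" "t \<le> L" for t
    using f_mono[of 0 t] f_mono[of t L] that by (auto simp: B_def)
  have F0_bound: "\<bar>F0 x\<bar> \<le> B" for x
    unfolding F0_def using u0_nn[of x] L by (intro f_bound) auto
  define U where "U x = (\<integral>y. bessel_potential s (m\<^sup>2) (x - y) * F0 y \<partial>lborel)" for x
  have U_cont: "continuous_on UNIV U"
    unfolding U_def by (rule continuous_bessel_potential_convolution[OF s m2 _ F0_bound]) measurable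
  have [measurable]: "U \<in> borel_measurable borel"
    by (rule borel_measurable_continuous_onI[OF U_cont])
  have u0_U: "AE x in lborel. u0 x = U x"
    using rep
  proof eventually_elim
    case (elim x)
    define G where "G y = bessel_potential s (m\<^sup>2) (x - y)" for y
    have [measurable]: "G \<in> borel_measurable borel" unfolding G_def by measurable
    have G_nn: "G y \<ge> 0" for y by (simp add: G_def)
    have G_int: "integrable lborel G"
      unfolding G_def by (rule integrable_bessel_potential(1)[OF s m2])
    have G_\<kappa>: "integral\<^sup>L lborel G = \<kappa>"
    proof -
      have "ennreal (integral\<^sup>L lborel G) = ennreal \<kappa>"
        using integrable_bessel_potential(2)[OF s m2, of x] nn_integral_eq_integral[OF G_int] G_nn
        unfolding G_def[symmetric] \<kappa>_def by simp
      then show ?thesis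
        using \<kappa> G_nn by (simp add: ennreal_inj integral_nonneg_AE)
    qed
    have GF: "integrable lborel (\<lambda>y. G y * F0 y)"
      unfolding G_def by (rule integrable_bessel_potential_mult[OF s m2 _ F0_bound]) measurable
    \<comment> \<open>A bounded version of \<open>h\<close>. With it the \<open>ennreal\<close>
      identity becomes one between finite real numbers, to which the potential of the constant f(0)
      is added back.\<close>
    define h' where "h' y = F0 y - f 0" for y
    have h'_nn: "h' y \<ge> 0" for y
      unfolding h'_def F0_def using f_mono[of 0 "min (u0 y) L"] u0_nn[of y] L by simp
    have h'_int: "integrable lborel (\<lambda>y. G y * h' y)"
      unfolding h'_def right_diff_distrib by (intro Bochner_Integration.integrable_diff GF integrable_mult_left G_int)
    have U_eq: "U x = (\<integral>y. G y * h' y \<partial>lborel) + f 0 * \<kappa>"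
      unfolding h'_def right_diff_distrib U_def G_def[symmetric] by (simp add: GF G_int G_\<kappa>)
    have "(\<integral>\<^sup>+y. ennreal (h y) * bessel_kernel s (m\<^sup>2) (x - y) \<partial>lborel) = (\<integral>\<^sup>+y. ennreal (h' y) * bessel_kernel s (m\<^sup>2) (x - y) \<partial>lborel)"
      by (rule nn_integral_cong_AE, use L(2) in eventually_elim) (simp add: h_def h'_def fe_u0 F0_def min_def)
    also have "\<dots> = (\<integral>\<^sup>+y. ennreal (h' y) * ennreal (G y) \<partial>lborel)"
      unfolding G_def by (rule nn_integral_bessel_potential[OF s m2, symmetric]) (simp add: h'_def)
    also have "\<dots> = ennreal (\<integral>y. G y * h' y \<partial>lborel)"
      using h'_int h'_nn G_nn by (simp add: nn_integral_eq_integral mult.commute flip: ennreal_mult)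
    finally have "ennreal (u0 x) + ennreal (max 0 (- f 0) * \<kappa>) = ennreal (\<integral>y. G y * h' y \<partial>lborel) + ennreal (max 0 (f 0) * \<kappa>)"
      using elim by simp
    moreover have "(\<integral>y. G y * h' y \<partial>lborel) \<ge> 0"
      using h'_nn G_nn by (intro integral_nonneg_AE) auto
    ultimately have "u0 x + max 0 (- f 0) * \<kappa> = (\<integral>y. G y * h' y \<partial>lborel) + max 0 (f 0) * \<kappa>"
      using u0_nn[of x] \<kappa> by (simp add: ennreal_inj flip: ennreal_plus)
    then show ?case
      using U_eq by (auto simp: max_def split: if_splits)
  qed
  \<comment> \<open>A set of full measure is dense, so closed conditions on the continuous
    \<open>U\<close> pass from almost every point to all points.\<close>
  have U_all: "P x" if "closed {x. P x}" and P: "AE x in lborel. P x" for P and x :: "real^'n"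
    using mem_closed_if_AE_lebesgue[of "{x. P x}" x] that by (simp add: AE_completion_iff)
  have U_nn: "U x \<ge> 0" for x
  proof (rule U_all[of "\<lambda>x. U x \<ge> 0"])
    show "closed {x. 0 \<le> U x}"
      by (intro closed_Collect_le continuous_on_const U_cont)
    show "AE x in lborel. 0 \<le> U x"
      using u0_U by eventually_elim (metis u0_nn)
  qed
  have U_le: "U x \<le> L" for x
  proof (rule U_all[of "\<lambda>x. U x \<le> L"])
    show "closed {x. U x \<le> L}"
      by (intro closed_Collect_le continuous_on_const U_cont)
    show "AE x in lborel. U x \<le> L"
      using u0_U L(2) by eventually_elim simp
  qed
  have fe_U: "fe (U x) = f (U x)" "fd (U x) = f' (U x)" for x
    using U_nn[of x] by (simp_all add: fe_def fd_def max_def)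
  \<comment> \<open>The potential f'(U) is bounded by f'(L), because f' is nondecreasing and U \<le>
    L.\<close>
  interpret moving_planes s "m\<^sup>2" p B "f' L" U "\<lambda>x. f (U x)" "\<lambda>x. f' (U x)"
  proof
    show "\<exists>x. 0 < U x"
    proof (rule ccontr)
      assume none: "\<not> (\<exists>x. 0 < U x)"
      have "AE x in lborel. x \<notin> (UNIV :: (real^'n) set)"
        using u_pos u0 u0_U
      proof eventually_elim
        case (elim x)
        then show ?case using none by auto
      qed
      then have "(UNIV :: (real^'n) set) \<in> null_sets lborel"
        by (subst (asm) AE_iff_null_sets[symmetric]) auto
      then show False by (simp add: null_sets_def)
    qed
    show "(\<lambda>x. f (U x)) \<in> borel_measurable borel" "(\<lambda>x. f' (U x)) \<in> borel_measurable borel"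
      unfolding fe_U[symmetric] by measurable
    show "U x = (\<integral>y. bessel_potential s (m\<^sup>2) (x - y) * f (U y) \<partial>lborel)" for x
      unfolding U_def[of x]
    proof (rule integral_cong_AE)
      show "(\<lambda>y. bessel_potential s (m\<^sup>2) (x - y) * f (U y)) \<in> borel_measurable lborel"
        unfolding fe_U[symmetric] by measurable
      show "AE y in lborel. bessel_potential s (m\<^sup>2) (x - y) * F0 y = bessel_potential s (m\<^sup>2) (x - y) * f (U y)"
        using u0_U L(2) by eventually_elim (simp add: F0_def min_def)
    qed measurable
    show "(\<integral>\<^sup>+x. ennreal (f' (U x) powr p) \<partial>lborel) < \<infinity>"
    proof -
      have "(\<integral>\<^sup>+x. ennreal (f' (U x) powr p) \<partial>lborel) = (\<integral>\<^sup>+x. ennreal (W x powr p) \<partial>lborel)"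
        by (rule nn_integral_cong_AE, use u0_U in eventually_elim) (simp add: W_eq)
      then show ?thesis using W_int by simp
    qed
    show "(\<integral>\<^sup>+x. ennreal ((U x)\<^sup>2) \<partial>lborel) < \<infinity>"
    proof -
      have "(\<integral>\<^sup>+x. ennreal ((U x)\<^sup>2) \<partial>lborel) = (\<integral>\<^sup>+x. ennreal ((u0 x)\<^sup>2) \<partial>lborel)"
        by (rule nn_integral_cong_AE, use u0_U in eventually_elim) simp
      then show ?thesis
        using u0_sq by (simp add: integrable_iff_bounded)
    qed
  qed (use s m2 p U_cont U_nn U_le L f_bound f_mono f_lip f'_mono assms(8) in auto)
  obtain a g where g: "\<And>r t. 0 \<le> r \<Longrightarrow> r < t \<Longrightarrow> g t < (g r :: real)" and Ug: "\<And>x. U (x + a) = g (norm x)"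
    using radial by blast
  have "AE x in lborel. u x = U x"
    using u0 u0_U by eventually_elim simp
  then have "AE x in lborel. u (a + x) = U (a + x)"
    by (rule AE_lborel_translation)
  then have "AE x in lborel. u (x + a) = g (norm x)"
    by eventually_elim (simp add: add.commute Ug[symmetric])
  then have "radially_decreasing (\<lambda>x. u (x + a))"
    unfolding radially_decreasing_def using g by (intro exI[of _ g]) (simp add: AE_completion_iff)
  then show ?thesis by blast
qed

end
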